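(* The space $\mathcal{T}=\Lambda^2\otimes\Lambda^1$ splits into $15$ irreducible $U(2)$-modules, $$\mathcal{T}=\mathcal{T}_{1,1}\oplus\mathcal{T}_{1,2}\oplus\mathcal{T}_{2,1}\oplus\ldots\oplus\mathcal{T}_{2,4}\oplus\mathcal{T}_{3,1}\oplus\ldots\oplus\mathcal{T}_{3,9},$$ where $$\mathcal{T}_1=\mathcal{T}_{1,1}\oplus\mathcal{T}_{1,2},\qquad \mathcal{T}_2=\mathcal{T}_{2,1}\oplus\ldots\oplus\mathcal{T}_{2,4},\qquad \mathcal{T}_3=\mathcal{T}_{3,1}\oplus\ldots\oplus\mathcal{T}_{3,9}.$$
   Context: Local model. $\mathbb{R}^5$ is Euclidean space with scalar product $\langle\cdot,\cdot\rangle$, an orientation and an oriented orthonormal basis $(e_1,\dots,e_5)$; vectors and $1$-forms are identified via $\langle\cdot,\cdot\rangle$; $\Lambda^k$ is the space of $k$-forms on $\mathbb{R}^5$, $*$ the Hodge operator, $\lrcorner$ the interior product, and $(e_1\wedge e_2)(e_1,e_2)=1$. Put $\xi=e_5$, $\eta$ its dual $1$-form, $\varphi$ the endomorphism with $\varphi(e_1)=-e_2$, $\varphi(e_2)=e_1$, $\varphi(e_3)=-e_4$, $\varphi(e_4)=e_3$, $\varphi(\xi)=0$, and $\Phi(X,Y)=\langle X,\varphi(Y)\rangle$, so $\Phi=e_1\wedge e_2+e_3\wedge e_4$. $U(2)=\{B\in O(5): B\xi=\xi,\ B\circ\varphi=\varphi\circ B\}$. Subspaces of forms: $\Lambda^1_1=\mathbb{R}\eta$,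 $\Lambda^1_2=\{\alpha\in\Lambda^1:\xi\lrcorner\alpha=0\}$; $\Lambda^2_1=\mathbb{R}\Phi$, $\Lambda^2_2=\{\alpha\in\Lambda^2:\Phi\wedge\alpha=0,\ *\alpha=\eta\wedge\alpha\}$, $\Lambda^2_3=\{\alpha\in\Lambda^2:*\alpha=-\eta\wedge\alpha\}$, $\Lambda^2_4=\{\alpha\in\Lambda^2:\eta\wedge\alpha=0\}$; $\Lambda^3_i=*\Lambda^2_i$. Spaces of $3$-tensors (for $\alpha\in\Lambda^1,\beta\in\Lambda^2$, $(\alpha\otimes\beta)(X,Y,Z)=\alpha(X)\beta(Y,Z)$): $\mathcal{A}=\Lambda^1\otimes\Lambda^2=\{A\in\otimes^3\Lambda^1: A(X,Y,Z)+A(X,Z,Y)=0\}$, and $\mathcal{A}_3=\{A\in\mathcal{A}: A(X,Y,Z)+A(Y,Z,X)+A(Z,X,Y)=0,\ \sum_iA(e_i,e_i,X)=0\}$. Define $\theta_1(\alpha)(X,Y,Z)=\alpha(Z)\langle X,Y\rangle-\alpha(Y)\langle X,Z\rangle$ for $\alpha\in\Lambda^1$; $\theta_2(\alpha)=\sum_ie_i\otimes(e_i\lrcorner\alpha)$ for $\alpha\in\Lambda^3$; $\theta_3(\alpha)=3\,\eta\otimes\alpha-\theta_2(\eta\wedge\alpha)$ for $\alpha\in\Lambda^2_1\oplus\Lambda^2_2\oplus\Lambda^2_3$; $\theta_4(\alpha)=\sum_ie_i\otimes(\alpha\wedge e_i)+\frac12\theta_2(\alpha\lrcorner(\Phi\wedge\Phi))-3(\alpha\lrcorner\Phi)\otimes\Phi-\eta\otimes(\alpha\wedge\eta)$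 for $\alpha\in\Lambda^1_2$; $\theta_5(\alpha)=\sum_ie_i\otimes(\alpha\wedge e_i)+\theta_2(\alpha\lrcorner(\Phi\wedge\Phi))-6(\alpha\lrcorner\Phi)\otimes\Phi+2\,\eta\otimes(\alpha\wedge\eta)$ for $\alpha\in\Lambda^1_2$. Then $\mathcal{A}_{1,i}=\theta_1(\Lambda^1_i)$ ($i=1,2$); $\mathcal{A}_{2,i}=\theta_2(\Lambda^3_i)$ ($i=1,\dots,4$); $\mathcal{A}_{3,i}=\theta_3(\Lambda^2_i)$ ($i=1,2,3$); $\mathcal{A}_{3,4}=\theta_4(\Lambda^1_2)$; $\mathcal{A}_{3,5}=\theta_5(\Lambda^1_2)$; $\mathcal{A}_{3,6}=\{A\in\mathcal{A}_3:A(X,Y,Z)=A(\varphi X,Y,\varphi Z)+A(\varphi X,\varphi Y,Z)\}$; $\mathcal{A}_{3,7}=\{A\in\mathcal{A}_3:A(X,Y,Z)=-A(X,\varphi Y,\varphi Z)\}$; $\mathcal{A}_{3,8}=\{A\in\mathcal{A}_3:A(X,Y,Z)=-A(\varphi X,Y,\varphi Z)-A(\varphi X,\varphi Y,Z)\}$; $\mathcal{A}_{3,9}=\{A\in\mathcal{A}_3:A(X,Y,Z)=A(X,\varphi Y,\varphi Z)\}$. Torsion side: $\mathcal{T}=\Lambda^2\otimes\Lambda^1=\{T\in\otimes^3\Lambda^1:T(X,Y,Z)+T(Y,X,Z)=0\}$, with $\mathcal{T}_1=\{T\in\mathcal{T}:\exists\alpha\in\Lambda^1: T(X,Y,Z)=\alpha(X)\langle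 Y,Z\rangle-\alpha(Y)\langle X,Z\rangle\}$, $\mathcal{T}_2=\{T\in\mathcal{T}:T(X,Y,Z)+T(X,Z,Y)=0\}$, $\mathcal{T}_3=\{T\in\mathcal{T}:T(X,Y,Z)+T(Y,Z,X)+T(Z,X,Y)=0,\ \sum_iT(X,e_i,e_i)=0\}$. The bijection $\tau:\mathcal{A}\to\mathcal{T}$ is $\tau(A)(X,Y,Z)=A(X,Y,Z)-A(Y,X,Z)$, and $\mathcal{T}_{i,j}:=\tau(\mathcal{A}_{i,j})$. *)

theory Defs
  imports "HOL-Analysis.Analysis" "HOL-Library.Function_Algebras"
begin

section \<open>Functions as a real vector space\<close>

instantiation "fun" :: (type, real_vector) real_vector
begin

definition scaleR_fun_def: "c *\<^sub>R f = (\<lambda>x. c *\<^sub>R f x)"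

instance
  by standard
    (simp_all add: scaleR_fun_def fun_eq_iff scaleR_add_right scaleR_add_left)

end

lemma scaleR_fun_apply [simp]: "(c *\<^sub>R f) x = c *\<^sub>R f x"
  by (simp add: scaleR_fun_def)


section \<open>Direct sums and modules\<close>

text \<open>\<open>V\<close> is the internal direct sum of the subspaces \<open>W i\<close>: every element of \<open>V\<close> is a sum of
  components in the \<open>W i\<close> in exactly one way, and all such sums lie in \<open>V\<close>.\<close>

definition direct_sum :: "'i set \<Rightarrow> ('i \<Rightarrow> 'v::real_vector set) \<Rightarrow> 'v set \<Rightarrow> bool" where
  "direct_sum I W V \<longleftrightarrow>
     (\<forall>i\<in>I. subspace (W i)) \<and> bij_betw (\<lambda>w. \<Sum>i\<in>I. w i) (Pi\<^sub>E I W) V"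

text \<open>A covariant tensor is a function on lists of vectors. A tensor of degree \<open>k\<close> is evaluated on
  lists of length \<open>k\<close> and is zero on all other lists, so that equality of tensors is equality of
  functions.\<close>

type_synonym vec5 = "real ^ 5"
type_synonym tensor = "vec5 list \<Rightarrow> real"

definition tensors :: "nat \<Rightarrow> tensor set" where
  "tensors k = {A. (\<forall>xs. length xs \<noteq> k \<longrightarrow> A xs = 0) \<and>
                   (\<forall>xs i. length xs = k \<and> i < k \<longrightarrow> linear (\<lambda>X. A (xs[i := X])))}"

definition act :: "(vec5 \<Rightarrow> vec5) \<Rightarrow> tensor \<Rightarrow> tensor" where
  "act B A = (\<lambda>xs. A (map (inv B) xs))"

definition is_module :: "(vec5 \<Rightarrow> vec5) set \<Rightarrow> tensor set \<Rightarrow> bool" where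
  "is_module G W \<longleftrightarrow> subspace W \<and> (\<forall>B\<in>G. \<forall>A\<in>W. act B A \<in> W)"

definition irreducible_module :: "(vec5 \<Rightarrow> vec5) set \<Rightarrow> tensor set \<Rightarrow> bool" where
  "irreducible_module G W \<longleftrightarrow>
     is_module G W \<and> W \<noteq> {0} \<and> (\<forall>U. is_module G U \<and> U \<subseteq> W \<longrightarrow> U = {0} \<or> U = W)"


section \<open>Exterior algebra\<close>

definition forms :: "nat \<Rightarrow> tensor set" where
  "forms k = {\<alpha> \<in> tensors k.
     \<forall>xs i j. length xs = k \<and> i < j \<and> j < k \<and> xs ! i = xs ! j \<longrightarrow> \<alpha> xs = 0}"

definition flat :: "vec5 \<Rightarrow> tensor" where
  "flat X = (\<lambda>xs. case xs of [Y] \<Rightarrow> X \<bullet> Y | _ \<Rightarrow> 0)"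

text \<open>Wedge product of a \<open>k\<close>-form and an \<open>l\<close>-form; with the factor \<open>1 / (k! l!)\<close>, the form
  \<open>wedge 1 1 (flat X) (flat Y)\<close> has value 1 on \<open>[X, Y]\<close> if \<open>X\<close> and \<open>Y\<close> are orthonormal.\<close>

definition wedge :: "nat \<Rightarrow> nat \<Rightarrow> tensor \<Rightarrow> tensor \<Rightarrow> tensor" where
  "wedge k l \<alpha> \<beta> = (\<lambda>xs. if length xs = k + l
     then (\<Sum>p | p permutes {..<k + l}. of_int (sign p) *
             \<alpha> (take k (permute_list p xs)) * \<beta> (drop k (permute_list p xs))) / (fact k * fact l)
     else 0)"

definition contract :: "vec5 \<Rightarrow> tensor \<Rightarrow> tensor" where
  "contract X \<alpha> = (\<lambda>xs. \<alpha> (X # xs))"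

text \<open>Tensor product of a 1-form with an arbitrary tensor.\<close>

definition tensor1 :: "tensor \<Rightarrow> tensor \<Rightarrow> tensor" where
  "tensor1 \<alpha> \<beta> = (\<lambda>xs. case xs of [] \<Rightarrow> 0 | X # ys \<Rightarrow> \<alpha> [X] * \<beta> ys)"


section \<open>The local model\<close>

text \<open>The basis \<open>(e 1, \<dots>, e 5)\<close> may be any orthonormal basis. The orientation is the one for which
  it is oriented; it enters only through the volume form.\<close>

definition orthonormal_frame :: "(nat \<Rightarrow> vec5) \<Rightarrow> bool" where
  "orthonormal_frame e \<longleftrightarrow>
     (\<forall>i\<in>{1..5}. \<forall>j\<in>{1..5}. e i \<bullet> e j = (if i = j then 1 else 0))"

context
  fixes e :: "nat \<Rightarrow> vec5"
begin

definition sharp :: "tensor \<Rightarrow> vec5" where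
  "sharp \<alpha> = (\<Sum>i=1..5. \<alpha> [e i] *\<^sub>R e i)"

definition vol :: tensor where
  "vol = (\<lambda>xs. if length xs = 5
     then \<Sum>p | p permutes {..<5}. of_int (sign p) * (\<Prod>i<5. xs ! i \<bullet> e (Suc (p i)))
     else 0)"

text \<open>Hodge operator on \<open>k\<close>-forms, characterised by \<open>\<alpha> \<and> *\<beta> = \<langle>\<alpha>, \<beta>\<rangle> vol\<close>, where the forms
  \<open>e\<^sub>i\<^sub>1 \<and> \<dots> \<and> e\<^sub>i\<^sub>k\<close> with increasing indices are orthonormal. The sum below runs over all index
  sequences, whence the factor \<open>1 / k!\<close>.\<close>

definition hodge :: "nat \<Rightarrow> tensor \<Rightarrow> tensor" where
  "hodge k \<alpha> = (\<lambda>xs. if length xs + k = 5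
     then (\<Sum>js | set js \<subseteq> {1..5} \<and> length js = k. \<alpha> (map e js) * vol (map e js @ xs)) / fact k
     else 0)"

definition xi :: vec5 where "xi = e 5"

definition eta :: tensor where "eta = flat xi"

definition phi :: "vec5 \<Rightarrow> vec5" where
  "phi X = (X \<bullet> e 2) *\<^sub>R e 1 - (X \<bullet> e 1) *\<^sub>R e 2 + (X \<bullet> e 4) *\<^sub>R e 3 - (X \<bullet> e 3) *\<^sub>R e 4"

definition Phi :: tensor where
  "Phi = (\<lambda>xs. case xs of [X, Y] \<Rightarrow> X \<bullet> phi Y | _ \<Rightarrow> 0)"

definition U2 :: "(vec5 \<Rightarrow> vec5) set" where
  "U2 = {B. orthogonal_transformation B \<and> B xi = xi \<and> B \<circ> phi = phi \<circ> B}"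


subsection \<open>Subspaces of forms\<close>

definition Lambda1 :: "nat \<Rightarrow> tensor set" where
  "Lambda1 j =
     (if j = 1 then span {eta}
      else if j = 2 then {\<alpha> \<in> forms 1. contract xi \<alpha> = 0}
      else {})"

definition Lambda2 :: "nat \<Rightarrow> tensor set" where
  "Lambda2 j =
     (if j = 1 then span {Phi}
      else if j = 2 then {\<alpha> \<in> forms 2. wedge 2 2 Phi \<alpha> = 0 \<and> hodge 2 \<alpha> = wedge 1 2 eta \<alpha>}
      else if j = 3 then {\<alpha> \<in> forms 2. hodge 2 \<alpha> = - wedge 1 2 eta \<alpha>}
      else if j = 4 then {\<alpha> \<in> forms 2. wedge 1 2 eta \<alpha> = 0}
      else {})"

definition Lambda3 :: "nat \<Rightarrow> tensor set" where
  "Lambda3 j = hodge 2 ` Lambda2 j"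


subsection \<open>The space \<open>\<A>\<close>\<close>

definition spaceA :: "tensor set" where
  "spaceA = {A \<in> tensors 3. \<forall>X Y Z. A [X, Y, Z] + A [X, Z, Y] = 0}"

definition spaceA3 :: "tensor set" where
  "spaceA3 = {A \<in> spaceA. (\<forall>X Y Z. A [X, Y, Z] + A [Y, Z, X] + A [Z, X, Y] = 0) \<and>
                          (\<forall>X. (\<Sum>i=1..5. A [e i, e i, X]) = 0)}"

definition theta1 :: "tensor \<Rightarrow> tensor" where
  "theta1 \<alpha> = (\<lambda>xs. case xs of [X, Y, Z] \<Rightarrow> \<alpha> [Z] * (X \<bullet> Y) - \<alpha> [Y] * (X \<bullet> Z) | _ \<Rightarrow> 0)"

definition theta2 :: "tensor \<Rightarrow> tensor" where
  "theta2 \<alpha> = (\<Sum>i=1..5. tensor1 (flat (e i)) (contract (e i) \<alpha>))"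

definition theta3 :: "tensor \<Rightarrow> tensor" where
  "theta3 \<alpha> = 3 *\<^sub>R tensor1 eta \<alpha> - theta2 (wedge 1 2 eta \<alpha>)"

definition theta4 :: "tensor \<Rightarrow> tensor" where
  "theta4 \<alpha> = (\<Sum>i=1..5. tensor1 (flat (e i)) (wedge 1 1 \<alpha> (flat (e i))))
     + (1/2) *\<^sub>R theta2 (contract (sharp \<alpha>) (wedge 2 2 Phi Phi))
     - 3 *\<^sub>R tensor1 (contract (sharp \<alpha>) Phi) Phi
     - tensor1 eta (wedge 1 1 \<alpha> eta)"

definition theta5 :: "tensor \<Rightarrow> tensor" where
  "theta5 \<alpha> = (\<Sum>i=1..5. tensor1 (flat (e i)) (wedge 1 1 \<alpha> (flat (e i))))
     + theta2 (contract (sharp \<alpha>) (wedge 2 2 Phi Phi))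
     - 6 *\<^sub>R tensor1 (contract (sharp \<alpha>) Phi) Phi
     + 2 *\<^sub>R tensor1 eta (wedge 1 1 \<alpha> eta)"

definition compA3 :: "nat \<Rightarrow> tensor set" where
  "compA3 j =
     (if j \<in> {1, 2, 3} then theta3 ` Lambda2 j
      else if j = 4 then theta4 ` Lambda1 2
      else if j = 5 then theta5 ` Lambda1 2
      else if j = 6 then
        {A \<in> spaceA3. \<forall>X Y Z. A [X, Y, Z] = A [phi X, Y, phi Z] + A [phi X, phi Y, Z]}
      else if j = 7 then
        {A \<in> spaceA3. \<forall>X Y Z. A [X, Y, Z] = - A [X, phi Y, phi Z]}
      else if j = 8 then
        {A \<in> spaceA3. \<forall>X Y Z. A [X, Y, Z] = - A [phi X, Y, phi Z] - A [phi X, phi Y, Z]}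
      else if j = 9 then
        {A \<in> spaceA3. \<forall>X Y Z. A [X, Y, Z] = A [X, phi Y, phi Z]}
      else {})"

definition compA :: "nat \<Rightarrow> nat \<Rightarrow> tensor set" where
  "compA i j =
     (if i = 1 then theta1 ` Lambda1 j
      else if i = 2 then theta2 ` Lambda3 j
      else if i = 3 then compA3 j
      else {})"


subsection \<open>The space \<open>\<T>\<close> of torsion tensors\<close>

definition spaceT :: "tensor set" where
  "spaceT = {T \<in> tensors 3. \<forall>X Y Z. T [X, Y, Z] + T [Y, X, Z] = 0}"

definition spaceT1 :: "tensor set" where
  "spaceT1 = {T \<in> spaceT. \<exists>\<alpha> \<in> forms 1. \<forall>X Y Z.
                T [X, Y, Z] = \<alpha> [X] * (Y \<bullet> Z) - \<alpha> [Y] * (X \<bullet> Z)}"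

definition spaceT2 :: "tensor set" where
  "spaceT2 = {T \<in> spaceT. \<forall>X Y Z. T [X, Y, Z] + T [X, Z, Y] = 0}"

definition spaceT3 :: "tensor set" where
  "spaceT3 = {T \<in> spaceT. (\<forall>X Y Z. T [X, Y, Z] + T [Y, Z, X] + T [Z, X, Y] = 0) \<and>
                          (\<forall>X. (\<Sum>i=1..5. T [X, e i, e i]) = 0)}"

definition tau :: "tensor \<Rightarrow> tensor" where
  "tau A = (\<lambda>xs. case xs of [X, Y, Z] \<Rightarrow> A [X, Y, Z] - A [Y, X, Z] | _ \<Rightarrow> 0)"

definition compT :: "nat \<Rightarrow> nat \<Rightarrow> tensor set" where
  "compT i j = tau ` compA i j"

end

end

theory Submission
  imports Defs
begin

text \<open>The map \<open>\<tau>\<close> is an equivariant bijection, so it suffices to decompose \<open>\<A>\<close>. Traces and cyclic sums give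
  \<open>\<A> = \<theta>\<^sub>1(\<Lambda>\<^sup>1) \<oplus> \<Lambda>\<^sup>3 \<oplus> \<A>\<^sub>3\<close>, where \<open>\<theta>\<^sub>2\<close> is the identity on 3-forms. A tensor \<open>A \<in> \<A>\<^sub>3\<close> is taken apart step by
  step: \<open>A(\<xi>, Y, Z)\<close> determines the components 1, 2, 3 and 5; the trace of \<open>A(X, \<cdot>, \<cdot>)\<close> against \<open>\<Phi>\<close> then
  determines component 4; the symmetric form \<open>A(X, \<xi>, Z)\<close> of what remains splits under \<open>\<phi>\<close> into components
  6 and 8; and the horizontal rest splits into components 7 and 9 by the sign of \<open>A(X, \<phi>Y, \<phi>Z) = \<plusminus>A(X, Y, Z)\<close>.

  For irreducibility, describe each module by the complex covectors \<open>z1\<close> and \<open>z2\<close> of the horizontal space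
  \<open>\<complex>\<^sup>2\<close>. Up to sign every weight of the maximal torus occurs once, so a submodule is a sum of weight spaces,
  and a rotation that mixes \<open>z1\<close> and \<open>z2\<close> connects these.\<close>

text \<open>Splitting into isotypic parts would not suffice, since several summands are isomorphic:
  \<open>Lambda1 e 2\<close> recurs in \<A> at the index pairs (1,2), (2,4), (3,4), (3,5), and
  \<open>Lambda2 e 3\<close> at (2,3), (3,3), (3,6). Such copies can only be told apart by concrete
  functionals, and this dictates the order of extraction. Both \<open>theta4\<close> and
  \<open>theta5\<close> belong to one family in which trace-freeness leaves one parameter;
  \<open>theta4\<close> is the member that A(\<xi>, Y, Z) cannot see, so component 5 is found before
  component 4.

  Irreducibility is over the reals. A torus element enters projections only through real
  polynomials, which never separate i from -i, and a nonzero weight contributes a real plane that a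
  quarter turn has to fill. The zero weight contributes a real line; among the nontrivial modules it
  occurs in the adjoint one, \<open>Lambda2 e 3\<close>, which is therefore treated separately.
  Rotations with rational entries turn equivariance into polynomial identities. The Hodge conditions
  on 2-forms are replaced by eigenvalues of \<phi>, with which the group commutes by
  definition.\<close>

declare One_nat_def [simp del]

section \<open>Direct sums and modules\<close>

lemma sum_fun_apply [simp]: "(\<Sum>i\<in>I. f i) x = (\<Sum>i\<in>I. f i x)"
  for f :: "'i \<Rightarrow> 'a \<Rightarrow> 'b::comm_monoid_add"
  by (induction I rule: infinite_finite_induct) auto

text \<open>Two families with equal sums differ by a family with sum zero, so uniqueness reduces to
  independence. \<open>restrict\<close> makes an arbitrary witness extensional, as
  \<open>Pi\<^sub>E\<close> demands.\<close>

lemma direct_sumI: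
  assumes "finite I" and sub: "\<And>i. i \<in> I \<Longrightarrow> subspace (W i)"
    and into: "\<And>w. (\<And>i. i \<in> I \<Longrightarrow> w i \<in> W i) \<Longrightarrow> (\<Sum>i\<in>I. w i) \<in> V"
    and onto: "\<And>v. v \<in> V \<Longrightarrow> \<exists>w. (\<forall>i\<in>I. w i \<in> W i) \<and> v = (\<Sum>i\<in>I. w i)"
    and indep: "\<And>w i. (\<And>i. i \<in> I \<Longrightarrow> w i \<in> W i) \<Longrightarrow> (\<Sum>i\<in>I. w i) = 0 \<Longrightarrow> i \<in> I \<Longrightarrow> w i = 0"
  shows "direct_sum I W V"
  unfolding direct_sum_def
proof (intro conjI ballI bij_betwI')
  fix v w assume v: "v \<in> Pi\<^sub>E I W" and w: "w \<in> Pi\<^sub>E I W"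
  show "(\<Sum>i\<in>I. v i) = (\<Sum>i\<in>I. w i) \<longleftrightarrow> v = w"
  proof
    assume eq: "(\<Sum>i\<in>I. v i) = (\<Sum>i\<in>I. w i)"
    have "v i - w i = 0" if "i \<in> I" for i
    proof (rule indep[where w = "\<lambda>i. v i - w i"])
      show "v i - w i \<in> W i" if "i \<in> I" for i
        using that v w sub by (auto intro: subspace_diff)
    qed (use eq that in \<open>auto simp: sum_subtractf\<close>)
    then show "v = w" using v w by (metis PiE_ext right_minus_eq)
  qed simp
next
  fix v assume "v \<in> V"
  then obtain w where "\<forall>i\<in>I. w i \<in> W i" "v = (\<Sum>i\<in>I. w i)" using onto by blast
  then show "\<exists>w\<in>Pi\<^sub>E I W. v = (\<Sum>i\<in>I. w i)"
    by (intro bexI[where x = "restrict w I"]) auto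
qed (use sub into in auto)

text \<open>The families here are arbitrary off \<open>I\<close>, so that function updates with
  default 0 can be inserted without passing to \<open>Pi\<^sub>E\<close>.\<close>

lemma direct_sumD:
  assumes "direct_sum I W V"
  shows "i \<in> I \<Longrightarrow> subspace (W i)"
    and "(\<And>i. i \<in> I \<Longrightarrow> w i \<in> W i) \<Longrightarrow> (\<Sum>i\<in>I. w i) \<in> V"
    and "v \<in> V \<Longrightarrow> \<exists>w. (\<forall>i\<in>I. w i \<in> W i) \<and> v = (\<Sum>i\<in>I. w i)"
    and "(\<And>i. i \<in> I \<Longrightarrow> w i \<in> W i) \<Longrightarrow> (\<Sum>i\<in>I. w i) = 0 \<Longrightarrow> i \<in> I \<Longrightarrow> w i = 0"
proof -
  have sub: "\<And>i. i \<in> I \<Longrightarrow> subspace (W i)"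
    and bij: "bij_betw (\<lambda>w. \<Sum>i\<in>I. w i) (Pi\<^sub>E I W) V"
    using assms by (auto simp: direct_sum_def)
  have restr: "restrict w I \<in> Pi\<^sub>E I W" if "\<And>i. i \<in> I \<Longrightarrow> w i \<in> W i" for w
    using that by auto
  have sum_restr: "(\<Sum>i\<in>I. restrict w I i) = (\<Sum>i\<in>I. w i)" for w
    by (intro sum.cong) auto
  show "i \<in> I \<Longrightarrow> subspace (W i)" by (fact sub)
  show "(\<And>i. i \<in> I \<Longrightarrow> w i \<in> W i) \<Longrightarrow> (\<Sum>i\<in>I. w i) \<in> V"
    using bij restr[of w] sum_restr[of w] by (metis (no_types, lifting) bij_betwE)
  show "\<exists>w. (\<forall>i\<in>I. w i \<in> W i) \<and> v = (\<Sum>i\<in>I. w i)" if "v \<in> V"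
  proof -
    have "v \<in> (\<lambda>w. \<Sum>i\<in>I. w i) ` Pi\<^sub>E I W" using bij that by (simp add: bij_betw_def)
    then show ?thesis by (auto dest: PiE_mem)
  qed
  show "w i = 0" if w: "\<And>i. i \<in> I \<Longrightarrow> w i \<in> W i" and "(\<Sum>i\<in>I. w i) = 0" and i: "i \<in> I"
  proof -
    have "restrict (\<lambda>_. 0) I \<in> Pi\<^sub>E I W" using sub by (intro restr) (auto intro: subspace_0)
    moreover have "(\<Sum>i\<in>I. restrict w I i) = (\<Sum>i\<in>I. restrict (\<lambda>_. 0) I i)"
      unfolding sum_restr using that by simp
    ultimately have "restrict w I = restrict (\<lambda>_. 0) I"
      using bij restr[OF w] by (auto simp: bij_betw_def inj_on_def)
    then show ?thesis using i by (metis restrict_apply')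
  qed
qed

text \<open>Refinement of a direct sum: an inner sum lies in its block, so independence applies to
  the blocks and afterwards within each of them. It turns the three pieces of \<A> into
  fifteen.\<close>

lemma direct_sum_Sigma:
  assumes outer: "direct_sum I U V" and inner: "\<And>i. i \<in> I \<Longrightarrow> direct_sum (J i) (W i) (U i)"
    and fin: "finite I" "\<And>i. i \<in> I \<Longrightarrow> finite (J i)"
  shows "direct_sum (Sigma I J) (\<lambda>(i, j). W i j) V"
proof (rule direct_sumI)
  have split: "(\<Sum>p\<in>Sigma I J. w p) = (\<Sum>i\<in>I. \<Sum>j\<in>J i. w (i, j))" for w
    using fin by (simp add: sum.Sigma)
  have block: "(\<Sum>j\<in>J i. w (i, j)) \<in> U i"
    if "\<And>p. p \<in> Sigma I J \<Longrightarrow> w p \<in> (case p of (i, j) \<Rightarrow> W i j)" "i \<in> I" for w i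
    using that by (intro direct_sumD(2)[OF inner[OF that(2)]]) force
  show "finite (Sigma I J)" using fin by auto
  show "subspace (case p of (i, j) \<Rightarrow> W i j)" if "p \<in> Sigma I J" for p
    using that direct_sumD(1)[OF inner] by auto
  show "(\<Sum>p\<in>Sigma I J. w p) \<in> V"
    if "\<And>p. p \<in> Sigma I J \<Longrightarrow> w p \<in> (case p of (i, j) \<Rightarrow> W i j)" for w
    unfolding split using block[OF that] by (intro direct_sumD(2)[OF outer])
  show "\<exists>w. (\<forall>p\<in>Sigma I J. w p \<in> (case p of (i, j) \<Rightarrow> W i j)) \<and> v = (\<Sum>p\<in>Sigma I J. w p)"
    if v: "v \<in> V" for v
  proof -
    obtain u where u: "\<forall>i\<in>I. u i \<in> U i" "v = (\<Sum>i\<in>I. u i)"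
      using direct_sumD(3)[OF outer v] by blast
    have "\<exists>w. (\<forall>j\<in>J i. w j \<in> W i j) \<and> u i = (\<Sum>j\<in>J i. w j)" if "i \<in> I" for i
      using direct_sumD(3)[OF inner[OF that]] u(1) that by blast
    then obtain w where "\<And>i. i \<in> I \<Longrightarrow> (\<forall>j\<in>J i. w i j \<in> W i j) \<and> u i = (\<Sum>j\<in>J i. w i j)"
      by metis
    then show ?thesis using u(2) by (intro exI[where x = "\<lambda>(i, j). w i j"]) (auto simp: split)
  qed
  show "w p = 0" if w: "\<And>p. p \<in> Sigma I J \<Longrightarrow> w p \<in> (case p of (i, j) \<Rightarrow> W i j)"
    and s: "(\<Sum>p\<in>Sigma I J. w p) = 0" and p: "p \<in> Sigma I J" for w p
  proof -
    obtain i j where ij: "p = (i, j)" "i \<in> I" "j \<in> J i" using p by auto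
    have "(\<Sum>j\<in>J i. w (i, j)) = 0"
      using direct_sumD(4)[OF outer, of "\<lambda>i. \<Sum>j\<in>J i. w (i, j)" i] block[OF w] s ij(2)
      unfolding split by blast
    then have "w (i, j) = 0"
      using direct_sumD(4)[OF inner[OF ij(2)], of "\<lambda>j. w (i, j)" j] w ij by force
    then show ?thesis using ij by simp
  qed
qed

text \<open>Injectivity is asked on \<open>V\<close> only, since \<open>theta1\<close>,
  \<open>hodge\<close> and \<open>tau\<close> are defined on all functions on lists and have large
  kernels there.\<close>

lemma direct_sum_image:
  assumes ds: "direct_sum I W V" and "finite I" and lin: "linear f"
    and inj: "\<And>v. v \<in> V \<Longrightarrow> f v = 0 \<Longrightarrow> v = 0"
  shows "direct_sum I (\<lambda>i. f ` W i) (f ` V)"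
proof (rule direct_sumI)
  have choose: "\<exists>u. (\<forall>i\<in>I. u i \<in> W i \<and> w i = f (u i))"
    if "\<And>i. i \<in> I \<Longrightarrow> w i \<in> f ` W i" for w
    using that by (intro bchoice) auto
  show "(\<Sum>i\<in>I. w i) \<in> f ` V" if w: "\<And>i. i \<in> I \<Longrightarrow> w i \<in> f ` W i" for w
  proof -
    obtain u where u: "\<forall>i\<in>I. u i \<in> W i \<and> w i = f (u i)" using choose[OF w] by blast
    then have "(\<Sum>i\<in>I. w i) = f (\<Sum>i\<in>I. u i)" by (simp add: linear_sum[OF lin])
    then show ?thesis using u direct_sumD(2)[OF ds, of u] by auto
  qed
  show "\<exists>w. (\<forall>i\<in>I. w i \<in> f ` W i) \<and> v = (\<Sum>i\<in>I. w i)" if v: "v \<in> f ` V" for v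
  proof -
    obtain u where "v = f u" "u \<in> V" using v by blast
    moreover obtain w where "\<forall>i\<in>I. w i \<in> W i" "u = (\<Sum>i\<in>I. w i)"
      using direct_sumD(3)[OF ds \<open>u \<in> V\<close>] by blast
    ultimately show ?thesis
      by (intro exI[where x = "\<lambda>i. f (w i)"]) (auto simp: linear_sum[OF lin])
  qed
  show "w i = 0" if w: "\<And>i. i \<in> I \<Longrightarrow> w i \<in> f ` W i" and s: "(\<Sum>i\<in>I. w i) = 0"
    and i: "i \<in> I" for w i
  proof -
    obtain u where u: "\<forall>i\<in>I. u i \<in> W i \<and> w i = f (u i)" using choose[OF w] by blast
    then have "f (\<Sum>i\<in>I. u i) = 0" using s by (simp add: linear_sum[OF lin])
    then have "(\<Sum>i\<in>I. u i) = 0" using u direct_sumD(2)[OF ds, of u] inj by blast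
    then have "u i = 0" using direct_sumD(4)[OF ds, of u i] u i by blast
    then show ?thesis using u i linear_0[OF lin] by simp
  qed
qed (use assms direct_sumD(1)[OF ds] in \<open>auto intro: linear_subspace_image\<close>)

lemma is_module_image:
  assumes W: "is_module G W" and lin: "linear f"
    and equiv: "\<And>B A. B \<in> G \<Longrightarrow> A \<in> W \<Longrightarrow> f (act B A) = act B (f A)"
  shows "is_module G (f ` W)"
  unfolding is_module_def
proof (intro conjI ballI)
  show "subspace (f ` W)" using W lin by (auto simp: is_module_def intro: linear_subspace_image)
  show "act B A \<in> f ` W" if "B \<in> G" "A \<in> f ` W" for A B
    using that W equiv by (auto simp: is_module_def simp flip: equiv)
qed

lemma linear_act: "linear (act B)"
  by (intro linearI) (auto simp: act_def)

text \<open>A submodule of the image is the image of its preimage in \<open>W\<close>; that preimage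
  is a submodule of \<open>W\<close>, hence zero or everything.\<close>

lemma irreducible_module_image:
  assumes irr: "irreducible_module G W" and lin: "linear f"
    and equiv: "\<And>B A. B \<in> G \<Longrightarrow> A \<in> W \<Longrightarrow> f (act B A) = act B (f A)"
    and nz: "\<exists>A\<in>W. f A \<noteq> 0"
  shows "irreducible_module G (f ` W)"
proof -
  have W: "is_module G W" using irr by (simp add: irreducible_module_def)
  show ?thesis
    unfolding irreducible_module_def
  proof (intro conjI allI impI)
    show "is_module G (f ` W)" using is_module_image[OF W lin equiv] .
    show "f ` W \<noteq> {0}" using nz by auto
    fix U assume U: "is_module G U \<and> U \<subseteq> f ` W"
    let ?U = "W \<inter> f -` U"
    have "is_module G ?U"
      unfolding is_module_def
    proof (intro conjI ballI)
      show "subspace ?U"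
        using U W lin by (auto simp: is_module_def intro!: subspace_inter linear_subspace_vimage)
      show "act B A \<in> ?U" if "B \<in> G" "A \<in> ?U" for A B
        using that U W equiv by (auto simp: is_module_def)
    qed
    then have "?U = {0} \<or> ?U = W" using irr by (simp add: irreducible_module_def)
    moreover have "U = f ` ?U" using U by auto
    ultimately show "U = {0} \<or> U = f ` W" using linear_0[OF lin] by auto
  qed
qed

lemma irreducible_moduleI:
  assumes "is_module G W" "v \<in> W" "v \<noteq> 0"
    and "\<And>U A. is_module G U \<Longrightarrow> U \<subseteq> W \<Longrightarrow> A \<in> U \<Longrightarrow> A \<noteq> 0 \<Longrightarrow> W \<subseteq> U"
  shows "irreducible_module G W"
  unfolding irreducible_module_def
proof (intro conjI allI impI)
  fix U assume U: "is_module G U \<and> U \<subseteq> W"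
  show "U = {0} \<or> U = W"
  proof (cases "U \<subseteq> {0}")
    case True
    then show ?thesis using U by (auto simp: is_module_def dest: subspace_0)
  next
    case False
    then show ?thesis using assms(4) U by blast
  qed
qed (use assms in auto)

lemma irreducible_module_span_singleton:
  assumes "v \<noteq> 0" and inv: "\<And>B. B \<in> G \<Longrightarrow> act B v = v"
  shows "irreducible_module G (span {v})"
proof (rule irreducible_moduleI)
  show "is_module G (span {v})"
    using inv subspace_span[of "{v}"]
    by (auto simp: is_module_def span_singleton linear_scale[OF linear_act])
  show "span {v} \<subseteq> U" if U: "is_module G U" "U \<subseteq> span {v}" "A \<in> U" "A \<noteq> 0" for U A
  proof -
    obtain c where c: "A = c *\<^sub>R v" using U by (auto simp: span_singleton)
    then have "v = (1 / c) *\<^sub>R A" using U by simp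
    then have "v \<in> U" using U by (auto simp: is_module_def intro: subspace_scale)
    then show ?thesis using U by (intro span_minimal) (auto simp: is_module_def)
  qed
qed (use assms in \<open>auto simp: span_base\<close>)

section \<open>Tensors of low degree\<close>

lemma tensors_1: "A \<in> tensors 1 \<longleftrightarrow> (\<forall>xs. length xs \<noteq> 1 \<longrightarrow> A xs = 0) \<and> linear (\<lambda>X. A [X])"
proof -
  have "(\<forall>xs i. length xs = 1 \<and> i < 1 \<longrightarrow> linear (\<lambda>X. A (xs[i := X]))) \<longleftrightarrow> linear (\<lambda>X. A [X])"
    by (auto simp: length_Suc_conv One_nat_def)
  then show ?thesis by (simp add: tensors_def)
qed

lemma tensors_2:
  "A \<in> tensors 2 \<longleftrightarrow> (\<forall>xs. length xs \<noteq> 2 \<longrightarrow> A xs = 0) \<and>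
     (\<forall>X Y. linear (\<lambda>W. A [W, Y]) \<and> linear (\<lambda>W. A [X, W]))"
proof -
  have "(\<forall>xs i. length xs = 2 \<and> i < 2 \<longrightarrow> linear (\<lambda>X. A (xs[i := X]))) \<longleftrightarrow>
      (\<forall>X Y. linear (\<lambda>W. A [W, Y]) \<and> linear (\<lambda>W. A [X, W]))" (is "?L \<longleftrightarrow> ?R")
  proof
    assume L: ?L
    show ?R
    proof (intro allI conjI)
      fix X Y
      show "linear (\<lambda>W. A [W, Y])" using L[rule_format, of "[X, Y]" 0] by simp
      show "linear (\<lambda>W. A [X, W])" using L[rule_format, of "[X, Y]" 1] by (simp add: One_nat_def)
    qed
  qed (auto simp: numeral_2_eq_2 less_Suc_eq length_Suc_conv)
  then show ?thesis by (simp add: tensors_def)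
qed

lemma tensors_3:
  "A \<in> tensors 3 \<longleftrightarrow> (\<forall>xs. length xs \<noteq> 3 \<longrightarrow> A xs = 0) \<and>
     (\<forall>X Y Z. linear (\<lambda>W. A [W, Y, Z]) \<and> linear (\<lambda>W. A [X, W, Z]) \<and> linear (\<lambda>W. A [X, Y, W]))"
proof -
  have "(\<forall>xs i. length xs = 3 \<and> i < 3 \<longrightarrow> linear (\<lambda>X. A (xs[i := X]))) \<longleftrightarrow>
      (\<forall>X Y Z. linear (\<lambda>W. A [W, Y, Z]) \<and> linear (\<lambda>W. A [X, W, Z]) \<and> linear (\<lambda>W. A [X, Y, W]))"
    (is "?L \<longleftrightarrow> ?R")
  proof
    assume L: ?L
    show ?R
    proof (intro allI conjI)
      fix X Y Z
      show "linear (\<lambda>W. A [W, Y, Z])" using L[rule_format, of "[X, Y, Z]" 0] by simp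
      show "linear (\<lambda>W. A [X, W, Z])"
        using L[rule_format, of "[X, Y, Z]" 1] by (simp add: One_nat_def)
      show "linear (\<lambda>W. A [X, Y, W])"
        using L[rule_format, of "[X, Y, Z]" 2] by (simp add: numeral_2_eq_2)
    qed
  qed (auto simp: numeral_3_eq_3 less_Suc_eq length_Suc_conv)
  then show ?thesis by (simp add: tensors_def)
qed

lemma linear_cmult: "linear f \<Longrightarrow> linear (\<lambda>x. c * f x)" for f :: "'a::real_vector \<Rightarrow> real"
  using linear_compose_scale_right[of f c] by simp

lemma subspace_tensors: "subspace (tensors k)"
  by (intro subspaceI)
    (auto simp: tensors_def zero_fun_def plus_fun_def scaleR_fun_def
      intro!: module_hom_zero linear_compose_add linear_cmult)

lemma forms_1: "forms 1 = tensors 1"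
  by (auto simp: forms_def)

lemma forms_2: "A \<in> forms 2 \<longleftrightarrow> A \<in> tensors 2 \<and> (\<forall>X. A [X, X] = 0)"
proof -
  have "(\<forall>xs i j. length xs = 2 \<and> i < j \<and> j < 2 \<and> xs ! i = xs ! j \<longrightarrow> A xs = 0) \<longleftrightarrow> (\<forall>X. A [X, X] = 0)"
    (is "?L \<longleftrightarrow> ?R")
  proof
    show ?R if L: ?L
    proof
      fix X show "A [X, X] = 0" using L[rule_format, of "[X, X]" 0 1] by simp
    qed
  qed (auto simp: numeral_2_eq_2 less_Suc_eq length_Suc_conv)
  then show ?thesis by (simp add: forms_def)
qed

lemma forms_3:
  "A \<in> forms 3 \<longleftrightarrow> A \<in> tensors 3 \<and> (\<forall>X Y. A [X, X, Y] = 0 \<and> A [X, Y, X] = 0 \<and> A [Y, X, X] = 0)"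
proof -
  have "(\<forall>xs i j. length xs = 3 \<and> i < j \<and> j < 3 \<and> xs ! i = xs ! j \<longrightarrow> A xs = 0) \<longleftrightarrow>
      (\<forall>X Y. A [X, X, Y] = 0 \<and> A [X, Y, X] = 0 \<and> A [Y, X, X] = 0)"
    (is "?L \<longleftrightarrow> ?R")
  proof
    show ?R if L: ?L
    proof (intro allI conjI)
      fix X Y
      show "A [X, X, Y] = 0" using L[rule_format, of "[X, X, Y]" 0 1] by simp
      show "A [X, Y, X] = 0" using L[rule_format, of "[X, Y, X]" 0 2] by (simp add: numeral_2_eq_2)
      show "A [Y, X, X] = 0"
        using L[rule_format, of "[Y, X, X]" 1 2] by (simp add: numeral_2_eq_2 One_nat_def)
    qed
  qed (auto simp: numeral_3_eq_3 less_Suc_eq length_Suc_conv)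
  then show ?thesis by (simp add: forms_def)
qed

lemma tensor1_eqI:
  assumes "A \<in> tensors 1" "B \<in> tensors 1" "\<And>X. A [X] = B [X]"
  shows "A = B"
proof
  fix xs show "A xs = B xs"
  proof (cases "length xs = 1")
    case True
    then obtain X where "xs = [X]" by (auto simp: length_Suc_conv One_nat_def)
    then show ?thesis using assms by simp
  qed (use assms in \<open>auto simp: tensors_def\<close>)
qed

lemma tensor2_eqI:
  assumes "A \<in> tensors 2" "B \<in> tensors 2" "\<And>X Y. A [X, Y] = B [X, Y]"
  shows "A = B"
proof
  fix xs show "A xs = B xs"
  proof (cases "length xs = 2")
    case True
    then obtain X Y where "xs = [X, Y]" by (auto simp: length_Suc_conv numeral_2_eq_2)
    then show ?thesis using assms by simp
  qed (use assms in \<open>auto simp: tensors_def\<close>)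
qed

lemma tensor3_eqI:
  assumes "A \<in> tensors 3" "B \<in> tensors 3" "\<And>X Y Z. A [X, Y, Z] = B [X, Y, Z]"
  shows "A = B"
proof
  fix xs show "A xs = B xs"
  proof (cases "length xs = 3")
    case True
    then obtain X Y Z where "xs = [X, Y, Z]" by (auto simp: length_Suc_conv numeral_3_eq_3)
    then show ?thesis using assms by simp
  qed (use assms in \<open>auto simp: tensors_def\<close>)
qed

lemma tensor2_simps:
  assumes "A \<in> tensors 2"
  shows "A [X + X', Y] = A [X, Y] + A [X', Y]" "A [X, Y + Y'] = A [X, Y] + A [X, Y']"
    "A [X - X', Y] = A [X, Y] - A [X', Y]" "A [X, Y - Y'] = A [X, Y] - A [X, Y']"
    "A [c *\<^sub>R X, Y] = c * A [X, Y]" "A [X, c *\<^sub>R Y] = c * A [X, Y]"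
    "A [- X, Y] = - A [X, Y]" "A [X, - Y] = - A [X, Y]" "A [0, Y] = 0" "A [X, 0] = 0"
  using assms unfolding tensors_2
  by (auto simp: linear_add[of "\<lambda>W. A [W, _]"] linear_add[of "\<lambda>W. A [_, W]"]
      linear_diff[of "\<lambda>W. A [W, _]"] linear_diff[of "\<lambda>W. A [_, W]"]
      linear_scale[of "\<lambda>W. A [W, _]"] linear_scale[of "\<lambda>W. A [_, W]"]
      linear_neg[of "\<lambda>W. A [W, _]"] linear_neg[of "\<lambda>W. A [_, W]"]
      linear_0[of "\<lambda>W. A [W, _]"] linear_0[of "\<lambda>W. A [_, W]"])

lemma tensor3_simps:
  assumes "A \<in> tensors 3"
  shows "A [X + X', Y, Z] = A [X, Y, Z] + A [X', Y, Z]"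
    "A [X, Y + Y', Z] = A [X, Y, Z] + A [X, Y', Z]"
    "A [X, Y, Z + Z'] = A [X, Y, Z] + A [X, Y, Z']"
    "A [X - X', Y, Z] = A [X, Y, Z] - A [X', Y, Z]"
    "A [X, Y - Y', Z] = A [X, Y, Z] - A [X, Y', Z]"
    "A [X, Y, Z - Z'] = A [X, Y, Z] - A [X, Y, Z']"
    "A [c *\<^sub>R X, Y, Z] = c * A [X, Y, Z]" "A [X, c *\<^sub>R Y, Z] = c * A [X, Y, Z]"
    "A [X, Y, c *\<^sub>R Z] = c * A [X, Y, Z]"
    "A [- X, Y, Z] = - A [X, Y, Z]" "A [X, - Y, Z] = - A [X, Y, Z]"
    "A [X, Y, - Z] = - A [X, Y, Z]"
    "A [0, Y, Z] = 0" "A [X, 0, Z] = 0" "A [X, Y, 0] = 0"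
  using assms unfolding tensors_3
  by (auto simp: linear_add[of "\<lambda>W. A [W, _, _]"] linear_add[of "\<lambda>W. A [_, W, _]"]
      linear_add[of "\<lambda>W. A [_, _, W]"] linear_diff[of "\<lambda>W. A [W, _, _]"]
      linear_diff[of "\<lambda>W. A [_, W, _]"] linear_diff[of "\<lambda>W. A [_, _, W]"]
      linear_scale[of "\<lambda>W. A [W, _, _]"] linear_scale[of "\<lambda>W. A [_, W, _]"]
      linear_scale[of "\<lambda>W. A [_, _, W]"] linear_neg[of "\<lambda>W. A [W, _, _]"]
      linear_neg[of "\<lambda>W. A [_, W, _]"] linear_neg[of "\<lambda>W. A [_, _, W]"]
      linear_0[of "\<lambda>W. A [W, _, _]"] linear_0[of "\<lambda>W. A [_, W, _]"]
      linear_0[of "\<lambda>W. A [_, _, W]"])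

section \<open>Explicit formulas for exterior products\<close>

text \<open>Permutations are enumerated as products of transpositions, so that
  \<open>sign_swap_id\<close> and \<open>sign_compose\<close> yield the signs.\<close>

lemma sum_permutations_2:
  "(\<Sum>p | p permutes {..<2}. f p) = f id + f (Transposition.transpose 0 (1::nat))"
proof -
  have "{..<2} = insert 0 (insert 1 ({}::nat set))" by auto
  then show ?thesis
    by (simp add: sum_over_permutations_insert)
qed

lemma sum_permutations_3:
  "(\<Sum>p | p permutes {..<3}. f p) =
     f id + f (Transposition.transpose 1 2) + f (Transposition.transpose 0 1) + f (Transposition.transpose 0 1 \<circ> Transposition.transpose 1 2)
     + f (Transposition.transpose 0 2) + f (Transposition.transpose 0 2 \<circ> Transposition.transpose 1 (2::nat))"
proof -
  have "{..<3} = insert 0 (insert 1 (insert 2 ({}::nat set)))" by auto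
  then show ?thesis
    by (simp add: sum_over_permutations_insert add.assoc)
qed

lemma permute_list_Cons:
  "permute_list p [X, Y] = [[X, Y] ! p 0, [X, Y] ! p 1]"
  "permute_list p [X, Y, Z] = [[X, Y, Z] ! p 0, [X, Y, Z] ! p 1, [X, Y, Z] ! p 2]"
  "permute_list p [X, Y, Z, W] =
    [[X, Y, Z, W] ! p 0, [X, Y, Z, W] ! p 1, [X, Y, Z, W] ! p 2, [X, Y, Z, W] ! p 3]"
  by (auto simp: permute_list_def numeral_2_eq_2 numeral_3_eq_3 One_nat_def)

lemma take_drop_1: "take 1 (x # xs) = [x]" "drop 1 (x # xs) = xs"
  by (simp_all add: One_nat_def)

lemma wedge_1_1: "wedge 1 1 \<alpha> \<beta> [X, Y] = \<alpha> [X] * \<beta> [Y] - \<alpha> [Y] * \<beta> [X]"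
  unfolding wedge_def
  by (simp add: sum_permutations_2 permute_list_Cons sign_swap_id Transposition.transpose_def take_drop_1)

lemma form2_swap:
  assumes "\<beta> \<in> forms 2"
  shows "\<beta> [Y, X] = - \<beta> [X, Y]"
proof -
  have "\<beta> [X + Y, X + Y] = 0" "\<beta> [X, X] = 0" "\<beta> [Y, Y] = 0" and t: "\<beta> \<in> tensors 2"
    using assms unfolding forms_2 by auto
  then show ?thesis by (simp add: tensor2_simps[OF t])
qed

lemma wedge_1_2:
  assumes "\<beta> \<in> forms 2"
  shows "wedge 1 2 \<alpha> \<beta> [X, Y, Z] = \<alpha> [X] * \<beta> [Y, Z] - \<alpha> [Y] * \<beta> [X, Z] + \<alpha> [Z] * \<beta> [X, Y]"
proof -
  have s: "\<beta> [Z, Y] = - \<beta> [Y, Z]" "\<beta> [Z, X] = - \<beta> [X, Z]" "\<beta> [Y, X] = - \<beta> [X, Y]"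
    by (rule form2_swap[OF assms])+
  show ?thesis
    unfolding wedge_def
    by (simp add: sum_permutations_3 permute_list_Cons sign_swap_id sign_compose permutation_swap_id
        Transposition.transpose_def s take_drop_1 fact_numeral field_simps)
qed

text \<open>The 24 permutations fall into 6 shuffles with 4 equal terms each, which cancels the
  denominator 2! 2!.\<close>

lemma wedge_2_2:
  assumes "\<alpha> \<in> forms 2" "\<beta> \<in> forms 2"
  shows "wedge 2 2 \<alpha> \<beta> [X, Y, Z, W] =
    \<alpha> [X, Y] * \<beta> [Z, W] - \<alpha> [X, Z] * \<beta> [Y, W] + \<alpha> [X, W] * \<beta> [Y, Z]
    + \<alpha> [Y, Z] * \<beta> [X, W] - \<alpha> [Y, W] * \<beta> [X, Z] + \<alpha> [Z, W] * \<beta> [X, Y]"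
proof -
  have "{..<4} = insert 0 (insert 1 (insert 2 (insert 3 ({}::nat set))))" by auto
  then have *: "(\<Sum>p | p permutes {..<4}. f p) = (\<Sum>b\<in>{0, 1, 2, 3}. \<Sum>c\<in>{1, 2, 3}. \<Sum>d\<in>{2, 3}.
      f (Transposition.transpose 0 b \<circ> (Transposition.transpose 1 c \<circ> Transposition.transpose 2 d)))" for f :: "(nat \<Rightarrow> nat) \<Rightarrow> real"
    by (simp add: sum_over_permutations_insert)
  have s: "\<alpha> [Y, X] = - \<alpha> [X, Y]" "\<alpha> [Z, X] = - \<alpha> [X, Z]" "\<alpha> [W, X] = - \<alpha> [X, W]"
    "\<alpha> [Z, Y] = - \<alpha> [Y, Z]" "\<alpha> [W, Y] = - \<alpha> [Y, W]" "\<alpha> [W, Z] = - \<alpha> [Z, W]"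
    "\<beta> [Y, X] = - \<beta> [X, Y]" "\<beta> [Z, X] = - \<beta> [X, Z]" "\<beta> [W, X] = - \<beta> [X, W]"
    "\<beta> [Z, Y] = - \<beta> [Y, Z]" "\<beta> [W, Y] = - \<beta> [Y, W]" "\<beta> [W, Z] = - \<beta> [Z, W]"
    by (rule form2_swap, fact)+
  show ?thesis
    unfolding wedge_def
    by (simp add: * permute_list_Cons sign_swap_id sign_compose permutation_swap_id
        permutation_compose Transposition.transpose_def s take_drop_1 fact_numeral field_simps)
qed

section \<open>The adapted frame\<close>

locale frame =
  fixes e :: "nat \<Rightarrow> vec5"
  assumes orthonormal: "orthonormal_frame e"
begin

abbreviation "\<phi> \<equiv> phi e"
abbreviation "G \<equiv> U2 e"

lemma inner_frame [simp]:
  "i \<in> {1..5} \<Longrightarrow> j \<in> {1..5} \<Longrightarrow> e i \<bullet> e j = (if i = j then 1 else 0)"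
  using orthonormal by (auto simp: orthonormal_frame_def)

lemma sum_1_5: "(\<Sum>i=1..5. f i) = f 1 + f 2 + f 3 + f 4 + f (5::nat)"
  by (simp add: eval_nat_numeral One_nat_def)

lemma ball_1_5: "(\<forall>i\<in>{1..5}. P i) \<longleftrightarrow> P 1 \<and> P 2 \<and> P 3 \<and> P 4 \<and> P (5::nat)"
proof -
  have "{1..5::nat} = {1, 2, 3, 4, 5}" by (auto simp: eval_nat_numeral One_nat_def)
  then show ?thesis by simp
qed

text \<open>Five nonzero orthogonal vectors are independent, hence span the space. The remainder
  lies in their span and is orthogonal to it, so it is orthogonal to itself.\<close>

lemma frame_expand: "X = (\<Sum>i=1..5. (X \<bullet> e i) *\<^sub>R e i)"
proof -
  have inj: "inj_on e {1..5}"
  proof (rule inj_onI)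
    fix i j assume "i \<in> {1..5}" "j \<in> {1..5}" "e i = e j"
    then show "i = j" using inner_frame[of i j] inner_frame[of j j] by (metis zero_neq_one)
  qed
  have "pairwise orthogonal (e ` {1..5})"
    by (auto simp: pairwise_def orthogonal_def)
  moreover have "0 \<notin> e ` {1..5}"
  proof
    assume "0 \<in> e ` {1..5}"
    then obtain i where "i \<in> {1..5}" "e i = 0" by auto
    then show False using inner_frame[of i i] by simp
  qed
  ultimately have "independent (e ` {1..5})" by (rule pairwise_orthogonal_independent)
  then have "UNIV \<subseteq> span (e ` {1..5})"
    using inj by (intro card_ge_dim_independent) (auto simp: card_image)
  then have "X - (\<Sum>i=1..5. (X \<bullet> e i) *\<^sub>R e i) \<in> span (e ` {1..5})" by blast
  moreover have "orthogonal (X - (\<Sum>i=1..5. (X \<bullet> e i) *\<^sub>R e i)) y" if "y \<in> e ` {1..5}" for y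
    using that by (auto simp: orthogonal_def inner_diff_left inner_sum_left if_distrib cong: if_cong)
  ultimately have "orthogonal (X - (\<Sum>i=1..5. (X \<bullet> e i) *\<^sub>R e i)) (X - (\<Sum>i=1..5. (X \<bullet> e i) *\<^sub>R e i))"
    by (rule orthogonal_to_span)
  then show ?thesis by (simp add: orthogonal_self)
qed

lemma linear_frame: "linear f \<Longrightarrow> (\<Sum>i=1..5. (X \<bullet> e i) * f (e i)) = f X"
  for f :: "vec5 \<Rightarrow> real"
  by (subst (2) frame_expand) (simp add: linear_sum linear_scale)

lemma inner_frame_sum: "(\<Sum>i=1..5. (X \<bullet> e i) * (Y \<bullet> e i)) = X \<bullet> Y"
  using linear_frame[of "\<lambda>Z. Y \<bullet> Z" X] by (simp add: linear_iff inner_add_right inner_commute)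

lemma frame_vec_eqI: "(\<And>i. i \<in> {1..5} \<Longrightarrow> X \<bullet> e i = Y \<bullet> e i) \<Longrightarrow> X = Y"
  by (subst frame_expand[of X], subst frame_expand[of Y]) simp

lemma linear_frame_eqI:
  fixes f g :: "vec5 \<Rightarrow> real"
  assumes "linear f" "linear g" "\<And>i. i \<in> {1..5} \<Longrightarrow> f (e i) = g (e i)"
  shows "f X = g X"
proof -
  have "(\<Sum>i=1..5. (X \<bullet> e i) * f (e i)) = (\<Sum>i=1..5. (X \<bullet> e i) * g (e i))"
    using assms(3) by simp
  then show ?thesis unfolding linear_frame[OF assms(1)] linear_frame[OF assms(2)] .
qed

lemma tensor2_frame_eqI:
  assumes A: "A \<in> tensors 2" and B: "B \<in> tensors 2"
    and eq: "\<And>i j. i \<in> {1..5} \<Longrightarrow> j \<in> {1..5} \<Longrightarrow> A [e i, e j] = B [e i, e j]"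
  shows "A = B"
proof (rule tensor2_eqI[OF A B])
  have *: "linear (\<lambda>W. A [W, Y])" "linear (\<lambda>W. A [X, W])"
    "linear (\<lambda>W. B [W, Y])" "linear (\<lambda>W. B [X, W])" for X Y
    using A B by (auto simp: tensors_2)
  have "A [X, e j] = B [X, e j]" if "j \<in> {1..5}" for X j
    using linear_frame_eqI[OF *(1) *(3)] eq that by blast
  then show "A [X, Y] = B [X, Y]" for X Y
    using linear_frame_eqI[OF *(2) *(4)] by blast
qed

lemma tensor3_frame_eqI:
  assumes A: "A \<in> tensors 3" and B: "B \<in> tensors 3"
    and eq: "\<And>i j k. i \<in> {1..5} \<Longrightarrow> j \<in> {1..5} \<Longrightarrow> k \<in> {1..5} \<Longrightarrow> A [e i, e j, e k] = B [e i, e j, e k]"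
  shows "A = B"
proof (rule tensor3_eqI[OF A B])
  have *: "linear (\<lambda>W. A [W, Y, Z])" "linear (\<lambda>W. A [X, W, Z])" "linear (\<lambda>W. A [X, Y, W])"
    "linear (\<lambda>W. B [W, Y, Z])" "linear (\<lambda>W. B [X, W, Z])" "linear (\<lambda>W. B [X, Y, W])" for X Y Z
    using A B by (auto simp: tensors_3)
  have "A [X, e j, e k] = B [X, e j, e k]" if "j \<in> {1..5}" "k \<in> {1..5}" for X j k
    using linear_frame_eqI[OF *(1) *(4)] eq that by blast
  then have "A [X, Y, e k] = B [X, Y, e k]" if "k \<in> {1..5}" for X Y k
    using linear_frame_eqI[OF *(2) *(5)] that by blast
  then show "A [X, Y, Z] = B [X, Y, Z]" for X Y Z
    using linear_frame_eqI[OF *(3) *(6)] by blast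
qed

lemma linear_phi: "linear \<phi>"
  by (intro linearI) (auto simp: phi_def inner_simps algebra_simps)

lemmas phi_add = linear_add[OF linear_phi]
  and phi_scaleR = linear_scale[OF linear_phi]

lemma phi_frame [simp]:
  "\<phi> (e 1) = - e 2" "\<phi> (e 2) = e 1" "\<phi> (e 3) = - e 4" "\<phi> (e 4) = e 3" "\<phi> (e 5) = 0"
  by (auto simp: phi_def)

lemma inner_phi_frame [simp]:
  "\<phi> X \<bullet> e 1 = X \<bullet> e 2" "\<phi> X \<bullet> e 2 = - (X \<bullet> e 1)" "\<phi> X \<bullet> e 3 = X \<bullet> e 4"
  "\<phi> X \<bullet> e 4 = - (X \<bullet> e 3)" "\<phi> X \<bullet> e 5 = 0"
  by (auto simp: phi_def inner_simps)

lemma phi_phi: "\<phi> (\<phi> X) = (X \<bullet> e 5) *\<^sub>R e 5 - X"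
proof (rule frame_vec_eqI)
  have "\<forall>i\<in>{1..5}. \<phi> (\<phi> X) \<bullet> e i = ((X \<bullet> e 5) *\<^sub>R e 5 - X) \<bullet> e i"
    unfolding ball_1_5 by (simp add: inner_diff_left)
  then show "i \<in> {1..5} \<Longrightarrow> \<phi> (\<phi> X) \<bullet> e i = ((X \<bullet> e 5) *\<^sub>R e 5 - X) \<bullet> e i" for i
    by blast
qed

lemma inner_phi_left: "\<phi> X \<bullet> Y = - (X \<bullet> \<phi> Y)"
  unfolding phi_def by (simp add: inner_simps inner_commute)

lemma inner_e5_phi [simp]: "e 5 \<bullet> \<phi> X = 0"
  using inner_phi_frame(5)[of X] by (simp add: inner_commute)

text \<open>The structure group acts on tensors by precomposition with the inverse; as \<^term>\<open>G\<close> is closed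
  under inverses, both directions reduce to precomposition with a group element.\<close>

lemma in_G_iff:
  "B \<in> G \<longleftrightarrow> linear B \<and> (\<forall>X Y. B X \<bullet> B Y = X \<bullet> Y) \<and> B (e 5) = e 5 \<and> (\<forall>X. B (\<phi> X) = \<phi> (B X))"
  by (auto simp: U2_def orthogonal_transformation_def xi_def fun_eq_iff)

lemma orthogonal_transformation_G: "C \<in> G \<Longrightarrow> orthogonal_transformation C"
  by (simp add: U2_def)

lemma bij_G: "C \<in> G \<Longrightarrow> bij C"
  unfolding bij_def
  using orthogonal_transformation_inj orthogonal_transformation_surj orthogonal_transformation_G
  by metis

lemma inv_in_G:
  assumes "B \<in> G"
  shows "inv B \<in> G"
proof -
  have ot: "orthogonal_transformation B" by (rule orthogonal_transformation_G[OF assms])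
  have B: "B (e 5) = e 5" "\<And>X. B (\<phi> X) = \<phi> (B X)" using assms by (simp_all add: in_G_iff)
  have "inj B" "surj B" using bij_G[OF assms] by (auto simp: bij_def)
  have "inv B (e 5) = e 5" using B(1) \<open>inj B\<close> by (metis inv_f_f)
  moreover have "inv B (\<phi> X) = \<phi> (inv B X)" for X
    using B(2) \<open>inj B\<close> \<open>surj B\<close> by (metis inv_f_f surj_f_inv_f)
  moreover have "orthogonal_transformation (inv B)" using ot by (rule orthogonal_transformation_inv)
  ultimately show ?thesis by (auto simp: in_G_iff orthogonal_transformation_def)
qed

lemma inv_inv_G: "B \<in> G \<Longrightarrow> inv (inv B) = B"
  by (rule inv_inv_eq[OF bij_G])

definition pull :: "(vec5 \<Rightarrow> vec5) \<Rightarrow> tensor \<Rightarrow> tensor" where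
  "pull C A = (\<lambda>xs. A (map C xs))"

lemma act_eq_pull: "act B A = pull (inv B) A"
  by (simp add: act_def pull_def)

lemma pull_eq_act: "C \<in> G \<Longrightarrow> pull C A = act (inv C) A"
  by (simp add: act_eq_pull inv_inv_G)

lemma is_module_G_iff: "is_module G W \<longleftrightarrow> subspace W \<and> (\<forall>C\<in>G. \<forall>A\<in>W. pull C A \<in> W)"
  unfolding is_module_def using inv_in_G by (metis act_eq_pull pull_eq_act)

lemma pull_eval:
  "pull C A [X] = A [C X]" "pull C A [X, Y] = A [C X, C Y]"
  "pull C A [X, Y, Z] = A [C X, C Y, C Z]"
  by (auto simp: pull_def)

lemma pull_tensors:
  assumes "linear C"
  shows "A \<in> tensors k \<Longrightarrow> pull C A \<in> tensors k"
  using assms by (auto simp: tensors_def pull_def map_update o_def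
      intro!: linear_compose[of C "\<lambda>X. A (_[_ := X])", unfolded o_def])

lemma G_D:
  assumes "C \<in> G"
  shows "linear C" "C X \<bullet> C Y = X \<bullet> Y" "C (e 5) = e 5" "C (\<phi> X) = \<phi> (C X)"
    "e 5 \<bullet> C X = e 5 \<bullet> X" "C X \<bullet> e 5 = X \<bullet> e 5"
proof -
  show *: "linear C" "C X \<bullet> C Y = X \<bullet> Y" "C (e 5) = e 5" "C (\<phi> X) = \<phi> (C X)" for X Y
    using assms by (auto simp: in_G_iff)
  show "e 5 \<bullet> C X = e 5 \<bullet> X" using *(2)[of "e 5" X] *(3) by simp
  then show "C X \<bullet> e 5 = X \<bullet> e 5" by (simp add: inner_commute)
qed

text \<open>Expanding both slots in the frame produces the Gram matrix of the vectors
  \<open>inv C (e j)\<close>, which is the identity. This carries the trace conditions in the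
  definitions over to \<open>pull C A\<close>.\<close>

lemma trace_G:
  fixes f :: "vec5 \<Rightarrow> vec5 \<Rightarrow> real"
  assumes lin: "\<And>Y. linear (\<lambda>X. f X Y)" "\<And>X. linear (f X)" and C: "C \<in> G"
  shows "(\<Sum>i=1..5. f (C (e i)) (C (e i))) = (\<Sum>i=1..5. f (e i) (e i))"
proof -
  let ?D = "inv C"
  have surj: "C (?D X) = X" for X
    using bij_G[OF C] by (simp add: bij_is_surj surj_f_inv_f)
  have dual: "C X \<bullet> Y = X \<bullet> ?D Y" for X Y
    using G_D(2)[OF C, of X "?D Y"] surj by simp
  have expand: "f (C X) (C X) = (\<Sum>j=1..5. \<Sum>k=1..5. (X \<bullet> ?D (e j)) * (X \<bullet> ?D (e k)) * f (e j) (e k))" for X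
  proof -
    have "f (C X) (C X) = (\<Sum>j=1..5. (C X \<bullet> e j) * f (e j) (C X))"
      using linear_frame[OF lin(1)] by simp
    also have "\<dots> = (\<Sum>j=1..5. (C X \<bullet> e j) * (\<Sum>k=1..5. (C X \<bullet> e k) * f (e j) (e k)))"
      using linear_frame[OF lin(2)] by simp
    finally show ?thesis by (simp add: sum_distrib_left dual mult.assoc)
  qed
  have orth: "(\<Sum>i=1..5. (e i \<bullet> ?D (e j)) * (e i \<bullet> ?D (e k))) = e j \<bullet> e k" for j k
    using inner_frame_sum[of "?D (e j)" "?D (e k)"] G_D(2)[OF inv_in_G[OF C]]
    by (simp add: inner_commute)
  have "(\<Sum>i=1..5. f (C (e i)) (C (e i))) =
      (\<Sum>j=1..5. \<Sum>k=1..5. (\<Sum>i=1..5. (e i \<bullet> ?D (e j)) * (e i \<bullet> ?D (e k))) * f (e j) (e k))"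
    unfolding expand sum_distrib_right
    by (subst sum.swap, rule sum.cong[OF refl], rule sum.swap)
  also have "\<dots> = (\<Sum>j=1..5. \<Sum>k=1..5. if j = k then f (e j) (e k) else 0)"
    unfolding orth by (intro sum.cong) auto
  finally show ?thesis by simp
qed

end

section \<open>The spaces \<open>\<A>\<close> and \<open>\<T>\<close>\<close>

lemma linear_tau: "linear tau"
  by (intro linearI) (auto simp: tau_def fun_eq_iff algebra_simps split: list.split)

lemma tau_eval [simp]: "tau A [X, Y, Z] = A [X, Y, Z] - A [Y, X, Z]"
  by (simp add: tau_def)

lemma tau_tensors:
  assumes "A \<in> tensors 3"
  shows "tau A \<in> tensors 3"
  unfolding tensors_3
proof (intro conjI allI impI)
  show "length xs \<noteq> 3 \<Longrightarrow> tau A xs = 0" for xs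
    by (auto simp: tau_def split: list.split)
qed (intro linearI; simp add: tensor3_simps[OF assms] algebra_simps)+

lemma spaceA_iff: "A \<in> spaceA \<longleftrightarrow> A \<in> tensors 3 \<and> (\<forall>X Y Z. A [X, Z, Y] = - A [X, Y, Z])"
  unfolding spaceA_def by (simp add: eq_neg_iff_add_eq_0 add.commute)

lemma spaceA_swap: "A \<in> spaceA \<Longrightarrow> A [X, Z, Y] = - A [X, Y, Z]"
  unfolding spaceA_iff by blast

lemma spaceA_tensors: "A \<in> spaceA \<Longrightarrow> A \<in> tensors 3"
  by (simp add: spaceA_def)

lemma subspace_spaceA: "subspace spaceA"
proof -
  have "A + B \<in> spaceA" if A: "A \<in> spaceA" and B: "B \<in> spaceA" for A B
    unfolding spaceA_def
  proof (intro CollectI conjI allI)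
    show "A + B \<in> tensors 3" using A B spaceA_tensors subspace_add[OF subspace_tensors] by blast
    show "(A + B) [X, Y, Z] + (A + B) [X, Z, Y] = 0" for X Y Z
      by (simp add: spaceA_swap[OF A, of X Z Y] spaceA_swap[OF B, of X Z Y])
  qed
  then show ?thesis
    using subspace_tensors[of 3] by (auto simp: subspace_def spaceA_def simp flip: distrib_left)
qed

text \<open>In the kernel, \<open>A\<close> is symmetric in the first two slots and skew in the last
  two. Alternating these exchanges three times each returns to the initial order with the sign
  -1.\<close>

lemma tau_inj_on_spaceA:
  assumes A: "A \<in> spaceA" and z: "tau A = 0"
  shows "A = 0"
proof (rule tensor3_eqI)
  show "A \<in> tensors 3" using A by (simp add: spaceA_def)
  show "0 \<in> tensors 3" using subspace_tensors by (rule subspace_0)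
  have s: "A [X, Z, Y] = - A [X, Y, Z]" for X Y Z using A by (rule spaceA_swap)
  have t: "A [X, Y, Z] = A [Y, X, Z]" for X Y Z using fun_cong[OF z, of "[X, Y, Z]"] by simp
  show "A [X, Y, Z] = 0 [X, Y, Z]" for X Y Z
    using s[of X Y Z] t[of X Y Z] s[of Y X Z] t[of Y Z X] s[of Z X Y] t[of X Z Y] by simp
qed

text \<open>The Koszul formula, which recovers the difference of two metric connections from the
  difference of their torsions.\<close>

definition tau_inv :: "tensor \<Rightarrow> tensor" where
  "tau_inv T = (\<lambda>xs. case xs of [X, Y, Z] \<Rightarrow> (T [X, Y, Z] - T [Y, Z, X] + T [Z, X, Y]) / 2 | _ \<Rightarrow> 0)"

lemma tau_inv_eval [simp]: "tau_inv T [X, Y, Z] = (T [X, Y, Z] - T [Y, Z, X] + T [Z, X, Y]) / 2"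
  by (simp add: tau_inv_def)

lemma tau_inv_tensors:
  assumes "T \<in> tensors 3"
  shows "tau_inv T \<in> tensors 3"
  unfolding tensors_3
proof (intro conjI allI impI)
  show "length xs \<noteq> 3 \<Longrightarrow> tau_inv T xs = 0" for xs
    by (auto simp: tau_inv_def split: list.split)
qed (intro linearI; simp add: tensor3_simps[OF assms] field_simps)+

lemma spaceT_iff: "T \<in> spaceT \<longleftrightarrow> T \<in> tensors 3 \<and> (\<forall>X Y Z. T [Y, X, Z] = - T [X, Y, Z])"
  unfolding spaceT_def by (simp add: eq_neg_iff_add_eq_0 add.commute)

lemma spaceT_swap: "T \<in> spaceT \<Longrightarrow> T [Y, X, Z] = - T [X, Y, Z]"
  unfolding spaceT_iff by blast

lemma spaceT_tensors: "T \<in> spaceT \<Longrightarrow> T \<in> tensors 3"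
  by (simp add: spaceT_def)

lemma tau_inv_spaceT:
  assumes T: "T \<in> spaceT"
  shows "tau_inv T \<in> spaceA" "tau (tau_inv T) = T"
proof -
  have s: "T [Y, X, Z] = - T [X, Y, Z]" for X Y Z using T by (rule spaceT_swap)
  have t: "T \<in> tensors 3" using T by (rule spaceT_tensors)
  show "tau_inv T \<in> spaceA"
    unfolding spaceA_iff
  proof (intro conjI allI)
    fix X Y Z
    show "tau_inv T [X, Z, Y] = - tau_inv T [X, Y, Z]"
      by (simp add: s[of X Z Y] s[of Z Y X] s[of Y X Z] field_simps)
  qed (rule tau_inv_tensors[OF t])
  show "tau (tau_inv T) = T"
  proof (rule tensor3_eqI[OF tau_tensors[OF tau_inv_tensors[OF t]] t])
    show "tau (tau_inv T) [X, Y, Z] = T [X, Y, Z]" for X Y Z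
      by (simp add: s[of X Z Y] s[of Z Y X] s[of Y X Z] field_simps)
  qed
qed

lemma tau_spaceA: "tau ` spaceA = spaceT"
proof
  show "tau ` spaceA \<subseteq> spaceT" by (auto simp: spaceA_tensors spaceT_iff tau_tensors)
  show "spaceT \<subseteq> tau ` spaceA" using tau_inv_spaceT by (metis image_eqI subsetI)
qed

lemma tau_image_subset:
  assumes "U \<subseteq> spaceT" "\<And>T. T \<in> U \<Longrightarrow> tau_inv T \<in> W"
  shows "U \<subseteq> tau ` W"
proof
  fix T assume "T \<in> U"
  then have "T = tau (tau_inv T)" "tau_inv T \<in> W" using assms tau_inv_spaceT(2) by auto
  then show "T \<in> tau ` W" by (rule image_eqI)
qed

section \<open>Trace part, totally skew part and the rest of \<A>\<close>

lemma theta1_eval [simp]: "theta1 \<alpha> [X, Y, Z] = \<alpha> [Z] * (X \<bullet> Y) - \<alpha> [Y] * (X \<bullet> Z)"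
  by (simp add: theta1_def)

lemma theta1_spaceA:
  assumes "\<alpha> \<in> tensors 1"
  shows "theta1 \<alpha> \<in> spaceA"
  unfolding spaceA_iff tensors_3
proof (intro conjI allI impI)
  show "length xs \<noteq> 3 \<Longrightarrow> theta1 \<alpha> xs = 0" for xs
    by (auto simp: theta1_def split: list.split)
  have \<alpha>: "\<alpha> [X + Y] = \<alpha> [X] + \<alpha> [Y]" "\<alpha> [c *\<^sub>R X] = c * \<alpha> [X]" for X Y c
    using assms by (auto simp: tensors_1 linear_iff)
  show "linear (\<lambda>W. theta1 \<alpha> [W, Y, Z])" "linear (\<lambda>W. theta1 \<alpha> [X, W, Z])"
    "linear (\<lambda>W. theta1 \<alpha> [X, Y, W])" for X Y Z
    by (intro linearI; simp add: \<alpha> inner_simps algebra_simps)+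
qed simp

lemma linear_theta1: "linear theta1"
  by (intro linearI) (auto simp: theta1_def fun_eq_iff algebra_simps split: list.split)

lemma form3_swap:
  assumes "A \<in> forms 3"
  shows "A [Y, X, Z] = - A [X, Y, Z]" "A [X, Z, Y] = - A [X, Y, Z]"
proof -
  have t: "A \<in> tensors 3" and a: "A [X + Y, X + Y, Z] = 0" "A [X, X, Z] = 0" "A [Y, Y, Z] = 0"
    "A [X, Y + Z, Y + Z] = 0" "A [X, Y, Y] = 0" "A [X, Z, Z] = 0"
    using assms by (auto simp: forms_3)
  show "A [Y, X, Z] = - A [X, Y, Z]" "A [X, Z, Y] = - A [X, Y, Z]"
    using a by (simp_all add: tensor3_simps[OF t])
qed

lemma form3_cyclic: "A \<in> forms 3 \<Longrightarrow> A [Y, Z, X] = A [X, Y, Z]"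
  using form3_swap[of A] by (metis minus_minus)

lemma forms_3_iff:
  "A \<in> forms 3 \<longleftrightarrow> A \<in> tensors 3 \<and> (\<forall>X Y Z. A [Y, X, Z] = - A [X, Y, Z] \<and> A [X, Z, Y] = - A [X, Y, Z])"
    (is "_ \<longleftrightarrow> ?R")
proof
  show "A \<in> forms 3 \<Longrightarrow> ?R" using form3_swap unfolding forms_3 by blast
  assume R: ?R
  then have s: "A [Y, X, Z] = - A [X, Y, Z]" "A [X, Z, Y] = - A [X, Y, Z]" for X Y Z by blast+
  show "A \<in> forms 3"
    unfolding forms_3
  proof (intro conjI allI)
    fix X Y
    show "A [X, X, Y] = 0" "A [Y, X, X] = 0" using s(1)[of X X Y] s(2)[of Y X X] by auto
    then show "A [X, Y, X] = 0" using s(2)[of X Y X] by simp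
  qed (use R in blast)
qed

lemma forms_3_spaceA: "forms 3 \<subseteq> spaceA"
  by (intro subsetI) (unfold forms_3_iff spaceA_iff, blast)

lemma subspace_forms_3: "subspace (forms 3)"
  using subspace_tensors[of 3] by (auto simp: subspace_def forms_3)

context frame
begin

lemma spaceA3_iff: "A \<in> spaceA3 e \<longleftrightarrow> A \<in> spaceA \<and>
    (\<forall>X Y Z. A [X, Y, Z] + A [Y, Z, X] + A [Z, X, Y] = 0) \<and> (\<forall>X. (\<Sum>i=1..5. A [e i, e i, X]) = 0)"
  by (simp add: spaceA3_def)

lemma subspace_spaceA3: "subspace (spaceA3 e)"
  unfolding subspace_def
proof (intro conjI ballI allI)
  fix A B assume A: "A \<in> spaceA3 e" and B: "B \<in> spaceA3 e"
  show "A + B \<in> spaceA3 e"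
    unfolding spaceA3_iff
  proof (intro conjI allI)
    show "A + B \<in> spaceA" using A B subspace_add[OF subspace_spaceA] by (simp add: spaceA3_iff)
    fix X Y Z
    have "A [X, Y, Z] + A [Y, Z, X] + A [Z, X, Y] = 0" "B [X, Y, Z] + B [Y, Z, X] + B [Z, X, Y] = 0"
      using A B by (simp_all add: spaceA3_iff)
    then show "(A + B) [X, Y, Z] + (A + B) [Y, Z, X] + (A + B) [Z, X, Y] = 0"
      unfolding plus_fun_apply by linarith
    show "(\<Sum>i=1..5. (A + B) [e i, e i, X]) = 0"
      using A B by (simp add: spaceA3_iff sum.distrib)
  qed
next
  fix c A assume A: "A \<in> spaceA3 e"
  then show "c *\<^sub>R A \<in> spaceA3 e"
    using subspace_scale[OF subspace_spaceA]
    by (simp add: spaceA3_iff flip: sum_distrib_left distrib_left)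
qed (simp add: spaceA3_iff subspace_0[OF subspace_spaceA])

lemma linear_frame_simps:
  fixes f :: "vec5 \<Rightarrow> real"
  assumes "linear f"
  shows "(\<Sum>i=1..5. (X \<bullet> e i) * f (e i)) = f X" "(\<Sum>i=1..5. (e i \<bullet> X) * f (e i)) = f X"
    "(\<Sum>i=1..5. f (e i) * (X \<bullet> e i)) = f X" "(\<Sum>i=1..5. f (e i) * (e i \<bullet> X)) = f X"
  using linear_frame[OF assms, of X] by (simp_all add: inner_commute mult.commute)

text \<open>The factor is 5 - 1: the first term of \<open>theta1\<close> is summed over five frame
  vectors, the second reproduces \<alpha>(X) once.\<close>

lemma theta1_trace:
  assumes "\<alpha> \<in> tensors 1"
  shows "(\<Sum>i=1..5. theta1 \<alpha> [e i, e i, X]) = 4 * \<alpha> [X]"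
proof -
  have "linear (\<lambda>X. \<alpha> [X])" using assms by (simp add: tensors_1)
  then show ?thesis by (simp add: sum_subtractf linear_frame_simps[of "\<lambda>X. \<alpha> [X]"])
qed

lemma direct_sum_spaceA:
  "direct_sum {1, 2, 3} ((\<lambda>_::nat. {})(1 := theta1 ` forms 1, 2 := forms 3, 3 := spaceA3 e)) spaceA"
    (is "direct_sum {1, 2, 3} ?W spaceA")
proof (rule direct_sumI)
  fix i :: nat assume "i \<in> {1, 2, 3}"
  then show "subspace (?W i)"
    using subspace_forms_3 subspace_spaceA3 linear_subspace_image[OF linear_theta1 subspace_tensors[of 1]]
    by (auto simp: forms_1)
next
  fix w assume "\<And>i. i \<in> {1, 2, 3} \<Longrightarrow> w i \<in> ?W i"
  from this[of 1] this[of 2] this[of 3] have "w 1 \<in> spaceA" "w 2 \<in> spaceA" "w 3 \<in> spaceA"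
    using forms_3_spaceA by (auto simp: forms_1 theta1_spaceA spaceA3_iff)
  then show "(\<Sum>i\<in>{1, 2, 3}. w i) \<in> spaceA"
    using subspace_add[OF subspace_spaceA] by simp
next
  fix A assume A: "A \<in> spaceA"
  then have s: "A [X, Z, Y] = - A [X, Y, Z]" for X Y Z by (rule spaceA_swap)
  have t: "A \<in> tensors 3" using A by (rule spaceA_tensors)
  \<comment> \<open>The divisors 4 and 3 normalise the two projections: \<open>theta1\<close>
    multiplies the trace by 4, and the cyclic sum of a 3-form is three times the form.\<close>
  define \<alpha> where "\<alpha> = (\<lambda>xs. case xs of [X] \<Rightarrow> (\<Sum>i=1..5. A [e i, e i, X]) / 4 | _ \<Rightarrow> 0)"
  define B where "B = (\<lambda>xs. case xs of [X, Y, Z] \<Rightarrow> (A [X, Y, Z] + A [Y, Z, X] + A [Z, X, Y]) / 3 | _ \<Rightarrow> 0)"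
  define C where "C = A - theta1 \<alpha> - B"
  have \<alpha>: "\<alpha> \<in> tensors 1"
    unfolding tensors_1
  proof
    show "\<forall>xs. length xs \<noteq> 1 \<longrightarrow> \<alpha> xs = 0" by (auto simp: \<alpha>_def split: list.split)
    show "linear (\<lambda>X. \<alpha> [X])"
      by (intro linearI) (simp_all add: \<alpha>_def tensor3_simps[OF t] sum.distrib add_divide_distrib
          flip: sum_distrib_left)
  qed
  have B_eval: "B [X, Y, Z] = (A [X, Y, Z] + A [Y, Z, X] + A [Z, X, Y]) / 3" for X Y Z
    by (simp add: B_def)
  have B: "B \<in> forms 3"
    unfolding forms_3_iff tensors_3
  proof (intro conjI allI impI)
    show "length xs \<noteq> 3 \<Longrightarrow> B xs = 0" for xs by (auto simp: B_def split: list.split)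
    show "linear (\<lambda>W. B [W, Y, Z])" "linear (\<lambda>W. B [X, W, Z])" "linear (\<lambda>W. B [X, Y, W])" for X Y Z
      by (intro linearI; simp add: B_eval tensor3_simps[OF t] field_simps)+
    show "B [Y, X, Z] = - B [X, Y, Z]" "B [X, Z, Y] = - B [X, Y, Z]" for X Y Z
      by (simp_all add: B_eval s[of X Z Y] s[of Z Y X] s[of Y X Z] field_simps)
  qed
  have "B \<in> spaceA" using B forms_3_spaceA by blast
  then have "C \<in> spaceA"
    unfolding C_def using A theta1_spaceA[OF \<alpha>] subspace_diff[OF subspace_spaceA] by blast
  \<comment> \<open>The cyclic sum annihilates \<open>theta1 \<alpha>\<close> and yields
    \<open>3 * B [X, Y, Z]\<close> for both \<open>A\<close> and \<open>B\<close>.\<close>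
  moreover have "C [X, Y, Z] + C [Y, Z, X] + C [Z, X, Y] = 0" for X Y Z
    by (simp add: C_def B_eval inner_commute field_simps)
  moreover have "(\<Sum>i=1..5. C [e i, e i, X]) = 0" for X
  proof -
    have "(\<Sum>i=1..5. A [e i, e i, X]) = 4 * \<alpha> [X]" by (simp add: \<alpha>_def)
    moreover have "B [Y, Y, X] = 0" for Y using B by (simp add: forms_3)
    moreover have "C [e i, e i, X] = A [e i, e i, X] - theta1 \<alpha> [e i, e i, X] - B [e i, e i, X]" for i
      by (simp add: C_def)
    ultimately show ?thesis using theta1_trace[OF \<alpha>, of X] by (simp only: sum_subtractf) simp
  qed
  ultimately have "C \<in> spaceA3 e" by (simp add: spaceA3_iff)
  moreover have "A = theta1 \<alpha> + B + C" by (simp add: C_def)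
  ultimately show "\<exists>w. (\<forall>i\<in>{1, 2, 3}. w i \<in> ?W i) \<and> A = (\<Sum>i\<in>{1, 2, 3}. w i)"
    using \<alpha> B by (intro exI[where x = "(\<lambda>_. 0)(1 := theta1 \<alpha>, 2 := B, 3 := C)"])
      (simp add: forms_1 add.assoc)
next
  fix w and i :: nat
  assume "\<And>i. i \<in> {1, 2, 3} \<Longrightarrow> w i \<in> ?W i" and sum: "(\<Sum>i\<in>{1, 2, 3}. w i) = 0"
    and i: "i \<in> {1, 2, 3}"
  from this(1)[of 1] this(1)[of 2] this(1)[of 3]
  obtain \<alpha> where w1: "w 1 = theta1 \<alpha>" and \<alpha>: "\<alpha> \<in> tensors 1" and w2: "w 2 \<in> forms 3" and w3: "w 3 \<in> spaceA3 e"
    by (auto simp: forms_1)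
  have eq: "theta1 \<alpha> [X, Y, Z] + w 2 [X, Y, Z] + w 3 [X, Y, Z] = 0" for X Y Z
    using fun_cong[OF sum, of "[X, Y, Z]"] by (simp add: w1 add.assoc del: theta1_eval)
  have tr: "(\<Sum>i=1..5. w 3 [e i, e i, X]) = 0" for X using w3 by (simp add: spaceA3_iff)
  \<comment> \<open>The second and third summands have no trace, so the trace of the relation
    isolates \<alpha>. Afterwards the cyclic sum isolates the 3-form.\<close>
  have "4 * \<alpha> [X] = 0" for X
  proof -
    have "theta1 \<alpha> [Y, Y, X] = - w 3 [Y, Y, X]" for Y
      using eq[of Y Y X] w2 by (simp add: forms_3)
    then show ?thesis using theta1_trace[OF \<alpha>, of X] tr[of X] by (simp add: sum_negf del: theta1_eval)
  qed
  then have \<alpha>0: "\<alpha> = 0"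
    using \<alpha> subspace_0[OF subspace_tensors] by (intro tensor1_eqI) auto
  then have w1_0: "w 1 = 0" unfolding w1 using linear_0[OF linear_theta1] by simp
  have "w 2 [X, Y, Z] = 0" for X Y Z
  proof -
    have "w 2 [X, Y, Z] + w 2 [Y, Z, X] + w 2 [Z, X, Y] = 0"
    proof -
      have "w 3 [X, Y, Z] + w 3 [Y, Z, X] + w 3 [Z, X, Y] = 0" using w3 by (simp add: spaceA3_iff)
      then show ?thesis
        using eq[of X Y Z] eq[of Y Z X] eq[of Z X Y] \<alpha>0 by (simp del: theta1_eval add: \<alpha>0 linear_0[OF linear_theta1])
    qed
    moreover have "w 2 [Y, Z, X] = w 2 [X, Y, Z]" "w 2 [Z, X, Y] = w 2 [X, Y, Z]"
      using form3_cyclic[OF w2] by metis+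
    ultimately show ?thesis by simp
  qed
  then have w2_0: "w 2 = 0"
    using w2 subspace_0[OF subspace_tensors] by (intro tensor3_eqI) (auto simp: forms_3)
  show "w i = 0" using i sum w1_0 w2_0 by auto
qed simp

end

section \<open>The volume form and the Hodge operator\<close>

text \<open>As for determinants: replacing \<open>p\<close> by \<open>p \<circ> q\<close> only
  permutes the summands, and in each of them the product is reindexed along
  \<open>q\<close>.\<close>

lemma vol_permute_list:
  assumes "length xs = 5" and q: "q permutes {..<5}"
  shows "vol e (permute_list q xs) = of_int (sign q) * vol e xs"
proof -
  let ?t = "\<lambda>p. of_int (sign p) * (\<Prod>i<5. xs ! i \<bullet> e (Suc (p i))) :: real"
  have "(\<Prod>i<5. permute_list q xs ! i \<bullet> e (Suc ((p \<circ> q) i))) = (\<Prod>i<5. xs ! i \<bullet> e (Suc (p i)))"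
    for p :: "nat \<Rightarrow> nat"
  proof -
    have "(\<Prod>i<5. permute_list q xs ! i \<bullet> e (Suc ((p \<circ> q) i))) =
        (\<Prod>i<5. ((\<lambda>i. xs ! i \<bullet> e (Suc (p i))) \<circ> q) i)"
      using assms by (intro prod.cong) (simp_all add: permute_list_nth)
    also have "\<dots> = (\<Prod>i<5. xs ! i \<bullet> e (Suc (p i)))" by (rule prod.permute[OF q, symmetric])
    finally show ?thesis .
  qed
  moreover have "sign (p \<circ> q) = sign p * sign q" if "p permutes {..<5::nat}" for p
    using that q by (intro sign_compose) (auto simp: permutation_permutes)
  ultimately have "vol e (permute_list q xs) = (\<Sum>p | p permutes {..<5}. of_int (sign q) * ?t p)"
    unfolding vol_def using assms
    by (subst sum_permutations_compose_right[OF q]) (auto intro!: sum.cong)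
  then show ?thesis using assms by (simp add: vol_def sum_distrib_left)
qed

lemma vol_transpose:
  assumes "length xs = 5" "i < 5" "j < 5" "i \<noteq> j"
  shows "vol e (permute_list (Transposition.transpose i j) xs) = - vol e xs"
  using vol_permute_list[OF assms(1) permutes_swap_id[of i _ j]] assms by (simp add: sign_swap_id)

lemma vol_swap:
  "vol e [b, a, c, d, f] = - vol e [a, b, c, d, f]"
  "vol e [a, c, b, d, f] = - vol e [a, b, c, d, f]"
  "vol e [a, b, d, c, f] = - vol e [a, b, c, d, f]"
  "vol e [a, b, c, f, d] = - vol e [a, b, c, d, f]"
  using vol_transpose[of "[a, b, c, d, f]" 0 1 e] vol_transpose[of "[a, b, c, d, f]" 1 2 e]
    vol_transpose[of "[a, b, c, d, f]" 2 3 e] vol_transpose[of "[a, b, c, d, f]" 3 4 e]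
  by (simp_all add: permute_list_def Transposition.transpose_def upt_rec[of _ 5] One_nat_def
      eval_nat_numeral)

lemma vol_repeat:
  "vol e [a, a, c, d, f] = 0" "vol e [a, b, b, d, f] = 0"
  "vol e [a, b, c, c, f] = 0" "vol e [a, b, c, d, d] = 0"
  using vol_swap(1)[of e a a c d f] vol_swap(2)[of e a b b d f] vol_swap(3)[of e a b c c f]
    vol_swap(4)[of e a b c d d] by simp_all

lemma vol_linear:
  "linear (\<lambda>X. vol e [X, b, c, d, f])" "linear (\<lambda>X. vol e [a, X, c, d, f])"
  "linear (\<lambda>X. vol e [a, b, X, d, f])" "linear (\<lambda>X. vol e [a, b, c, X, f])"
  "linear (\<lambda>X. vol e [a, b, c, d, X])"
proof -
  have eval: "vol e [a, b, c, d, f] = (\<Sum>p | p permutes {..<5}. of_int (sign p) *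
      ((a \<bullet> e (Suc (p 0))) * (b \<bullet> e (Suc (p 1))) * (c \<bullet> e (Suc (p 2))) * (d \<bullet> e (Suc (p 3)))
      * (f \<bullet> e (Suc (p 4)))))" for a b c d f
    by (simp add: vol_def lessThan_Suc[of 4, simplified] eval_nat_numeral One_nat_def mult_ac)
  show "linear (\<lambda>X. vol e [X, b, c, d, f])" "linear (\<lambda>X. vol e [a, X, c, d, f])"
    "linear (\<lambda>X. vol e [a, b, X, d, f])" "linear (\<lambda>X. vol e [a, b, c, X, f])"
    "linear (\<lambda>X. vol e [a, b, c, d, X])"
    unfolding eval
    by (intro linearI; simp add: inner_simps sum_distrib_left algebra_simps flip: sum.distrib)+
qed

lemma hodge_2_eval:
  "hodge e 2 \<alpha> [X, Y, Z] = (\<Sum>i=1..5. \<Sum>j=1..5. \<alpha> [e i, e j] * vol e [e i, e j, X, Y, Z]) / 2"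
proof -
  have "{js. set js \<subseteq> {1..5} \<and> length js = 2} = (\<lambda>(i, j). [i, j]) ` ({1..5} \<times> {1..5::nat})"
    by (auto simp: length_Suc_conv numeral_2_eq_2)
  moreover have "inj_on (\<lambda>(i, j). [i, j]) ({1..5} \<times> {1..5::nat})" by (auto simp: inj_on_def)
  ultimately show ?thesis
    by (simp add: hodge_def sum.reindex o_def case_prod_unfold sum.cartesian_product)
qed

lemma hodge_2_length: "length xs \<noteq> 3 \<Longrightarrow> hodge e 2 \<alpha> xs = 0"
  by (simp add: hodge_def)

lemma hodge_2_forms: "hodge e 2 \<alpha> \<in> forms 3"
  unfolding forms_3_iff tensors_3
proof (intro conjI allI impI)
  have add: "vol e [a, b, X + X', Y, Z] = vol e [a, b, X, Y, Z] + vol e [a, b, X', Y, Z]"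
    "vol e [a, b, X, Y + Y', Z] = vol e [a, b, X, Y, Z] + vol e [a, b, X, Y', Z]"
    "vol e [a, b, X, Y, Z + Z'] = vol e [a, b, X, Y, Z] + vol e [a, b, X, Y, Z']"
    "vol e [a, b, c *\<^sub>R X, Y, Z] = c * vol e [a, b, X, Y, Z]"
    "vol e [a, b, X, c *\<^sub>R Y, Z] = c * vol e [a, b, X, Y, Z]"
    "vol e [a, b, X, Y, c *\<^sub>R Z] = c * vol e [a, b, X, Y, Z]" for a b c X Y Z X' Y' Z'
    using vol_linear[of e] by (simp_all add: linear_iff)
  show "linear (\<lambda>W. hodge e 2 \<alpha> [W, Y, Z])" "linear (\<lambda>W. hodge e 2 \<alpha> [X, W, Z])"
    "linear (\<lambda>W. hodge e 2 \<alpha> [X, Y, W])" for X Y Z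
    unfolding hodge_2_eval
    by (intro linearI; simp add: add sum_distrib_left add_divide_distrib algebra_simps sum.distrib)+
  show "hodge e 2 \<alpha> [Y, X, Z] = - hodge e 2 \<alpha> [X, Y, Z]"
    "hodge e 2 \<alpha> [X, Z, Y] = - hodge e 2 \<alpha> [X, Y, Z]" for X Y Z
    unfolding hodge_2_eval vol_swap(3)[of e _ _ Y X Z] vol_swap(4)[of e _ _ X Z Y]
    by (simp_all add: sum_negf)
qed (rule hodge_2_length)

lemma linear_hodge: "linear (hodge e k)"
  by (intro linearI)
    (auto simp: hodge_def fun_eq_iff algebra_simps sum.distrib add_divide_distrib sum_distrib_left)

context frame
begin

lemma vol_frame: "vol e [e 1, e 2, e 3, e 4, e 5] = 1"
proof -
  have "(\<Prod>i<5. [e 1, e 2, e 3, e 4, e 5] ! i \<bullet> e (Suc (p i))) = (if p = id then 1 else 0)"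
    if "p permutes {..<5}" for p
  proof -
    have p: "p i < 5" if "i < 5" for i using permutes_in_image[OF \<open>p permutes _\<close>] that by simp
    have "[e 1, e 2, e 3, e 4, e 5] ! i = e (Suc i)" if "i < 5" for i
    proof -
      have "\<forall>i<5. [e 1, e 2, e 3, e 4, e 5] ! i = e (Suc i)"
        by (simp add: eval_nat_numeral All_less_Suc One_nat_def)
      then show ?thesis using that by blast
    qed
    then have "(\<Prod>i<5. [e 1, e 2, e 3, e 4, e 5] ! i \<bullet> e (Suc (p i))) = (\<Prod>i<5. if i = p i then 1 else 0)"
      using p by (intro prod.cong) (auto simp: Suc_le_eq less_Suc_eq_le One_nat_def)
    also have "\<dots> = (if p = id then 1 else 0)"
    proof (cases "p = id")
      case False
      then obtain i where "p i \<noteq> i" by (auto simp: fun_eq_iff)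
      then have "i \<in> {..<5}" using permutes_not_in[OF that] by blast
      then show ?thesis using \<open>p i \<noteq> i\<close> False by (auto intro!: prod_zero bexI[of _ i])
    qed simp
    finally show ?thesis .
  qed
  then have "vol e [e 1, e 2, e 3, e 4, e 5] =
      (\<Sum>p | p permutes {..<5::nat}. of_int (sign p) * (if p = id then 1 else 0))"
    by (simp add: vol_def)
  also have "\<dots> = (\<Sum>p\<in>{id :: nat \<Rightarrow> nat}. 1)"
    by (intro sum.mono_neutral_cong_right) (auto simp: finite_permutations permutes_id)
  finally show ?thesis by simp
qed

text \<open>The condition j < i orients the exchanges, so that rewriting sorts the frame vectors and
  stops; \<open>vol_repeat\<close> and \<open>vol_frame\<close> evaluate the result. The variants
  for 2-forms and 3-forms serve the same purpose.\<close>

lemma vol_frame_sort: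
  "j < i \<Longrightarrow> vol e [e i, e j, c, d, f] = - vol e [e j, e i, c, d, f]"
  "j < i \<Longrightarrow> vol e [a, e i, e j, d, f] = - vol e [a, e j, e i, d, f]"
  "j < i \<Longrightarrow> vol e [a, b, e i, e j, f] = - vol e [a, b, e j, e i, f]"
  "j < i \<Longrightarrow> vol e [a, b, c, e i, e j] = - vol e [a, b, c, e j, e i]"
  by (rule vol_swap)+

lemma form2_frame_sort: "\<beta> \<in> forms 2 \<Longrightarrow> j < i \<Longrightarrow> \<beta> [e i, e j] = - \<beta> [e j, e i]"
  by (rule form2_swap)

lemma form3_frame_sort:
  "\<beta> \<in> forms 3 \<Longrightarrow> j < i \<Longrightarrow> \<beta> [e i, e j, Z] = - \<beta> [e j, e i, Z]"
  "\<beta> \<in> forms 3 \<Longrightarrow> j < i \<Longrightarrow> \<beta> [Z, e i, e j] = - \<beta> [Z, e j, e i]"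
  by (rule form3_swap, assumption)+

lemma hodge_2_frame:
  assumes "\<alpha> \<in> forms 2"
  shows "hodge e 2 \<alpha> [e 1, e 2, e 3] = \<alpha> [e 4, e 5]"
    "hodge e 2 \<alpha> [e 1, e 2, e 4] = - \<alpha> [e 3, e 5]"
    "hodge e 2 \<alpha> [e 1, e 2, e 5] = \<alpha> [e 3, e 4]"
    "hodge e 2 \<alpha> [e 1, e 3, e 4] = \<alpha> [e 2, e 5]"
    "hodge e 2 \<alpha> [e 1, e 3, e 5] = - \<alpha> [e 2, e 4]"
    "hodge e 2 \<alpha> [e 1, e 4, e 5] = \<alpha> [e 2, e 3]"
    "hodge e 2 \<alpha> [e 2, e 3, e 4] = - \<alpha> [e 1, e 5]"
    "hodge e 2 \<alpha> [e 2, e 3, e 5] = \<alpha> [e 1, e 4]"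
    "hodge e 2 \<alpha> [e 2, e 4, e 5] = - \<alpha> [e 1, e 3]"
    "hodge e 2 \<alpha> [e 3, e 4, e 5] = \<alpha> [e 1, e 2]"
  unfolding hodge_2_eval sum_1_5
  by (simp_all add: vol_frame_sort vol_repeat vol_frame form2_frame_sort[OF assms])

end

section \<open>The spaces of forms\<close>

lemma flat_eval [simp]: "flat a [X] = a \<bullet> X"
  by (simp add: flat_def)

lemma flat_tensors: "flat a \<in> tensors 1"
  unfolding tensors_1
proof
  show "\<forall>xs. length xs \<noteq> 1 \<longrightarrow> flat a xs = 0" by (auto simp: flat_def split: list.split)
  show "linear (\<lambda>X. flat a [X])" by (intro linearI) (simp_all add: inner_simps)
qed

lemma linear_flat: "linear flat"
  by (intro linearI) (auto simp: flat_def fun_eq_iff inner_simps split: list.split)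

lemma linear_wedge: "linear (wedge k l \<alpha>)"
  by (intro linearI)
    (auto simp: wedge_def fun_eq_iff algebra_simps sum.distrib add_divide_distrib sum_distrib_left)

lemma linear_wedge_left: "linear (\<lambda>\<alpha>. wedge k l \<alpha> \<beta>)"
  by (intro linearI)
    (auto simp: wedge_def fun_eq_iff algebra_simps sum.distrib add_divide_distrib sum_distrib_left)

lemma tensor1_simps:
  assumes "\<alpha> \<in> tensors 1"
  shows "\<alpha> [X + Y] = \<alpha> [X] + \<alpha> [Y]" "\<alpha> [c *\<^sub>R X] = c * \<alpha> [X]"
  using assms by (auto simp: tensors_1 linear_iff)

lemma wedge_1_1_forms:
  assumes "\<alpha> \<in> tensors 1" "\<beta> \<in> tensors 1"
  shows "wedge 1 1 \<alpha> \<beta> \<in> forms 2"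
  unfolding forms_2 tensors_2
proof (intro conjI allI impI)
  show "length xs \<noteq> 2 \<Longrightarrow> wedge 1 1 \<alpha> \<beta> xs = 0" for xs by (simp add: wedge_def)
  show "linear (\<lambda>W. wedge 1 1 \<alpha> \<beta> [W, Y])" "linear (\<lambda>W. wedge 1 1 \<alpha> \<beta> [X, W])" for X Y
    by (intro linearI; simp add: wedge_1_1 tensor1_simps[OF assms(1)] tensor1_simps[OF assms(2)]
        algebra_simps)+
qed (simp add: wedge_1_1)

lemma wedge_1_2_forms:
  assumes \<alpha>: "\<alpha> \<in> tensors 1" and \<beta>: "\<beta> \<in> forms 2"
  shows "wedge 1 2 \<alpha> \<beta> \<in> forms 3"
  unfolding forms_3 tensors_3
proof (intro conjI allI impI)
  have t: "\<beta> \<in> tensors 2" and z: "\<beta> [X, X] = 0" for X using \<beta> by (simp_all add: forms_2)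
  show "length xs \<noteq> 3 \<Longrightarrow> wedge 1 2 \<alpha> \<beta> xs = 0" for xs by (simp add: wedge_def)
  show "linear (\<lambda>W. wedge 1 2 \<alpha> \<beta> [W, Y, Z])" "linear (\<lambda>W. wedge 1 2 \<alpha> \<beta> [X, W, Z])"
    "linear (\<lambda>W. wedge 1 2 \<alpha> \<beta> [X, Y, W])" for X Y Z
    by (intro linearI; simp add: wedge_1_2[OF \<beta>] tensor1_simps[OF \<alpha>] tensor2_simps[OF t]
        algebra_simps)+
  show "wedge 1 2 \<alpha> \<beta> [X, X, Y] = 0" "wedge 1 2 \<alpha> \<beta> [X, Y, X] = 0"
    "wedge 1 2 \<alpha> \<beta> [Y, X, X] = 0" for X Y
    using form2_swap[OF \<beta>, of X Y] by (simp_all add: wedge_1_2[OF \<beta>] z)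
qed

lemma subspace_forms_2: "subspace (forms 2)"
  using subspace_tensors[of 2] by (auto simp: subspace_def forms_2)

context frame
begin

lemma linear_pull: "linear (pull C)"
  by (intro linearI) (auto simp: pull_def)

lemma pull_forms_2: "linear C \<Longrightarrow> \<alpha> \<in> forms 2 \<Longrightarrow> pull C \<alpha> \<in> forms 2"
  by (simp add: forms_2 pull_tensors pull_eval)

lemma eta_eq_flat: "eta e = flat (e 5)"
  by (simp add: eta_def xi_def)

lemma eta_eval [simp]: "eta e [X] = X \<bullet> e 5"
  by (simp add: eta_eq_flat inner_commute)

lemma eta_tensors: "eta e \<in> tensors 1"
  by (simp add: eta_eq_flat flat_tensors)

lemma Phi_eval [simp]: "Phi e [X, Y] = X \<bullet> \<phi> Y"
  by (simp add: Phi_def)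

lemma inner_phi_self: "X \<bullet> \<phi> X = 0"
  using inner_phi_left[of X X] by (simp add: inner_commute)

lemma Phi_forms: "Phi e \<in> forms 2"
  unfolding forms_2 tensors_2
proof (intro conjI allI impI)
  show "length xs \<noteq> 2 \<Longrightarrow> Phi e xs = 0" for xs
    by (auto simp: Phi_def split: list.split)
  show "linear (\<lambda>W. Phi e [W, Y])" "linear (\<lambda>W. Phi e [X, W])" for X Y
    by (intro linearI; simp add: inner_simps phi_add phi_scaleR)+
qed (simp add: inner_phi_self)

lemma form2_frame_eqI:
  assumes \<alpha>: "\<alpha> \<in> forms 2" and \<beta>: "\<beta> \<in> forms 2"
    and "\<alpha> [e 1, e 2] = \<beta> [e 1, e 2]" "\<alpha> [e 1, e 3] = \<beta> [e 1, e 3]" "\<alpha> [e 1, e 4] = \<beta> [e 1, e 4]"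
    "\<alpha> [e 1, e 5] = \<beta> [e 1, e 5]" "\<alpha> [e 2, e 3] = \<beta> [e 2, e 3]" "\<alpha> [e 2, e 4] = \<beta> [e 2, e 4]"
    "\<alpha> [e 2, e 5] = \<beta> [e 2, e 5]" "\<alpha> [e 3, e 4] = \<beta> [e 3, e 4]" "\<alpha> [e 3, e 5] = \<beta> [e 3, e 5]"
    "\<alpha> [e 4, e 5] = \<beta> [e 4, e 5]"
  shows "\<alpha> = \<beta>"
proof (rule tensor2_frame_eqI)
  have z: "\<alpha> [X, X] = 0" "\<beta> [X, X] = 0" for X using \<alpha> \<beta> by (simp_all add: forms_2)
  have "\<forall>i\<in>{1..5}. \<forall>j\<in>{1..5}. \<alpha> [e i, e j] = \<beta> [e i, e j]"
    unfolding ball_1_5 by (simp add: z form2_frame_sort[OF \<alpha>] form2_frame_sort[OF \<beta>] assms)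
  then show "i \<in> {1..5} \<Longrightarrow> j \<in> {1..5} \<Longrightarrow> \<alpha> [e i, e j] = \<beta> [e i, e j]" for i j by blast
qed (use \<alpha> \<beta> in \<open>simp_all add: forms_2\<close>)

lemma form3_frame_eqI:
  assumes \<alpha>: "\<alpha> \<in> forms 3" and \<beta>: "\<beta> \<in> forms 3"
    and "\<alpha> [e 1, e 2, e 3] = \<beta> [e 1, e 2, e 3]" "\<alpha> [e 1, e 2, e 4] = \<beta> [e 1, e 2, e 4]"
    "\<alpha> [e 1, e 2, e 5] = \<beta> [e 1, e 2, e 5]" "\<alpha> [e 1, e 3, e 4] = \<beta> [e 1, e 3, e 4]"
    "\<alpha> [e 1, e 3, e 5] = \<beta> [e 1, e 3, e 5]" "\<alpha> [e 1, e 4, e 5] = \<beta> [e 1, e 4, e 5]"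
    "\<alpha> [e 2, e 3, e 4] = \<beta> [e 2, e 3, e 4]" "\<alpha> [e 2, e 3, e 5] = \<beta> [e 2, e 3, e 5]"
    "\<alpha> [e 2, e 4, e 5] = \<beta> [e 2, e 4, e 5]" "\<alpha> [e 3, e 4, e 5] = \<beta> [e 3, e 4, e 5]"
  shows "\<alpha> = \<beta>"
proof (rule tensor3_frame_eqI)
  have z: "\<alpha> [X, X, Y] = 0" "\<alpha> [Y, X, X] = 0" "\<beta> [X, X, Y] = 0" "\<beta> [Y, X, X] = 0" for X Y
    using \<alpha> \<beta> by (simp_all add: forms_3)
  have "\<forall>i\<in>{1..5}. \<forall>j\<in>{1..5}. \<forall>k\<in>{1..5}. \<alpha> [e i, e j, e k] = \<beta> [e i, e j, e k]"
    unfolding ball_1_5 by (simp add: z form3_frame_sort[OF \<alpha>] form3_frame_sort[OF \<beta>] assms)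
  then show "i \<in> {1..5} \<Longrightarrow> j \<in> {1..5} \<Longrightarrow> k \<in> {1..5} \<Longrightarrow> \<alpha> [e i, e j, e k] = \<beta> [e i, e j, e k]"
    for i j k by blast
qed (use \<alpha> \<beta> in \<open>simp_all add: forms_3\<close>)

lemma form2_expand:
  assumes "\<alpha> \<in> forms 2"
  shows "\<alpha> [X, Y] =
    \<alpha> [e 1, e 2] * ((X \<bullet> e 1) * (Y \<bullet> e 2) - (X \<bullet> e 2) * (Y \<bullet> e 1)) +
    \<alpha> [e 1, e 3] * ((X \<bullet> e 1) * (Y \<bullet> e 3) - (X \<bullet> e 3) * (Y \<bullet> e 1)) +
    \<alpha> [e 1, e 4] * ((X \<bullet> e 1) * (Y \<bullet> e 4) - (X \<bullet> e 4) * (Y \<bullet> e 1)) +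
    \<alpha> [e 1, e 5] * ((X \<bullet> e 1) * (Y \<bullet> e 5) - (X \<bullet> e 5) * (Y \<bullet> e 1)) +
    \<alpha> [e 2, e 3] * ((X \<bullet> e 2) * (Y \<bullet> e 3) - (X \<bullet> e 3) * (Y \<bullet> e 2)) +
    \<alpha> [e 2, e 4] * ((X \<bullet> e 2) * (Y \<bullet> e 4) - (X \<bullet> e 4) * (Y \<bullet> e 2)) +
    \<alpha> [e 2, e 5] * ((X \<bullet> e 2) * (Y \<bullet> e 5) - (X \<bullet> e 5) * (Y \<bullet> e 2)) +
    \<alpha> [e 3, e 4] * ((X \<bullet> e 3) * (Y \<bullet> e 4) - (X \<bullet> e 4) * (Y \<bullet> e 3)) +
    \<alpha> [e 3, e 5] * ((X \<bullet> e 3) * (Y \<bullet> e 5) - (X \<bullet> e 5) * (Y \<bullet> e 3)) +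
    \<alpha> [e 4, e 5] * ((X \<bullet> e 4) * (Y \<bullet> e 5) - (X \<bullet> e 5) * (Y \<bullet> e 4))"
proof -
  have t: "\<alpha> \<in> tensors 2" and z: "\<alpha> [V, V] = 0" for V using assms by (simp_all add: forms_2)
  have "\<alpha> [X, Y] = (\<Sum>i=1..5. (X \<bullet> e i) * (\<Sum>j=1..5. (Y \<bullet> e j) * \<alpha> [e i, e j]))"
    using t linear_frame[of "\<lambda>W. \<alpha> [W, Y]"] linear_frame[of "\<lambda>W. \<alpha> [_, W]"]
    by (simp add: tensors_2)
  also have "\<dots> = (X \<bullet> e 1) * ((Y \<bullet> e 2) * \<alpha> [e 1, e 2] + (Y \<bullet> e 3) * \<alpha> [e 1, e 3]
      + (Y \<bullet> e 4) * \<alpha> [e 1, e 4] + (Y \<bullet> e 5) * \<alpha> [e 1, e 5])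
    + (X \<bullet> e 2) * (- (Y \<bullet> e 1) * \<alpha> [e 1, e 2] + (Y \<bullet> e 3) * \<alpha> [e 2, e 3]
      + (Y \<bullet> e 4) * \<alpha> [e 2, e 4] + (Y \<bullet> e 5) * \<alpha> [e 2, e 5])
    + (X \<bullet> e 3) * (- (Y \<bullet> e 1) * \<alpha> [e 1, e 3] - (Y \<bullet> e 2) * \<alpha> [e 2, e 3]
      + (Y \<bullet> e 4) * \<alpha> [e 3, e 4] + (Y \<bullet> e 5) * \<alpha> [e 3, e 5])
    + (X \<bullet> e 4) * (- (Y \<bullet> e 1) * \<alpha> [e 1, e 4] - (Y \<bullet> e 2) * \<alpha> [e 2, e 4]
      - (Y \<bullet> e 3) * \<alpha> [e 3, e 4] + (Y \<bullet> e 5) * \<alpha> [e 4, e 5])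
    + (X \<bullet> e 5) * (- (Y \<bullet> e 1) * \<alpha> [e 1, e 5] - (Y \<bullet> e 2) * \<alpha> [e 2, e 5]
      - (Y \<bullet> e 3) * \<alpha> [e 3, e 5] - (Y \<bullet> e 4) * \<alpha> [e 4, e 5])"
    unfolding sum_1_5 by (simp add: z form2_frame_sort[OF assms])
  finally show ?thesis by (simp add: algebra_simps)
qed

section \<open>Two-forms as eigenvectors of \<phi>, and their Hodge duals\<close>

lemma pull_phi_form2:
  assumes "\<alpha> \<in> forms 2"
  shows "pull \<phi> \<alpha> [e 1, e 2] = \<alpha> [e 1, e 2]" "pull \<phi> \<alpha> [e 1, e 3] = \<alpha> [e 2, e 4]"
    "pull \<phi> \<alpha> [e 1, e 4] = - \<alpha> [e 2, e 3]" "pull \<phi> \<alpha> [e 1, e 5] = 0"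
    "pull \<phi> \<alpha> [e 2, e 3] = - \<alpha> [e 1, e 4]" "pull \<phi> \<alpha> [e 2, e 4] = \<alpha> [e 1, e 3]"
    "pull \<phi> \<alpha> [e 2, e 5] = 0" "pull \<phi> \<alpha> [e 3, e 4] = \<alpha> [e 3, e 4]"
    "pull \<phi> \<alpha> [e 3, e 5] = 0" "pull \<phi> \<alpha> [e 4, e 5] = 0"
proof -
  have t: "\<alpha> \<in> tensors 2" using assms by (simp add: forms_2)
  show "pull \<phi> \<alpha> [e 1, e 2] = \<alpha> [e 1, e 2]" "pull \<phi> \<alpha> [e 1, e 3] = \<alpha> [e 2, e 4]"
    "pull \<phi> \<alpha> [e 1, e 4] = - \<alpha> [e 2, e 3]" "pull \<phi> \<alpha> [e 1, e 5] = 0"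
    "pull \<phi> \<alpha> [e 2, e 3] = - \<alpha> [e 1, e 4]" "pull \<phi> \<alpha> [e 2, e 4] = \<alpha> [e 1, e 3]"
    "pull \<phi> \<alpha> [e 2, e 5] = 0" "pull \<phi> \<alpha> [e 3, e 4] = \<alpha> [e 3, e 4]"
    "pull \<phi> \<alpha> [e 3, e 5] = 0" "pull \<phi> \<alpha> [e 4, e 5] = 0"
    by (simp_all add: pull_eval tensor2_simps[OF t] form2_frame_sort[OF assms])
qed

lemma wedge_eta_form2:
  assumes "\<alpha> \<in> forms 2"
  shows "wedge 1 2 (eta e) \<alpha> [e 1, e 2, e 3] = 0" "wedge 1 2 (eta e) \<alpha> [e 1, e 2, e 4] = 0"
    "wedge 1 2 (eta e) \<alpha> [e 1, e 2, e 5] = \<alpha> [e 1, e 2]" "wedge 1 2 (eta e) \<alpha> [e 1, e 3, e 4] = 0"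
    "wedge 1 2 (eta e) \<alpha> [e 1, e 3, e 5] = \<alpha> [e 1, e 3]"
    "wedge 1 2 (eta e) \<alpha> [e 1, e 4, e 5] = \<alpha> [e 1, e 4]" "wedge 1 2 (eta e) \<alpha> [e 2, e 3, e 4] = 0"
    "wedge 1 2 (eta e) \<alpha> [e 2, e 3, e 5] = \<alpha> [e 2, e 3]"
    "wedge 1 2 (eta e) \<alpha> [e 2, e 4, e 5] = \<alpha> [e 2, e 4]"
    "wedge 1 2 (eta e) \<alpha> [e 3, e 4, e 5] = \<alpha> [e 3, e 4]"
  by (simp_all add: wedge_1_2[OF assms])

lemma form3_neg: "\<alpha> \<in> forms 3 \<Longrightarrow> - \<alpha> \<in> forms 3"
  using subspace_neg[OF subspace_forms_3] .

lemma form2_neg: "\<alpha> \<in> forms 2 \<Longrightarrow> - \<alpha> \<in> forms 2"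
  using subspace_neg[OF subspace_forms_2] .

lemma uminus_fun_eval [simp]: "(- f) x = - f x" for f :: tensor
  by (simp add: fun_Compl_def)

text \<open>On horizontal 2-forms \<open>pull \<phi>\<close> is an involution. Described as its
  eigenspace, this space is invariant because the group commutes with \<phi>, and the volume form
  need not be followed.\<close>

lemma Lambda2_2_iff: "\<alpha> \<in> Lambda2 e 2 \<longleftrightarrow> \<alpha> \<in> forms 2 \<and> pull \<phi> \<alpha> = - \<alpha>"
proof (intro iffI conjI)
  assume L: "\<alpha> \<in> Lambda2 e 2"
  show \<alpha>: "\<alpha> \<in> forms 2" using L by (simp add: Lambda2_def)
  have h: "hodge e 2 \<alpha> = wedge 1 2 (eta e) \<alpha>" and w: "wedge 2 2 (Phi e) \<alpha> = 0"
    using L by (simp_all add: Lambda2_def)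
  \<comment> \<open>The Hodge condition gives \<alpha>(e1, e2) = \<alpha>(e3, e4), the wedge
    condition the opposite sign; hence both values vanish.\<close>
  have "wedge 2 2 (Phi e) \<alpha> [e 1, e 2, e 3, e 4] = 0" by (simp add: w)
  then have "\<alpha> [e 1, e 2] + \<alpha> [e 3, e 4] = 0" by (simp add: wedge_2_2[OF Phi_forms \<alpha>])
  then show "pull \<phi> \<alpha> = - \<alpha>"
    using hodge_2_frame[OF \<alpha>] wedge_eta_form2[OF \<alpha>] unfolding h
    by (intro form2_frame_eqI pull_forms_2 linear_phi \<alpha> form2_neg)
      (simp_all add: pull_phi_form2[OF \<alpha>])
next
  assume "\<alpha> \<in> forms 2 \<and> pull \<phi> \<alpha> = - \<alpha>"
  then have \<alpha>: "\<alpha> \<in> forms 2" and p: "pull \<phi> \<alpha> = - \<alpha>" by auto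
  have c: "\<alpha> [e 1, e 2] = 0" "\<alpha> [e 2, e 4] = - \<alpha> [e 1, e 3]" "\<alpha> [e 2, e 3] = \<alpha> [e 1, e 4]"
    "\<alpha> [e 1, e 5] = 0" "\<alpha> [e 2, e 5] = 0" "\<alpha> [e 3, e 4] = 0" "\<alpha> [e 3, e 5] = 0" "\<alpha> [e 4, e 5] = 0"
    using pull_phi_form2[OF \<alpha>] unfolding p uminus_fun_eval by linarith+
  have hodge: "hodge e 2 \<alpha> = wedge 1 2 (eta e) \<alpha>"
    by (intro form3_frame_eqI hodge_2_forms wedge_1_2_forms eta_tensors \<alpha>)
      (simp_all add: hodge_2_frame[OF \<alpha>] wedge_eta_form2[OF \<alpha>] c)
  \<comment> \<open>Two real parameters describe such a form completely, which makes the wedge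
    condition on arbitrary vectors a polynomial identity.\<close>
  obtain a b where exp: "\<alpha> [X, Y] =
      a * ((X \<bullet> e 1) * (Y \<bullet> e 3) - (X \<bullet> e 3) * (Y \<bullet> e 1) - (X \<bullet> e 2) * (Y \<bullet> e 4) + (X \<bullet> e 4) * (Y \<bullet> e 2)) +
      b * ((X \<bullet> e 1) * (Y \<bullet> e 4) - (X \<bullet> e 4) * (Y \<bullet> e 1) + (X \<bullet> e 2) * (Y \<bullet> e 3) - (X \<bullet> e 3) * (Y \<bullet> e 2))" for X Y
  proof -
    show ?thesis
      by (rule that[of "\<alpha> [e 1, e 3]" "\<alpha> [e 1, e 4]"])
        (subst form2_expand[OF \<alpha>], simp add: c algebra_simps)
  qed
  have Phi: "X \<bullet> \<phi> Y = (X \<bullet> e 1) * (Y \<bullet> e 2) - (X \<bullet> e 2) * (Y \<bullet> e 1)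
      + (X \<bullet> e 3) * (Y \<bullet> e 4) - (X \<bullet> e 4) * (Y \<bullet> e 3)" for X Y
    by (simp add: phi_def inner_simps)
  have "wedge 2 2 (Phi e) \<alpha> xs = 0" for xs
  proof (cases "length xs = 4")
    case True
    then have "length xs = Suc (Suc (Suc (Suc 0)))" by simp
    then obtain X Y Z W where "xs = [X, Y, Z, W]" by (auto simp: length_Suc_conv)
    have "wedge 2 2 (Phi e) \<alpha> [X, Y, Z, W] = 0"
      unfolding wedge_2_2[OF Phi_forms \<alpha>] Phi_eval exp Phi by algebra
    then show ?thesis by (simp add: \<open>xs = _\<close>)
  qed (simp add: wedge_def)
  with hodge show "\<alpha> \<in> Lambda2 e 2" using \<alpha> by (simp add: Lambda2_def fun_eq_iff)
qed

text \<open>The eigenspace for +1 has dimension 4 and contains \<open>Phi e\<close>. The last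
  condition is orthogonality to \<open>Phi e\<close>; what remains are the primitive forms of type
  (1,1), the adjoint module of SU(2).\<close>

lemma Lambda2_3_iff:
  "\<alpha> \<in> Lambda2 e 3 \<longleftrightarrow> \<alpha> \<in> forms 2 \<and> pull \<phi> \<alpha> = \<alpha> \<and> \<alpha> [e 1, e 2] + \<alpha> [e 3, e 4] = 0"
proof (cases "\<alpha> \<in> forms 2")
  case \<alpha>: True
  note c = hodge_2_frame[OF \<alpha>] wedge_eta_form2[OF \<alpha>] pull_phi_form2[OF \<alpha>]
  show ?thesis
  proof
    assume "\<alpha> \<in> Lambda2 e 3"
    then have h: "hodge e 2 \<alpha> = - wedge 1 2 (eta e) \<alpha>" by (simp add: Lambda2_def)
    have "pull \<phi> \<alpha> = \<alpha>"
      using c unfolding h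
      by (intro form2_frame_eqI pull_forms_2 linear_phi \<alpha>) simp_all
    then show "\<alpha> \<in> forms 2 \<and> pull \<phi> \<alpha> = \<alpha> \<and> \<alpha> [e 1, e 2] + \<alpha> [e 3, e 4] = 0"
      using c \<alpha> unfolding h by simp
  next
    assume "\<alpha> \<in> forms 2 \<and> pull \<phi> \<alpha> = \<alpha> \<and> \<alpha> [e 1, e 2] + \<alpha> [e 3, e 4] = 0"
    then have p: "pull \<phi> \<alpha> = \<alpha>" "\<alpha> [e 1, e 2] + \<alpha> [e 3, e 4] = 0" by auto
    have d: "\<alpha> [e 3, e 4] = - \<alpha> [e 1, e 2]" "\<alpha> [e 2, e 4] = \<alpha> [e 1, e 3]"
      "\<alpha> [e 2, e 3] = - \<alpha> [e 1, e 4]" "\<alpha> [e 1, e 5] = 0" "\<alpha> [e 2, e 5] = 0"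
      "\<alpha> [e 3, e 5] = 0" "\<alpha> [e 4, e 5] = 0"
      using c p(2) unfolding p(1) by linarith+
    have "hodge e 2 \<alpha> = - wedge 1 2 (eta e) \<alpha>"
      by (intro form3_frame_eqI hodge_2_forms form3_neg wedge_1_2_forms eta_tensors \<alpha>)
        (simp_all add: c d)
    then show "\<alpha> \<in> Lambda2 e 3" using \<alpha> by (simp add: Lambda2_def)
  qed
qed (simp add: Lambda2_def)

lemma Lambda2_4_iff: "\<alpha> \<in> Lambda2 e 4 \<longleftrightarrow> \<alpha> \<in> forms 2 \<and> pull \<phi> \<alpha> = 0"
proof (cases "\<alpha> \<in> forms 2")
  case \<alpha>: True
  note c = wedge_eta_form2[OF \<alpha>] pull_phi_form2[OF \<alpha>]
  have z: "0 \<in> forms 2" "0 \<in> forms 3"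
    using subspace_0[OF subspace_forms_2] subspace_0[OF subspace_forms_3] by auto
  have "wedge 1 2 (eta e) \<alpha> = 0 \<longleftrightarrow> pull \<phi> \<alpha> = 0"
  proof
    assume w: "wedge 1 2 (eta e) \<alpha> = 0"
    show "pull \<phi> \<alpha> = 0"
      using c unfolding w
      by (intro form2_frame_eqI pull_forms_2 linear_phi \<alpha> z) simp_all
  next
    assume p: "pull \<phi> \<alpha> = 0"
    show "wedge 1 2 (eta e) \<alpha> = 0"
      using c unfolding p
      by (intro form3_frame_eqI wedge_1_2_forms eta_tensors \<alpha> z) simp_all
  qed
  then show ?thesis using \<alpha> by (simp add: Lambda2_def)
qed (simp add: Lambda2_def)

lemma pull_phi_Phi: "pull \<phi> (Phi e) = Phi e"
  by (intro form2_frame_eqI pull_forms_2 linear_phi Phi_forms)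
    (simp_all add: pull_phi_form2[OF Phi_forms])

lemma pull_phi_3: "pull \<phi> (pull \<phi> (pull \<phi> \<alpha>)) = pull \<phi> \<alpha>" if "\<alpha> \<in> forms 2"
  using that
  by (intro form2_frame_eqI pull_forms_2 linear_phi)
    (simp_all add: pull_phi_form2 pull_forms_2 linear_phi)

lemma subspace_Lambda2:
  assumes "i \<in> {1..4}"
  shows "subspace (Lambda2 e i)"
proof -
  consider "i = 1" | "i = 2" | "i = 3" | "i = 4" using assms by force
  then show ?thesis
  proof cases
    case 2
    show ?thesis
      using subspace_forms_2 unfolding 2
      by (auto simp: subspace_def Lambda2_2_iff linear_add[OF linear_pull] linear_scale[OF linear_pull]
          linear_0[OF linear_pull])
  next
    case 3
    show ?thesis
      using subspace_forms_2 unfolding 3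
      by (auto simp: subspace_def Lambda2_3_iff linear_add[OF linear_pull] linear_scale[OF linear_pull]
          linear_0[OF linear_pull] algebra_simps eq_neg_iff_add_eq_0 simp flip: distrib_left)
  next
    case 4
    show ?thesis
      using subspace_forms_2 unfolding 4
      by (auto simp: subspace_def Lambda2_4_iff linear_add[OF linear_pull] linear_scale[OF linear_pull]
          linear_0[OF linear_pull])
  qed (simp add: Lambda2_def subspace_span)
qed

lemma Lambda2_subset: "i \<in> {1..4} \<Longrightarrow> Lambda2 e i \<subseteq> forms 2"
  using Phi_forms span_minimal[OF _ subspace_forms_2, of "{Phi e}"] by (auto simp: Lambda2_def)

lemma sum_1_4: "(\<Sum>i=1..4. f i) = f 1 + f 2 + f 3 + f (4::nat)"
  by (simp add: eval_nat_numeral One_nat_def)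

text \<open>Since p = \<open>pull \<phi>\<close> satisfies p^3 = p on 2-forms, the eigenprojections
  are (p^2 - p)/2, (p^2 + p)/2 and 1 - p^2. Only the +1 part has to be split further, along
  \<open>Phi e\<close>.\<close>

lemma direct_sum_forms_2: "direct_sum {1..4} (Lambda2 e) (forms 2)"
proof (rule direct_sumI)
  show "(\<Sum>i=1..4. w i) \<in> forms 2" if "\<And>i. i \<in> {1..4} \<Longrightarrow> w i \<in> Lambda2 e i" for w
    using that Lambda2_subset by (intro subspace_sum[OF subspace_forms_2]) blast
next
  fix \<alpha> assume \<alpha>: "\<alpha> \<in> forms 2"
  let ?p = "pull \<phi>"
  \<comment> \<open>\<open>Phi e\<close> has the value 1 on both pairs, whence the factor 1/2. The
    two components are fixed by p, so they may be read off from \<alpha> itself.\<close>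
  define c where "c = (\<alpha> [e 1, e 2] + \<alpha> [e 3, e 4]) / 2"
  define \<alpha>2 where "\<alpha>2 = (1/2) *\<^sub>R (?p (?p \<alpha>) - ?p \<alpha>)"
  define \<alpha>3 where "\<alpha>3 = (1/2) *\<^sub>R (?p (?p \<alpha>) + ?p \<alpha>) - c *\<^sub>R Phi e"
  define \<alpha>4 where "\<alpha>4 = \<alpha> - ?p (?p \<alpha>)"
  have p: "?p \<alpha> \<in> forms 2" "?p (?p \<alpha>) \<in> forms 2"
    using \<alpha> pull_forms_2[OF linear_phi] by auto
  have forms: "\<alpha>2 \<in> forms 2" "\<alpha>3 \<in> forms 2" "\<alpha>4 \<in> forms 2"
    unfolding \<alpha>2_def \<alpha>3_def \<alpha>4_def using \<alpha> p Phi_forms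
    by (auto intro!: subspace_diff subspace_add subspace_scale subspace_forms_2)
  note lin = linear_add[OF linear_pull] linear_scale[OF linear_pull] linear_diff[OF linear_pull]
  have "\<alpha>2 \<in> Lambda2 e 2"
    unfolding Lambda2_2_iff using forms by (simp add: \<alpha>2_def lin pull_phi_3[OF \<alpha>] flip: scaleR_minus_right)
  moreover have "\<alpha>3 \<in> Lambda2 e 3"
    unfolding Lambda2_3_iff using forms
    by (simp add: \<alpha>3_def lin pull_phi_3[OF \<alpha>] pull_phi_Phi add.commute)
      (simp add: pull_phi_form2[OF \<alpha>] c_def pull_phi_form2[OF p(1)] field_simps)
  moreover have "\<alpha>4 \<in> Lambda2 e 4"
    unfolding Lambda2_4_iff using forms by (simp add: \<alpha>4_def lin pull_phi_3[OF \<alpha>])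
  moreover have "c *\<^sub>R Phi e \<in> Lambda2 e 1"
    by (simp add: Lambda2_def span_base span_scale)
  moreover have "\<alpha> = c *\<^sub>R Phi e + \<alpha>2 + \<alpha>3 + \<alpha>4"
    by (simp add: \<alpha>2_def \<alpha>3_def \<alpha>4_def fun_eq_iff field_simps)
  ultimately show "\<exists>w. (\<forall>i\<in>{1..4}. w i \<in> Lambda2 e i) \<and> \<alpha> = (\<Sum>i=1..4. w i)"
    by (intro exI[where x = "(\<lambda>_. 0)(1 := c *\<^sub>R Phi e, 2 := \<alpha>2, 3 := \<alpha>3, 4 := \<alpha>4)"])
      (auto simp: sum_1_4 numeral_eq_Suc le_Suc_eq One_nat_def)
next
  fix w and i :: nat
  assume w: "\<And>i. i \<in> {1..4} \<Longrightarrow> w i \<in> Lambda2 e i" and sum: "(\<Sum>i=1..4. w i) = 0" and i: "i \<in> {1..4}"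
  let ?p = "pull \<phi>"
  obtain c where w1: "w 1 = c *\<^sub>R Phi e"
    using w[of 1] by (auto simp: Lambda2_def span_singleton)
  have w2: "?p (w 2) = - w 2" using w[of 2] by (simp add: Lambda2_2_iff)
  have w3: "?p (w 3) = w 3" "w 3 [e 1, e 2] + w 3 [e 3, e 4] = 0"
    using w[of 3] by (simp_all add: Lambda2_3_iff)
  have w4: "?p (w 4) = 0" using w[of 4] by (simp add: Lambda2_4_iff)
  note lin = linear_add[OF linear_pull] linear_neg[OF linear_pull] linear_0[OF linear_pull]
  have p1: "?p (w 1) = w 1" unfolding w1 linear_scale[OF linear_pull] pull_phi_Phi ..
  have s: "w 1 + w 2 + w 3 + w 4 = 0" using sum by (simp add: sum_1_4)
  \<comment> \<open>Applying p removes \<open>w 4\<close>; applying it again changes only the sign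
    of \<open>w 2\<close>, so the two resulting relations together force
    \<open>w 2 = 0\<close>.\<close>
  have "?p (w 1 + w 2 + w 3 + w 4) = 0" unfolding s by (simp add: lin)
  then have s1: "w 1 - w 2 + w 3 = 0" by (simp add: lin p1 w2 w3 w4)
  have "?p (w 1 - w 2 + w 3) = 0" unfolding s1 by (simp add: lin)
  then have s2: "w 1 + w 2 + w 3 = 0" by (simp add: lin p1 w2 w3 linear_diff[OF linear_pull])
  have 2: "w 2 = 0"
  proof
    show "w 2 xs = 0 xs" for xs using fun_cong[OF s1, of xs] fun_cong[OF s2, of xs] by simp
  qed
  have "c = 0"
  proof -
    have "(w 1 + w 3) [e 1, e 2] + (w 1 + w 3) [e 3, e 4] = 0" using s2 2 by simp
    then show ?thesis using w3(2) by (simp add: w1)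
  qed
  then have 1: "w 1 = 0" using w1 by simp
  have 3: "w 3 = 0" using s2 1 2 by simp
  have 4: "w 4 = 0" using s 1 2 3 by simp
  have "i = 1 \<or> i = 2 \<or> i = 3 \<or> i = 4" using i by force
  then show "w i = 0" using 1 2 3 4 by auto
qed (simp_all add: subspace_Lambda2)

lemma hodge_inj_on_forms_2:
  assumes \<alpha>: "\<alpha> \<in> forms 2" and "hodge e 2 \<alpha> = 0"
  shows "\<alpha> = 0"
  using hodge_2_frame[OF \<alpha>] unfolding assms(2)
  by (intro form2_frame_eqI \<alpha> subspace_0 subspace_forms_2) simp_all

lemma hodge_forms_2: "hodge e 2 ` forms 2 = forms 3"
proof
  show "hodge e 2 ` forms 2 \<subseteq> forms 3" using hodge_2_forms by blast
  show "forms 3 \<subseteq> hodge e 2 ` forms 2"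
  proof
    fix \<beta> assume \<beta>: "\<beta> \<in> forms 3"
    let ?w = "\<lambda>i j. wedge 1 1 (flat (e i)) (flat (e j))"
    \<comment> \<open>The table \<open>hodge_2_frame\<close> read backwards, including its
      signs.\<close>
    define \<alpha> where "\<alpha> = \<beta> [e 3, e 4, e 5] *\<^sub>R ?w 1 2 - \<beta> [e 2, e 4, e 5] *\<^sub>R ?w 1 3
      + \<beta> [e 2, e 3, e 5] *\<^sub>R ?w 1 4 - \<beta> [e 2, e 3, e 4] *\<^sub>R ?w 1 5 + \<beta> [e 1, e 4, e 5] *\<^sub>R ?w 2 3
      - \<beta> [e 1, e 3, e 5] *\<^sub>R ?w 2 4 + \<beta> [e 1, e 3, e 4] *\<^sub>R ?w 2 5 + \<beta> [e 1, e 2, e 5] *\<^sub>R ?w 3 4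
      - \<beta> [e 1, e 2, e 4] *\<^sub>R ?w 3 5 + \<beta> [e 1, e 2, e 3] *\<^sub>R ?w 4 5"
    have \<alpha>: "\<alpha> \<in> forms 2"
      unfolding \<alpha>_def
      by (intro subspace_diff subspace_add subspace_scale subspace_forms_2 wedge_1_1_forms flat_tensors)
    have "hodge e 2 \<alpha> = \<beta>"
      by (intro form3_frame_eqI hodge_2_forms \<beta>)
        (simp_all add: hodge_2_frame[OF \<alpha>], simp_all add: \<alpha>_def wedge_1_1)
    then show "\<beta> \<in> hodge e 2 ` forms 2" using \<alpha> by blast
  qed
qed

lemma direct_sum_forms_3: "direct_sum {1..4} (Lambda3 e) (forms 3)"
proof -
  have eq: "Lambda3 e = (\<lambda>i. hodge e 2 ` Lambda2 e i)" by (simp add: fun_eq_iff Lambda3_def)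
  show ?thesis
    unfolding eq hodge_forms_2[symmetric]
    by (rule direct_sum_image[OF direct_sum_forms_2 _ linear_hodge hodge_inj_on_forms_2]) auto
qed

end

section \<open>The decomposition of \<open>\<A>\<^sub>3\<close>\<close>

definition tri :: "(vec5 \<Rightarrow> vec5 \<Rightarrow> vec5 \<Rightarrow> real) \<Rightarrow> tensor" where
  "tri f = (\<lambda>xs. case xs of [X, Y, Z] \<Rightarrow> f X Y Z | _ \<Rightarrow> 0)"

lemma tri_eval [simp]: "tri f [X, Y, Z] = f X Y Z"
  by (simp add: tri_def)

lemma tri_tensors:
  assumes "\<And>Y Z. linear (\<lambda>X. f X Y Z)" "\<And>X Z. linear (\<lambda>Y. f X Y Z)" "\<And>X Y. linear (\<lambda>Z. f X Y Z)"
  shows "tri f \<in> tensors 3"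
  using assms by (auto simp: tensors_3) (auto simp: tri_def split: list.split)

lemma tri_eqI:
  assumes "\<And>xs. length xs \<noteq> 3 \<Longrightarrow> A xs = 0" "\<And>X Y Z. A [X, Y, Z] = f X Y Z"
  shows "A = tri f"
proof
  show "A xs = tri f xs" for xs
    using assms by (auto simp: tri_def split: list.split)
qed

lemma tensor1_Cons: "tensor1 \<alpha> \<beta> (X # ys) = \<alpha> [X] * \<beta> ys"
  by (simp add: tensor1_def)

lemma tensor1_length:
  assumes "length xs \<noteq> 3" "\<And>ys. length ys \<noteq> 2 \<Longrightarrow> \<beta> ys = 0"
  shows "tensor1 \<alpha> \<beta> xs = 0"
  using assms by (cases xs) (auto simp: tensor1_def)

lemma theta2_length:
  assumes "length xs \<noteq> 3" "\<And>ys. length ys \<noteq> 3 \<Longrightarrow> \<beta> ys = 0"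
  shows "theta2 e \<beta> xs = 0"
  using assms by (auto simp: theta2_def contract_def intro!: sum.neutral tensor1_length)

lemma linear_theta2: "linear (theta2 e)"
proof (rule linearI)
  show "theta2 e (\<alpha> + \<beta>) = theta2 e \<alpha> + theta2 e \<beta>" for \<alpha> \<beta>
  proof
    show "theta2 e (\<alpha> + \<beta>) xs = (theta2 e \<alpha> + theta2 e \<beta>) xs" for xs
      by (cases xs) (simp_all add: theta2_def tensor1_def contract_def distrib_left sum.distrib)
  qed
  show "theta2 e (c *\<^sub>R \<alpha>) = c *\<^sub>R theta2 e \<alpha>" for c \<alpha>
  proof
    show "theta2 e (c *\<^sub>R \<alpha>) xs = (c *\<^sub>R theta2 e \<alpha>) xs" for xs
      by (cases xs) (simp_all add: theta2_def tensor1_def contract_def sum_distrib_left mult_ac)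
  qed
qed

lemma linear_theta3: "linear (theta3 e)"
proof (rule linearI)
  show "theta3 e (\<alpha> + \<beta>) = theta3 e \<alpha> + theta3 e \<beta>" for \<alpha> \<beta>
    by (simp add: theta3_def linear_add[OF linear_wedge] linear_add[OF linear_theta2])
      (auto simp: tensor1_def fun_eq_iff algebra_simps split: list.split)
  show "theta3 e (c *\<^sub>R \<alpha>) = c *\<^sub>R theta3 e \<alpha>" for c \<alpha>
    by (simp add: theta3_def linear_scale[OF linear_wedge] linear_scale[OF linear_theta2])
      (auto simp: tensor1_def fun_eq_iff algebra_simps split: list.split)
qed

context frame
begin

section \<open>Explicit formulas for the maps into \<A>\<close>

lemma theta2_eval:
  assumes "linear (\<lambda>W. \<beta> [W, Y, Z])"
  shows "theta2 e \<beta> [X, Y, Z] = \<beta> [X, Y, Z]"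
  using linear_frame_simps(2)[OF assms]
  by (simp add: theta2_def tensor1_Cons contract_def)

lemma theta2_id:
  assumes "\<beta> \<in> tensors 3"
  shows "theta2 e \<beta> = \<beta>"
proof -
  have "theta2 e \<beta> = tri (\<lambda>X Y Z. \<beta> [X, Y, Z])"
    using assms by (intro tri_eqI theta2_eval theta2_length) (auto simp: tensors_3)
  also have "\<dots> = \<beta>" using assms by (intro tri_eqI[symmetric]) (auto simp: tensors_3)
  finally show ?thesis .
qed

text \<open>The coefficient 2 is 3 - 1: the wedge product contains the term \<eta>(X) \<alpha>(Y, Z)
  once, and \<open>theta2\<close> leaves it unchanged.\<close>

lemma theta3_eq:
  assumes \<alpha>: "\<alpha> \<in> forms 2"
  shows "theta3 e \<alpha> = tri (\<lambda>X Y Z.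
     2 * (X \<bullet> e 5) * \<alpha> [Y, Z] + (Y \<bullet> e 5) * \<alpha> [X, Z] - (Z \<bullet> e 5) * \<alpha> [X, Y])"
proof -
  have w: "wedge 1 2 (eta e) \<alpha> \<in> tensors 3"
    using wedge_1_2_forms[OF eta_tensors \<alpha>] by (simp add: forms_3)
  show ?thesis
    unfolding theta3_def theta2_id[OF w]
  proof (rule tri_eqI)
    fix xs :: "vec5 list" assume "length xs \<noteq> 3"
    moreover have "\<alpha> ys = 0" if "length ys \<noteq> 2" for ys
      using \<alpha> that by (simp add: forms_2 tensors_2)
    ultimately show "(3 *\<^sub>R tensor1 (eta e) \<alpha> - wedge 1 2 (eta e) \<alpha>) xs = 0"
      using w by (simp add: tensors_3 tensor1_length)
  qed (simp add: tensor1_Cons wedge_1_2[OF \<alpha>])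
qed

text \<open>The common shape of \<open>theta4\<close> and \<open>theta5\<close> on the 1-form dual
  to \<open>a\<close>: \<open>p\<close> weighs the terms with \<Phi>, \<open>r\<close> the vertical
  term. Membership, trace and equivariance are thus computed once for both.\<close>

definition theta45 :: "real \<Rightarrow> real \<Rightarrow> vec5 \<Rightarrow> tensor" where
  "theta45 p r a = tri (\<lambda>X Y Z. (a \<bullet> Y) * (X \<bullet> Z) - (a \<bullet> Z) * (X \<bullet> Y)
     + p * ((a \<bullet> \<phi> Z) * (X \<bullet> \<phi> Y) - (a \<bullet> \<phi> Y) * (X \<bullet> \<phi> Z) - 2 * (a \<bullet> \<phi> X) * (Y \<bullet> \<phi> Z))
     + r * (X \<bullet> e 5) * ((a \<bullet> Y) * (Z \<bullet> e 5) - (a \<bullet> Z) * (Y \<bullet> e 5)))"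

text \<open>\<Phi> \<and> \<Phi> evaluates with a factor 2, which doubles \<open>p\<close>. The
  product of a \<bullet> \<phi> X and Y \<bullet> \<phi> Z occurs with 2 p from there and with -6 p
  from the third term, that is, -2 times the new parameter.\<close>

lemma theta45_eq:
  fixes a :: vec5 and p r :: real
  shows "(\<Sum>i=1..5. tensor1 (flat (e i)) (wedge 1 1 (flat a) (flat (e i))))
     + p *\<^sub>R theta2 e (contract (sharp e (flat a)) (wedge 2 2 (Phi e) (Phi e)))
     - (6 * p) *\<^sub>R tensor1 (contract (sharp e (flat a)) (Phi e)) (Phi e)
     + r *\<^sub>R tensor1 (eta e) (wedge 1 1 (flat a) (eta e)) = theta45 (2 * p) r a"
    (is "?L = _")
  unfolding theta45_def
proof (rule tri_eqI)
  have sharp: "sharp e (flat a) = a"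
    using frame_expand[of a] by (simp add: sharp_def)
  have w11: "length ys \<noteq> 2 \<Longrightarrow> wedge 1 1 \<alpha> \<beta> ys = 0" for \<alpha> \<beta> ys by (simp add: wedge_def)
  have Phi: "length ys \<noteq> 2 \<Longrightarrow> Phi e ys = 0" for ys using Phi_forms by (simp add: forms_2 tensors_2)
  have w22: "length ys \<noteq> 3 \<Longrightarrow> contract a (wedge 2 2 \<alpha> \<beta>) ys = 0" for \<alpha> \<beta> ys
    by (simp add: wedge_def contract_def)
  show "?L xs = 0" if xs: "length xs \<noteq> 3" for xs
    unfolding sharp using theta2_length[OF xs w22] tensor1_length[OF xs w11] tensor1_length[OF xs Phi]
    by simp
  fix X Y Z
  have eval: "contract a (wedge 2 2 (Phi e) (Phi e)) [W, Y, Z] =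
      2 * ((a \<bullet> \<phi> W) * (Y \<bullet> \<phi> Z) - (a \<bullet> \<phi> Y) * (W \<bullet> \<phi> Z) + (a \<bullet> \<phi> Z) * (W \<bullet> \<phi> Y))" for W
    by (simp add: contract_def wedge_2_2[OF Phi_forms Phi_forms])
  have "linear (\<lambda>W. contract a (wedge 2 2 (Phi e) (Phi e)) [W, Y, Z])"
    unfolding eval by (intro linearI) (simp_all add: inner_simps phi_add phi_scaleR algebra_simps)
  note t2 = theta2_eval[OF this, of X]
  have lin: "linear (\<lambda>W. W \<bullet> Z)" for Z :: vec5 by (intro linearI) (simp_all add: inner_simps)
  have "(\<Sum>i=1..5. tensor1 (flat (e i)) (wedge 1 1 (flat a) (flat (e i)))) [X, Y, Z] =
      (a \<bullet> Y) * (\<Sum>i=1..5. (e i \<bullet> X) * (e i \<bullet> Z)) - (a \<bullet> Z) * (\<Sum>i=1..5. (e i \<bullet> X) * (e i \<bullet> Y))"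
    by (simp add: tensor1_Cons wedge_1_1 sum_distrib_left sum_subtractf right_diff_distrib mult_ac)
  also have "\<dots> = (a \<bullet> Y) * (X \<bullet> Z) - (a \<bullet> Z) * (X \<bullet> Y)"
    unfolding linear_frame_simps(2)[OF lin] ..
  finally show "?L [X, Y, Z] =
    (a \<bullet> Y) * (X \<bullet> Z) - (a \<bullet> Z) * (X \<bullet> Y)
     + 2 * p * ((a \<bullet> \<phi> Z) * (X \<bullet> \<phi> Y) - (a \<bullet> \<phi> Y) * (X \<bullet> \<phi> Z) - 2 * (a \<bullet> \<phi> X) * (Y \<bullet> \<phi> Z))
     + r * (X \<bullet> e 5) * ((a \<bullet> Y) * (Z \<bullet> e 5) - (a \<bullet> Z) * (Y \<bullet> e 5))"
    unfolding sharp plus_fun_apply minus_apply scaleR_fun_apply t2 eval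
    by (simp add: tensor1_Cons wedge_1_1 contract_def algebra_simps)
qed

lemma theta4_flat: "theta4 e (flat a) = theta45 1 (-1) a"
  using theta45_eq[of a "1/2" "-1"] by (simp add: theta4_def)

lemma theta5_flat: "theta5 e (flat a) = theta45 2 2 a"
  using theta45_eq[of a 1 2] by (simp add: theta5_def)

lemma linear_theta45: "linear (theta45 p r)"
  by (intro linearI)
    (auto simp: theta45_def tri_def fun_eq_iff inner_simps algebra_simps split: list.split)

lemma theta45_spaceA: "theta45 p r a \<in> spaceA"
  unfolding spaceA_iff
proof
  show "theta45 p r a \<in> tensors 3"
    unfolding theta45_def
    by (intro tri_tensors linearI; simp add: inner_simps phi_add phi_scaleR algebra_simps)
  show "\<forall>X Y Z. theta45 p r a [X, Z, Y] = - theta45 p r a [X, Y, Z]"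
  proof (intro allI)
    fix X Y Z
    have "Z \<bullet> \<phi> Y = - (Y \<bullet> \<phi> Z)" using inner_phi_left[of Y Z] by (simp add: inner_commute)
    then show "theta45 p r a [X, Z, Y] = - theta45 p r a [X, Y, Z]"
      unfolding theta45_def by (simp add: algebra_simps)
  qed
qed

lemma phi_swap: "X \<bullet> \<phi> Y = - (Y \<bullet> \<phi> X)"
  using inner_phi_left[of Y X] by (simp add: inner_commute)

lemma phi_e5_right [simp]: "X \<bullet> e 5 = 0 \<Longrightarrow> \<phi> (\<phi> X) = - X"
  by (simp add: phi_phi)

text \<open>For horizontal \<open>a\<close> the trace is (-4 + 3 p - r) (a \<bullet> X): the metric
  terms give 1 - 5, the \<Phi>-terms give 1 + 2 times \<open>p\<close> because \<phi> squares to -1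
  on horizontal vectors, and the vertical term gives -r. Both (1, -1) and (2, 2) solve the
  equation.\<close>

lemma theta45_spaceA3:
  assumes a: "a \<bullet> e 5 = 0" and pr: "3 * p - r = 4"
  shows "theta45 p r a \<in> spaceA3 e"
  unfolding spaceA3_iff
proof (intro conjI allI)
  show A: "theta45 p r a \<in> spaceA" by (rule theta45_spaceA)
  show "theta45 p r a [X, Y, Z] + theta45 p r a [Y, Z, X] + theta45 p r a [Z, X, Y] = 0" for X Y Z
    unfolding theta45_def tri_eval
    by (simp add: phi_swap[of Y X] phi_swap[of Z Y] phi_swap[of Z X] inner_commute[of Y X]
        inner_commute[of Z X] inner_commute[of Z Y] algebra_simps)
  let ?tr = "\<lambda>X. \<Sum>i=1..5. theta45 p r a [e i, e i, X]"
  have "linear ?tr"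
    using spaceA_tensors[OF A] by (intro linearI) (simp_all add: tensor3_simps sum.distrib sum_distrib_left)
  moreover have "linear (\<lambda>X. 0 :: real)" by (rule linear_zero)
  moreover have "?tr (e k) = 0" if "k \<in> {1..5}" for k
  proof -
    have r: "r = 3 * p - 4" using pr by simp
    have "\<forall>k\<in>{1..5}. ?tr (e k) = 0"
      unfolding ball_1_5 sum_1_5 by (simp add: theta45_def a r algebra_simps)
    then show ?thesis using that by blast
  qed
  ultimately show "?tr X = 0" for X by (rule linear_frame_eqI)
qed

text \<open>The trace consists of terms \<alpha>(\<xi>, X), which horizontality removes, and of
  \<alpha> on equal arguments.\<close>

lemma theta3_spaceA3:
  assumes \<alpha>: "\<alpha> \<in> forms 2" and h: "\<And>X. \<alpha> [e 5, X] = 0"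
  shows "theta3 e \<alpha> \<in> spaceA3 e"
  unfolding spaceA3_iff theta3_eq[OF \<alpha>] spaceA_iff
proof (intro conjI allI)
  let ?T = "tri (\<lambda>X Y Z. 2 * (X \<bullet> e 5) * \<alpha> [Y, Z] + (Y \<bullet> e 5) * \<alpha> [X, Z] - (Z \<bullet> e 5) * \<alpha> [X, Y])"
  have t: "\<alpha> \<in> tensors 2" using \<alpha> by (simp add: forms_2)
  show "?T \<in> tensors 3"
    by (intro tri_tensors linearI; simp add: inner_simps tensor2_simps[OF t] algebra_simps)
  fix X Y Z
  note s = form2_swap[OF \<alpha>, of Z Y] form2_swap[OF \<alpha>, of Y X] form2_swap[OF \<alpha>, of Z X]
  show "?T [X, Z, Y] = - ?T [X, Y, Z]"
    by (simp add: s)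
  show "?T [X, Y, Z] + ?T [Y, Z, X] + ?T [Z, X, Y] = 0"
    by (simp add: s)
  have z: "\<alpha> [V, V] = 0" for V using \<alpha> by (simp add: forms_2)
  have h': "\<alpha> [X, e 5] = 0" for X using form2_swap[OF \<alpha>, of X "e 5"] h by simp
  show "(\<Sum>i=1..5. ?T [e i, e i, X]) = 0"
    unfolding sum_1_5 by (simp add: z h h')
qed

lemma Lambda2_horizontal:
  assumes "i \<in> {1, 2, 3}" "\<alpha> \<in> Lambda2 e i"
  shows "\<alpha> [e 5, X] = 0"
proof -
  have \<alpha>: "\<alpha> \<in> forms 2" using Lambda2_subset[of i] assms by auto
  then have t: "\<alpha> \<in> tensors 2" by (simp add: forms_2)
  consider "i = 1" | "pull \<phi> \<alpha> = - \<alpha>" | "pull \<phi> \<alpha> = \<alpha>"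
    using assms Lambda2_2_iff Lambda2_3_iff by auto
  then show ?thesis
  proof cases
    case 1
    then obtain c where "\<alpha> = c *\<^sub>R Phi e" using assms by (auto simp: Lambda2_def span_singleton)
    then show ?thesis by simp
  next
    case 2
    have "- \<alpha> [e 5, X] = pull \<phi> \<alpha> [e 5, X]" unfolding 2 by simp
    then show ?thesis by (simp add: pull_eval tensor2_simps[OF t])
  next
    case 3
    have "\<alpha> [e 5, X] = pull \<phi> \<alpha> [e 5, X]" unfolding 3 by simp
    then show ?thesis by (simp add: pull_eval tensor2_simps[OF t])
  qed
qed

section \<open>The components 6 to 9 and the functionals that detect them\<close>

definition hor :: "vec5 \<Rightarrow> vec5" where
  "hor X = X - (X \<bullet> e 5) *\<^sub>R e 5"

lemma hor_e5 [simp]: "hor X \<bullet> e 5 = 0"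
  by (simp add: hor_def inner_simps)

lemma phi_phi_hor: "\<phi> (\<phi> X) = - hor X"
  by (simp add: phi_phi hor_def)

text \<open>One predicate for the four components given by equations, so that closure under sums and
  under the group is shown once. The pairs (1, 0), (0, -1), (-1, 0), (0, 1) give the components 6,
  7, 8, 9.\<close>

definition typed :: "real \<Rightarrow> real \<Rightarrow> tensor set" where
  "typed c d = {A \<in> spaceA3 e. \<forall>X Y Z. A [X, Y, Z] =
     c * (A [\<phi> X, Y, \<phi> Z] + A [\<phi> X, \<phi> Y, Z]) + d * A [X, \<phi> Y, \<phi> Z]}"

lemma compA3_typed:
  "compA3 e 6 = typed 1 0" "compA3 e 7 = typed 0 (-1)" "compA3 e 8 = typed (-1) 0"
  "compA3 e 9 = typed 0 1"
  by (simp_all add: compA3_def typed_def)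

lemma typed_D:
  assumes "A \<in> typed c d"
  shows "A [X, Y, Z] = c * (A [\<phi> X, Y, \<phi> Z] + A [\<phi> X, \<phi> Y, Z]) + d * A [X, \<phi> Y, \<phi> Z]"
    and "A \<in> spaceA3 e" "A \<in> spaceA" "A \<in> tensors 3" "A [X, Z, Y] = - A [X, Y, Z]"
    and "A [X, Y, Z] + A [Y, Z, X] + A [Z, X, Y] = 0" "(\<Sum>i=1..5. A [e i, e i, X]) = 0"
proof -
  show "A [X, Y, Z] = c * (A [\<phi> X, Y, \<phi> Z] + A [\<phi> X, \<phi> Y, Z]) + d * A [X, \<phi> Y, \<phi> Z]"
    using assms unfolding typed_def by blast
  show A: "A \<in> spaceA3 e" using assms by (simp add: typed_def)
  then show "A \<in> spaceA" "A \<in> tensors 3" by (simp_all add: spaceA3_iff spaceA_tensors)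
  then show "A [X, Z, Y] = - A [X, Y, Z]" by (intro spaceA_swap)
  show "A [X, Y, Z] + A [Y, Z, X] + A [Z, X, Y] = 0" "(\<Sum>i=1..5. A [e i, e i, X]) = 0"
    using A by (simp_all add: spaceA3_iff)
qed

lemma subspace_typed: "subspace (typed c d)"
proof -
  have "A + B \<in> typed c d" if A: "A \<in> typed c d" and B: "B \<in> typed c d" for A B
    unfolding typed_def
  proof (intro CollectI conjI allI)
    show "A + B \<in> spaceA3 e"
      using typed_D(2)[OF A] typed_D(2)[OF B] by (intro subspace_add[OF subspace_spaceA3])
    show "(A + B) [X, Y, Z] = c * ((A + B) [\<phi> X, Y, \<phi> Z] + (A + B) [\<phi> X, \<phi> Y, Z])
        + d * (A + B) [X, \<phi> Y, \<phi> Z]" for X Y Z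
      using typed_D(1)[OF A, of X Y Z] typed_D(1)[OF B, of X Y Z] by (simp add: algebra_simps)
  qed
  moreover have "k *\<^sub>R A \<in> typed c d" if A: "A \<in> typed c d" for k A
    unfolding typed_def
  proof (intro CollectI conjI allI)
    show "k *\<^sub>R A \<in> spaceA3 e"
      using typed_D(2)[OF A] by (intro subspace_scale[OF subspace_spaceA3])
    show "(k *\<^sub>R A) [X, Y, Z] = c * ((k *\<^sub>R A) [\<phi> X, Y, \<phi> Z] + (k *\<^sub>R A) [\<phi> X, \<phi> Y, Z])
        + d * (k *\<^sub>R A) [X, \<phi> Y, \<phi> Z]" for X Y Z
      using typed_D(1)[OF A, of X Y Z] by (simp add: algebra_simps)
  qed
  moreover have "0 \<in> typed c d"
    using subspace_0[OF subspace_spaceA3] by (simp add: typed_def)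
  ultimately show ?thesis by (simp add: subspace_def)
qed

lemma Lambda1_2_eq: "Lambda1 e 2 = flat ` {a. a \<bullet> e 5 = 0}"
proof (intro equalityI subsetI)
  fix \<alpha> assume "\<alpha> \<in> Lambda1 e 2"
  then have \<alpha>: "\<alpha> \<in> tensors 1" "\<alpha> [e 5] = 0"
    by (auto simp: Lambda1_def forms_1 contract_def xi_def fun_eq_iff)
  have sharp: "sharp e \<alpha> \<bullet> X = \<alpha> [X]" for X
    using linear_frame_simps(4)[of "\<lambda>X. \<alpha> [X]" X] \<alpha>(1)
    by (simp add: sharp_def inner_sum_left tensors_1)
  then have "\<alpha> = flat (sharp e \<alpha>)"
    by (intro tensor1_eqI \<alpha> flat_tensors) simp
  then show "\<alpha> \<in> flat ` {a. a \<bullet> e 5 = 0}" using sharp[of "e 5"] \<alpha>(2) by auto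
next
  fix \<alpha> assume "\<alpha> \<in> flat ` {a. a \<bullet> e 5 = 0}"
  then obtain a where a: "\<alpha> = flat a" "a \<bullet> e 5 = 0" by blast
  have "contract (e 5) (flat a) = 0"
  proof
    show "contract (e 5) (flat a) xs = 0 xs" for xs
      using a(2) by (cases xs) (simp_all add: contract_def flat_def)
  qed
  then show "\<alpha> \<in> Lambda1 e 2"
    unfolding a(1) using flat_tensors by (simp add: Lambda1_def forms_1 xi_def)
qed

lemma compA3_theta45:
  "compA3 e 4 = theta45 1 (-1) ` {a. a \<bullet> e 5 = 0}" "compA3 e 5 = theta45 2 2 ` {a. a \<bullet> e 5 = 0}"
  by (simp_all add: compA3_def Lambda1_2_eq image_image theta4_flat theta5_flat)

lemma compA3_theta3: "i \<in> {1, 2, 3} \<Longrightarrow> compA3 e i = theta3 e ` Lambda2 e i"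
  by (simp add: compA3_def)

lemma compA3_subset:
  assumes "i \<in> {1..9}"
  shows "compA3 e i \<subseteq> spaceA3 e"
proof -
  consider "i \<in> {1, 2, 3}" | "i = 4" | "i = 5" | "i \<in> {6, 7, 8, 9}" using assms by force
  then show ?thesis
  proof cases
    case 1
    then show ?thesis
      using Lambda2_subset[of i] Lambda2_horizontal[of i]
      by (auto simp: compA3_theta3 intro!: theta3_spaceA3)
  next
    case 4
    then show ?thesis by (auto simp: compA3_typed typed_D(2))
  qed (auto simp: compA3_theta45 theta45_spaceA3)
qed

lemma subspace_compA3:
  assumes "i \<in> {1..9}"
  shows "subspace (compA3 e i)"
proof -
  have H: "subspace {a. a \<bullet> e 5 = 0}" by (auto simp: subspace_def inner_simps)
  consider "i \<in> {1, 2, 3}" | "i = 4" | "i = 5" | "i \<in> {6, 7, 8, 9}" using assms by force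
  then show ?thesis
  proof cases
    case 1
    then show ?thesis
      using subspace_Lambda2[of i] by (auto simp: compA3_theta3 intro!: linear_subspace_image linear_theta3)
  next
    case 4
    then show ?thesis by (auto simp: compA3_typed subspace_typed)
  qed (auto simp: compA3_theta45 intro!: linear_subspace_image linear_theta45 H)
qed

lemma spaceA_hor_expand:
  assumes A: "A \<in> spaceA" and z: "\<And>Y Z. A [e 5, Y, Z] = 0"
  shows "A [X, Y, Z] =
    A [hor X, hor Y, hor Z] + (Y \<bullet> e 5) * A [X, e 5, Z] - (Z \<bullet> e 5) * A [X, e 5, Y]"
proof -
  have "A [X, e 5, e 5] = 0" using spaceA_swap[OF A, of X "e 5" "e 5"] by simp
  then show ?thesis
    unfolding hor_def
    by (simp add: tensor3_simps[OF spaceA_tensors[OF A]] z spaceA_swap[OF A, of X "e 5" Y] algebra_simps)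
qed

text \<open>On horizontal vectors \<open>\<phi>\<close> has the eigenvalues \<open>\<plusminus>\<i>\<close>. A component of \<open>A\<close> with signs \<open>s\<^sub>1, s\<^sub>2, s\<^sub>3\<close> in
  its slots would have to satisfy \<open>1 = - c s\<^sub>1 (s\<^sub>2 + s\<^sub>3)\<close>, where the right side is even; hence \<open>A\<close> vanishes
  on horizontal vectors.\<close>

lemma typed_vertical:
  assumes A: "A \<in> typed c 0" and c: "c * c = 1"
  shows "A [e 5, Y, Z] = 0"
    and "A [X, Y, Z] = (Y \<bullet> e 5) * A [X, e 5, Z] - (Z \<bullet> e 5) * A [X, e 5, Y]"
    and "A [X, e 5, Z] = c * A [\<phi> X, e 5, \<phi> Z]" "A [X, e 5, Z] = A [Z, e 5, X]"
proof -
  note t = tensor3_simps[OF typed_D(4)[OF A]] and D = typed_D(1)[OF A, simplified]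
  show z: "A [e 5, Y, Z] = 0" for Y Z using D[of "e 5" Y Z] by (simp add: t)
  have "A [X, Y, Z] = 0" if "X \<bullet> e 5 = 0" "Y \<bullet> e 5 = 0" "Z \<bullet> e 5 = 0" for X Y Z
  proof -
    let ?a = "A [X, Y, Z]" and ?d = "A [X, \<phi> Y, \<phi> Z]"
    have 1: "A [\<phi> X, \<phi> Y, Z] = c * (?a - ?d)" "A [\<phi> X, Y, \<phi> Z] = c * (?a - ?d)"
      using D[of "\<phi> X" "\<phi> Y" Z] D[of "\<phi> X" Y "\<phi> Z"] that by (simp_all add: t algebra_simps)
    have "?a = c * (c * (?a - ?d) + c * (?a - ?d))" using D[of X Y Z] unfolding 1 .
    also have "\<dots> = (c * c) * (2 * (?a - ?d))" by (simp add: algebra_simps)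
    finally have a: "?a = 2 * (?a - ?d)" by (simp add: c)
    have "?d = - c * (A [\<phi> X, \<phi> Y, Z] + A [\<phi> X, Y, \<phi> Z])"
      using D[of X "\<phi> Y" "\<phi> Z"] that by (simp add: t algebra_simps)
    then have "?d = - c * (c * (?a - ?d) + c * (?a - ?d))" unfolding 1 .
    also have "- c * (c * (?a - ?d) + c * (?a - ?d)) = - (c * c) * (2 * (?a - ?d))" by (simp add: algebra_simps)
    finally have d: "?d = - (2 * (?a - ?d))" by (simp add: c)
    \<comment> \<open>Subtraction gives a - d = 4 (a - d), so a = d, and then a = 2 (a - d) =
      0.\<close>
    from a d show ?thesis by argo
  qed
  then show "A [X, Y, Z] = (Y \<bullet> e 5) * A [X, e 5, Z] - (Z \<bullet> e 5) * A [X, e 5, Y]" for X Y Z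
    using spaceA_hor_expand[OF typed_D(3)[OF A] z, of X Y Z] by simp
  show "A [X, e 5, Z] = c * A [\<phi> X, e 5, \<phi> Z]" using D[of X "e 5" Z] by (simp add: t)
  \<comment> \<open>With A(\<xi>, Y, Z) = 0 the cyclic identity has two terms left, and skewness in
    the last slots turns it into symmetry.\<close>
  show "A [X, e 5, Z] = A [Z, e 5, X]"
    using typed_D(6)[OF A, of X "e 5" Z] z[of Z X] typed_D(5)[OF A, of Z "e 5" X] by simp
qed

lemma typed_horizontal:
  assumes A: "A \<in> typed 0 d"
  shows "A [X, e 5, Z] = 0" "A [X, Y, e 5] = 0" "A [e 5, Y, Z] = 0"
proof -
  note t = tensor3_simps[OF typed_D(4)[OF A]] and D = typed_D(1)[OF A, simplified]
  show z: "A [X, e 5, Z] = 0" "A [X, Y, e 5] = 0" for X Y Z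
    using D[of X "e 5" Z] D[of X Y "e 5"] by (simp_all add: t)
  show "A [e 5, Y, Z] = 0" using typed_D(6)[OF A, of "e 5" Y Z] by (simp add: z)
qed

text \<open>Half the contraction of the last two slots with \<Phi>. Among the components that vanish
  when \<xi> is put in the first slot, it detects the fourth only.\<close>

definition phi_trace :: "tensor \<Rightarrow> vec5 \<Rightarrow> real" where
  "phi_trace A X = A [X, e 1, e 2] + A [X, e 3, e 4]"

text \<open>In general the factor is 1 - 5 p; \<open>theta4\<close> has p = 1.\<close>

lemma phi_trace_theta45: "phi_trace (theta45 1 (-1) a) X = - 4 * (a \<bullet> \<phi> X)" if a: "a \<bullet> e 5 = 0"
proof (rule linear_frame_eqI[where g = "\<lambda>X. - 4 * (a \<bullet> \<phi> X)"])
  have t: "theta45 1 (-1) a \<in> tensors 3" by (rule spaceA_tensors[OF theta45_spaceA])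
  show "linear (phi_trace (theta45 1 (-1) a))"
    by (intro linearI) (simp_all add: phi_trace_def tensor3_simps[OF t] algebra_simps)
  show "linear (\<lambda>X. - 4 * (a \<bullet> \<phi> X))"
    by (intro linearI) (simp_all add: inner_simps phi_add phi_scaleR algebra_simps)
  have "\<forall>i\<in>{1..5}. phi_trace (theta45 1 (-1) a) (e i) = - 4 * (a \<bullet> \<phi> (e i))"
    unfolding ball_1_5 by (simp add: phi_trace_def theta45_def a)
  then show "i \<in> {1..5} \<Longrightarrow> phi_trace (theta45 1 (-1) a) (e i) = - 4 * (a \<bullet> \<phi> (e i))" for i
    by blast
qed

text \<open>For the types (c, 0) only values with \<xi> in the second or third slot survive. For (0,
  -1) the type relation yields A(X, e1, e2) = A(X, e2, e1). For (0, 1) it moves \<phi> from the last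
  slot of the metric trace at \<phi> X to the middle one, and the cyclic identity turns the result
  into the \<Phi>-trace.\<close>

lemma phi_trace_typed:
  "A \<in> typed c 0 \<Longrightarrow> c * c = 1 \<Longrightarrow> phi_trace A X = 0"
  "A \<in> typed 0 (-1) \<Longrightarrow> phi_trace A X = 0"
  "A \<in> typed 0 1 \<Longrightarrow> phi_trace A X = 0"
proof -
  show "phi_trace A X = 0" if "A \<in> typed c 0" "c * c = 1"
    unfolding phi_trace_def using typed_vertical(2)[OF that, of X "e 1" "e 2"]
      typed_vertical(2)[OF that, of X "e 3" "e 4"] by simp
  show "phi_trace A X = 0" if A: "A \<in> typed 0 (-1)"
    using typed_D(1)[OF A, of X "e 1" "e 2"] typed_D(1)[OF A, of X "e 3" "e 4"]
      typed_D(5)[OF A, of X "e 1" "e 2"] typed_D(5)[OF A, of X "e 3" "e 4"]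
    by (simp add: phi_trace_def tensor3_simps[OF typed_D(4)[OF A]])
  show "phi_trace A X = 0" if A: "A \<in> typed 0 1"
  proof -
    note t = tensor3_simps[OF typed_D(4)[OF A]]
    have "(\<Sum>i=1..5. A [e i, e i, \<phi> X]) = 0" by (rule typed_D(7)[OF A])
    then have "A [e 1, e 1, \<phi> X] + A [e 2, e 2, \<phi> X] + A [e 3, e 3, \<phi> X] + A [e 4, e 4, \<phi> X] = 0"
      by (simp add: sum_1_5 typed_horizontal[OF A])
    moreover have "A [Y, Z, \<phi> X] = - A [Y, \<phi> Z, X]" for Y Z
      using typed_D(1)[OF A, of Y Z "\<phi> X"] by (simp add: phi_phi_hor hor_def t typed_horizontal[OF A])
    ultimately have "A [e 1, e 2, X] - A [e 2, e 1, X] + A [e 3, e 4, X] - A [e 4, e 3, X] = 0"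
      by (simp add: t)
    then show ?thesis
      using typed_D(6)[OF A, of "e 1" "e 2" X] typed_D(6)[OF A, of "e 3" "e 4" X]
        typed_D(5)[OF A, of "e 2" X "e 1"] typed_D(5)[OF A, of "e 4" X "e 3"]
      unfolding phi_trace_def by linarith
  qed
qed

section \<open>Independence of the nine components of \<open>spaceA3 e\<close>\<close>

lemma sum_1_9: "(\<Sum>i=1..9. f i) = f 1 + f 2 + f 3 + f 4 + f 5 + f 6 + f 7 + f 8 + f (9::nat)"
  by (simp add: eval_nat_numeral One_nat_def)

text \<open>The factor 1 + r is 0 for \<open>theta4\<close>, which makes component 4 invisible here,
  and 3 for \<open>theta5\<close>.\<close>

lemma theta45_e5:
  assumes "a \<bullet> e 5 = 0"
  shows "theta45 p r a [e 5, Y, Z] = (1 + r) * ((a \<bullet> Y) * (Z \<bullet> e 5) - (a \<bullet> Z) * (Y \<bullet> e 5))"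
  by (simp add: theta45_def inner_commute[of "e 5" Y] inner_commute[of "e 5" Z] assms algebra_simps)

lemma theta3_e5:
  assumes "\<alpha> \<in> forms 2" "\<And>X. \<alpha> [e 5, X] = 0"
  shows "theta3 e \<alpha> [e 5, Y, Z] = 2 * \<alpha> [Y, Z]"
  by (simp add: theta3_eq[OF assms(1)] assms(2))

text \<open>The functionals of the splitting are applied to the relation one after the other; each
  sees only its target and components already known to vanish.\<close>

lemma compA3_independent:
  assumes w: "\<And>i. i \<in> {1..9} \<Longrightarrow> w i \<in> compA3 e i" and sum: "(\<Sum>i=1..9. w i) = 0"
    and i: "i \<in> {1..9}"
  shows "w i = 0"
proof -
  obtain \<alpha>1 \<alpha>2 \<alpha>3 where \<alpha>: "w 1 = theta3 e \<alpha>1" "\<alpha>1 \<in> Lambda2 e 1" "w 2 = theta3 e \<alpha>2" "\<alpha>2 \<in> Lambda2 e 2"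
    "w 3 = theta3 e \<alpha>3" "\<alpha>3 \<in> Lambda2 e 3"
    using w[of 1] w[of 2] w[of 3] by (auto simp: compA3_theta3)
  have f: "\<alpha>1 \<in> forms 2" "\<alpha>2 \<in> forms 2" "\<alpha>3 \<in> forms 2"
    using \<alpha> Lambda2_subset[of 1] Lambda2_subset[of 2] Lambda2_subset[of 3] by auto
  have hz: "\<alpha>1 [e 5, X] = 0" "\<alpha>2 [e 5, X] = 0" "\<alpha>3 [e 5, X] = 0" for X
    using \<alpha> Lambda2_horizontal by blast+
  obtain a b where a: "w 4 = theta45 1 (-1) a" "a \<bullet> e 5 = 0" and b: "w 5 = theta45 2 2 b" "b \<bullet> e 5 = 0"
    using w[of 4] w[of 5] by (auto simp: compA3_theta45)
  have w6: "w 6 \<in> typed 1 0" and w7: "w 7 \<in> typed 0 (-1)" and w8: "w 8 \<in> typed (-1) 0"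
    and w9: "w 9 \<in> typed 0 1"
    using w[of 6] w[of 7] w[of 8] w[of 9] by (simp_all add: compA3_typed)
  have eq: "w 1 xs + w 2 xs + w 3 xs + w 4 xs + w 5 xs + w 6 xs + w 7 xs + w 8 xs + w 9 xs = 0" for xs
    using fun_cong[OF sum, of xs] by (simp add: sum_1_9)
  note e5 = theta3_e5[OF f(1) hz(1)] theta3_e5[OF f(2) hz(2)] theta3_e5[OF f(3) hz(3)]
    theta45_e5[OF a(2)] theta45_e5[OF b(2)] typed_vertical(1)[OF w6, simplified] typed_vertical(1)[OF w8, simplified]
    typed_horizontal[OF w7] typed_horizontal[OF w9]
  \<comment> \<open>With \<xi> in two slots the horizontal 2-forms drop out and -3 (b \<bullet> Z)
    remains.\<close>
  have "b \<bullet> Z = 0" for Z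
    using eq[of "[e 5, e 5, Z]"] unfolding \<alpha> a b e5 by (simp add: hz b(2))
  then have b0: "b = 0" using inner_eq_zero_iff by blast
  then have w5: "w 5 = 0" using b linear_0[OF linear_theta45] by simp
  \<comment> \<open>Index 4 receives the default 0, so that \<open>direct_sum_forms_2\<close>
    applies to three forms.\<close>
  let ?v = "(\<lambda>_::nat. 0)(1 := \<alpha>1, 2 := \<alpha>2, 3 := \<alpha>3)"
  have "\<alpha>1 + \<alpha>2 + \<alpha>3 = 0"
  proof (rule tensor2_eqI)
    show "\<alpha>1 + \<alpha>2 + \<alpha>3 \<in> tensors 2" "0 \<in> tensors 2"
      using f subspace_tensors[of 2] by (auto simp: forms_2 intro!: subspace_add subspace_0)
    show "(\<alpha>1 + \<alpha>2 + \<alpha>3) [Y, Z] = 0 [Y, Z]" for Y Z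
      using eq[of "[e 5, Y, Z]"] unfolding \<alpha> a b e5 by (simp add: b0)
  qed
  then have "(\<Sum>i=1..4. ?v i) = 0" by (simp add: sum_1_4)
  moreover have "?v i \<in> Lambda2 e i" if "i \<in> {1..4}" for i
  proof -
    have "i = 1 \<or> i = 2 \<or> i = 3 \<or> i = 4" using that by force
    then show ?thesis using \<alpha> subspace_0[OF subspace_Lambda2[of 4]] by auto
  qed
  ultimately have v: "?v i = 0" if "i \<in> {1..4}" for i
    using direct_sumD(4)[OF direct_sum_forms_2] that by blast
  have "\<alpha>1 = 0" "\<alpha>2 = 0" "\<alpha>3 = 0" using v[of 1] v[of 2] v[of 3] by simp_all
  then have w123: "w 1 = 0" "w 2 = 0" "w 3 = 0" using \<alpha> linear_0[OF linear_theta3] by simp_all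
  have eq2: "w 4 xs + w 6 xs + w 7 xs + w 8 xs + w 9 xs = 0" for xs
    using eq[of xs] by (simp add: w5 w123)
  have "a \<bullet> \<phi> X = 0" for X
  proof -
    have "phi_trace (w 4) X + phi_trace (w 6) X + phi_trace (w 7) X + phi_trace (w 8) X + phi_trace (w 9) X = 0"
      using eq2[of "[X, e 1, e 2]"] eq2[of "[X, e 3, e 4]"] unfolding phi_trace_def by argo
    then show ?thesis
      using phi_trace_typed(1)[OF w6] phi_trace_typed(1)[OF w8] phi_trace_typed(2)[OF w7]
        phi_trace_typed(3)[OF w9] by (simp add: a phi_trace_theta45)
  qed
  \<comment> \<open>As \<open>a\<close> is horizontal, this choice gives the negative of its squared
    length.\<close>
  from this[of "\<phi> a"] have "a = 0" using a(2) by simp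
  then have w4: "w 4 = 0" using a linear_0[OF linear_theta45] by simp
  have eq3: "w 6 xs + w 7 xs + w 8 xs + w 9 xs = 0" for xs
    using eq2[of xs] by (simp add: w4)
  have m: "w 6 [X, e 5, Z] + w 8 [X, e 5, Z] = 0" for X Z
    using eq3[of "[X, e 5, Z]"] by (simp add: typed_horizontal[OF w7] typed_horizontal[OF w9])
  \<comment> \<open>Replacing X, Z by \<phi> X, \<phi> Z preserves one summand and negates the
    other.\<close>
  have "w 6 [X, e 5, Z] = 0" "w 8 [X, e 5, Z] = 0" for X Z
    using m[of X Z] m[of "\<phi> X" "\<phi> Z"] typed_vertical(3)[OF w6, of X Z] typed_vertical(3)[OF w8, of X Z]
    by simp_all
  then have "w 6 [X, Y, Z] = 0" "w 8 [X, Y, Z] = 0" for X Y Z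
    using typed_vertical(2)[OF w6, of X Y Z] typed_vertical(2)[OF w8, of X Y Z] by simp_all
  then have w68: "w 6 = 0" "w 8 = 0"
    using typed_D(4)[OF w6] typed_D(4)[OF w8] subspace_0[OF subspace_tensors]
    by (auto intro: tensor3_eqI)
  have eq4: "w 7 xs + w 9 xs = 0" for xs using eq3[of xs] by (simp add: w68)
  have "w 7 [X, Y, Z] = 0" "w 9 [X, Y, Z] = 0" for X Y Z
    using eq4[of "[X, Y, Z]"] eq4[of "[X, \<phi> Y, \<phi> Z]"] typed_D(1)[OF w7, of X Y Z] typed_D(1)[OF w9, of X Y Z]
    by simp_all
  then have w79: "w 7 = 0" "w 9 = 0"
    using typed_D(4)[OF w7] typed_D(4)[OF w9] subspace_0[OF subspace_tensors]
    by (auto intro: tensor3_eqI)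
  have "i = 1 \<or> i = 2 \<or> i = 3 \<or> i = 4 \<or> i = 5 \<or> i = 6 \<or> i = 7 \<or> i = 8 \<or> i = 9"
    using i by force
  then show ?thesis using w123 w4 w5 w68 w79 by auto
qed

section \<open>Splitting an arbitrary element of \<open>spaceA3 e\<close>\<close>

lemma spaceA3_D:
  assumes "A \<in> spaceA3 e"
  shows "A \<in> spaceA" "A \<in> tensors 3" "A [X, Z, Y] = - A [X, Y, Z]"
    "A [X, Y, Z] + A [Y, Z, X] + A [Z, X, Y] = 0" "(\<Sum>i=1..5. A [e i, e i, X]) = 0"
  using assms by (auto simp: spaceA3_iff spaceA_tensors spaceA_swap[of A X Z Y])

lemma spaceA3_split_e5:
  assumes A: "A \<in> spaceA3 e"
  shows "\<exists>\<alpha> b. \<alpha> \<in> forms 2 \<and> (\<forall>X. \<alpha> [e 5, X] = 0) \<and> b \<bullet> e 5 = 0 \<and>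
    (\<forall>Y Z. (A - theta3 e \<alpha> - theta45 2 2 b) [e 5, Y, Z] = 0)"
proof -
  note t = tensor3_simps[OF spaceA3_D(2)[OF A]] and s = spaceA3_D(3)[OF A]
  have lin: "linear hor" unfolding hor_def by (intro linearI) (simp_all add: inner_simps algebra_simps)
  have z: "A [X, Y, Y] = 0" for X Y using s[of X Y Y] by simp
  \<comment> \<open>\<open>theta3_e5\<close> doubles the form, hence the divisor 2;
    \<open>hor\<close> removes the part that belongs to \<open>b\<close>.\<close>
  define \<alpha> where "\<alpha> = (\<lambda>xs. case xs of [Y, Z] \<Rightarrow> A [e 5, hor Y, hor Z] / 2 | _ \<Rightarrow> 0)"
  \<comment> \<open>By \<open>theta45_e5\<close> with r = 2, the tensor of \<open>b\<close> has the
    value -3 (b \<bullet> Z) at [\<xi>, \<xi>, Z].\<close>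
  define b where "b = (\<Sum>i=1..5. - (A [e 5, e 5, e i] / 3) *\<^sub>R e i)"
  have \<alpha>_eval: "\<alpha> [Y, Z] = A [e 5, hor Y, hor Z] / 2" for Y Z by (simp add: \<alpha>_def)
  have \<alpha>: "\<alpha> \<in> forms 2"
    unfolding forms_2 tensors_2
  proof (intro conjI allI impI)
    show "length xs \<noteq> 2 \<Longrightarrow> \<alpha> xs = 0" for xs by (auto simp: \<alpha>_def split: list.split)
    show "linear (\<lambda>W. \<alpha> [W, Y])" "linear (\<lambda>W. \<alpha> [X, W])" for X Y
      by (intro linearI; simp add: \<alpha>_eval linear_add[OF lin] linear_scale[OF lin] t field_simps)+
    show "\<alpha> [X, X] = 0" for X by (simp add: \<alpha>_eval z)
  qed
  have \<alpha>5: "\<alpha> [e 5, X] = 0" for X by (simp add: \<alpha>_eval hor_def t)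
  have bZ: "b \<bullet> Z = - (A [e 5, e 5, Z] / 3)" for Z
  proof -
    have "linear (\<lambda>Z. - (A [e 5, e 5, Z] / 3))" by (intro linearI) (simp_all add: t field_simps)
    from linear_frame_simps(4)[OF this, of Z] show ?thesis
      unfolding b_def inner_sum_left inner_scaleR_left .
  qed
  have b5: "b \<bullet> e 5 = 0" by (simp add: bZ z)
  have "(A - theta3 e \<alpha> - theta45 2 2 b) [e 5, Y, Z] = 0" for Y Z
  proof -
    have "A [e 5, Y, e 5] = - A [e 5, e 5, Y]" by (rule s)
    then show ?thesis
      by (simp add: theta3_e5[OF \<alpha> \<alpha>5] theta45_e5[OF b5] \<alpha>_eval bZ hor_def t z field_simps)
  qed
  then show ?thesis using \<alpha> \<alpha>5 b5 by blast
qed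

lemma phi_trace_linear:
  assumes "A \<in> tensors 3"
  shows "linear (phi_trace A)"
  by (intro linearI) (simp_all add: phi_trace_def tensor3_simps[OF assms] algebra_simps)

lemma spaceA3_split_phi_trace:
  assumes A: "A \<in> spaceA3 e" and z: "\<And>Y Z. A [e 5, Y, Z] = 0"
  shows "\<exists>a. a \<bullet> e 5 = 0 \<and> (\<forall>X. phi_trace (A - theta45 1 (-1) a) X = 0)"
proof -
  define u where "u = (\<Sum>i=1..5. phi_trace A (e i) *\<^sub>R e i)"
  have u: "u \<bullet> X = phi_trace A X" for X
    unfolding u_def inner_sum_left inner_scaleR_left
    by (rule linear_frame_simps(4)[OF phi_trace_linear[OF spaceA3_D(2)[OF A]]])
  \<comment> \<open>This inverts the factor -4 of \<open>phi_trace_theta45\<close>, since \<phi> is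
    an isometry on horizontal vectors and \<open>u\<close> is horizontal.\<close>
  define a where "a = (- 1 / 4) *\<^sub>R \<phi> u"
  have a5: "a \<bullet> e 5 = 0" by (simp add: a_def)
  have "u \<bullet> e 5 = 0" by (simp add: u phi_trace_def z)
  then have "\<phi> u \<bullet> \<phi> X = u \<bullet> X" for X by (simp add: inner_phi_left phi_phi hor_def inner_simps)
  then have "phi_trace (theta45 1 (-1) a) X = phi_trace A X" for X
    by (simp add: phi_trace_theta45[OF a5]) (simp add: a_def u)
  moreover have "phi_trace (A - B) X = phi_trace A X - phi_trace B X" for B X
    by (simp add: phi_trace_def)
  ultimately have "phi_trace (A - theta45 1 (-1) a) X = 0" for X by simp
  then show ?thesis using a5 by blast
qed

text \<open>Rebuilds a tensor from its values with \<xi> in the middle slot; by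
  \<open>typed_vertical\<close> all tensors of types (1, 0) and (-1, 0) have this shape.\<close>

definition sym_part :: "(vec5 \<Rightarrow> vec5 \<Rightarrow> real) \<Rightarrow> tensor" where
  "sym_part S = tri (\<lambda>X Y Z. (Y \<bullet> e 5) * S X Z - (Z \<bullet> e 5) * S X Y)"

text \<open>Each condition on the tensor is one on \<open>S\<close>: the cyclic identity is
  symmetry, the trace condition is vanishing of the trace of \<open>S\<close>, and the type is the
  behaviour of \<open>S\<close> under \<phi>.\<close>

lemma sym_part_typed:
  assumes lin: "\<And>Y. linear (\<lambda>X. S X Y)" and sym: "\<And>X Y. S X Y = S Y X" and tr: "(\<Sum>i=1..5. S (e i) (e i)) = 0"
    and c: "c * c = 1" and type: "\<And>X Y. S X Y = c * S (\<phi> X) (\<phi> Y)"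
  shows "sym_part S \<in> typed c 0"
proof -
  have lin': "linear (S X)" for X
  proof -
    have "S X = (\<lambda>Y. S Y X)" by (rule ext) (rule sym)
    then show ?thesis using lin[of X] by metis
  qed
  have S: "S (X + X') Y = S X Y + S X' Y" "S X (Y + Y') = S X Y + S X Y'" "S (k *\<^sub>R X) Y = k * S X Y"
    "S X (k *\<^sub>R Y) = k * S X Y" for X X' Y Y' k
    using lin[of Y] lin'[of X] by (auto simp: linear_iff)
  have S0: "S 0 Y = 0" for Y using S(3)[of 0 0 Y] by simp
  have S5: "S (e 5) Y = 0" for Y using type[of "e 5" Y] by (simp add: S0)
  have "sym_part S \<in> tensors 3"
    unfolding sym_part_def by (intro tri_tensors linearI; simp add: inner_simps S algebra_simps)
  then have A: "sym_part S \<in> spaceA" unfolding spaceA_iff by (simp add: sym_part_def)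
  moreover have "sym_part S [X, Y, Z] + sym_part S [Y, Z, X] + sym_part S [Z, X, Y] = 0" for X Y Z
    by (simp add: sym_part_def sym[of Y X] sym[of Z X] sym[of Z Y])
  moreover have "(\<Sum>i=1..5. sym_part S [e i, e i, X]) = 0" for X
  proof -
    have "(\<Sum>i=1..5. sym_part S [e i, e i, X]) = S (e 5) X - (X \<bullet> e 5) * (\<Sum>i=1..5. S (e i) (e i))"
      unfolding sum_1_5 by (simp add: sym_part_def algebra_simps)
    then show ?thesis by (simp add: tr S5)
  qed
  ultimately have "sym_part S \<in> spaceA3 e" by (simp add: spaceA3_iff)
  moreover have "sym_part S [X, Y, Z] = c * (sym_part S [\<phi> X, Y, \<phi> Z] + sym_part S [\<phi> X, \<phi> Y, Z])
      + 0 * sym_part S [X, \<phi> Y, \<phi> Z]" for X Y Z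
    unfolding sym_part_def tri_eval
    by (subst type[of X Z], subst type[of X Y]) (simp add: algebra_simps)
  ultimately show ?thesis unfolding typed_def by blast
qed

lemma spaceA3_split_middle:
  assumes A: "A \<in> spaceA3 e" and z: "\<And>Y Z. A [e 5, Y, Z] = 0"
  shows "\<exists>B C. B \<in> typed 1 0 \<and> C \<in> typed (-1) 0 \<and> (\<forall>X Z. (A - B - C) [X, e 5, Z] = 0)"
proof -
  note t = tensor3_simps[OF spaceA3_D(2)[OF A]]
  define S where "S X Z = A [X, e 5, Z]" for X Z
  have sym: "S X Z = S Z X" for X Z
  proof -
    have "A [Z, X, e 5] = - A [Z, e 5, X]" by (rule spaceA3_D(3)[OF A])
    then show ?thesis using spaceA3_D(4)[OF A, of X "e 5" Z] z by (simp add: S_def)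
  qed
  have S: "S (X + X') Y = S X Y + S X' Y" "S (k *\<^sub>R X) Y = k * S X Y" "S (X - X') Y = S X Y - S X' Y"
    "S (- X) Y = - S X Y" "S X (- Y) = - S X Y" "S X 0 = 0"
    for X X' Y k by (simp_all add: S_def t)
  have S5: "S (e 5) X = 0" "S X (e 5) = 0" for X using z sym[of X "e 5"] by (simp_all add: S_def)
  have hor: "S (hor X) (hor Y) = S X Y" for X Y
    by (simp add: hor_def S S5 sym[of X "_ - _"] sym[of Y X])
  have trS: "(\<Sum>i=1..5. S (e i) (e i)) = 0"
  proof -
    have "A [e i, e i, e 5] = - S (e i) (e i)" for i
      unfolding S_def by (rule spaceA3_D(3)[OF A])
    then show ?thesis using spaceA3_D(5)[OF A, of "e 5"] by (simp add: sum_negf)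
  qed
  then have trS4: "S (e 1) (e 1) + S (e 2) (e 2) + S (e 3) (e 3) + S (e 4) (e 4) = 0"
    by (simp add: sum_1_5 S5)
  \<comment> \<open>The part of \<open>S\<close> with eigenvalue \<open>c\<close> under
    precomposition with \<phi> in both slots, which is an involution because \<phi> squares to -1 on
    horizontal vectors.\<close>
  define T where "T c X Y = (S X Y + c * S (\<phi> X) (\<phi> Y)) / 2" for c X Y
  have typed: "sym_part (T c) \<in> typed c 0" if c: "c * c = 1" for c
  proof (rule sym_part_typed[OF _ _ _ c])
    show "linear (\<lambda>X. T c X Y)" for Y
      by (intro linearI) (simp_all add: T_def S phi_add phi_scaleR field_simps)
    show "T c X Y = T c Y X" for X Y by (simp add: T_def sym[of X Y] sym[of "\<phi> X" "\<phi> Y"])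
    \<comment> \<open>Up to sign \<phi> permutes the horizontal frame, so this is (1 + c)/2 times
      the trace of \<open>S\<close>.\<close>
    show "(\<Sum>i=1..5. T c (e i) (e i)) = 0"
    proof -
      have "T c (e 1) (e 1) + T c (e 2) (e 2) + T c (e 3) (e 3) + T c (e 4) (e 4) =
          (1 + c) * (S (e 1) (e 1) + S (e 2) (e 2) + S (e 3) (e 3) + S (e 4) (e 4)) / 2"
        by (simp add: T_def S field_simps)
      moreover have "T c (e 5) (e 5) = 0" by (simp add: T_def S S5)
      ultimately show ?thesis unfolding sum_1_5 trS4 by simp
    qed
    have "c * (c * r) = r" for r using c by (simp flip: mult.assoc)
    then show "T c X Y = c * T c (\<phi> X) (\<phi> Y)" for X Y
      by (simp add: T_def phi_phi_hor S hor field_simps)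
  qed
  have "(A - sym_part (T 1) - sym_part (T (-1))) [X, e 5, Z] = 0" for X Z
    by (simp add: sym_part_def T_def S5 S_def[symmetric] S field_simps)
  then show ?thesis using typed[of 1] typed[of "-1"] by auto
qed

text \<open>The two parts are (A - D)/2 and (A + D)/2 with D(X, Y, Z) = A(X, \<phi> Y, \<phi> Z).
  The difficulty is that \<open>D\<close> has to satisfy the trace and cyclic conditions again; this
  is where the vanishing \<Phi>-trace enters.\<close>

lemma spaceA3_split_horizontal:
  assumes A: "A \<in> spaceA3 e" and z: "\<And>Y Z. A [e 5, Y, Z] = 0" and m: "\<And>X Z. A [X, e 5, Z] = 0"
    and tr: "\<And>X. phi_trace A X = 0"
  shows "\<exists>B C. B \<in> typed 0 (-1) \<and> C \<in> typed 0 1 \<and> A = B + C"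
proof -
  note t = tensor3_simps[OF spaceA3_D(2)[OF A]] and s = spaceA3_D(3)[OF A] and cyc = spaceA3_D(4)[OF A]
  have m': "A [X, Y, e 5] = 0" for X Y using s[of X "e 5" Y] m by simp
  define D where "D = tri (\<lambda>X Y Z. A [X, \<phi> Y, \<phi> Z])"
  have D_eval: "D [X, Y, Z] = A [X, \<phi> Y, \<phi> Z]" for X Y Z by (simp add: D_def)
  have Dt: "D \<in> tensors 3"
    unfolding D_def by (intro tri_tensors linearI; simp add: t phi_add phi_scaleR)
  have DA: "D \<in> spaceA"
    unfolding spaceA_iff D_eval by (intro conjI allI Dt s)
  have tr12: "A [e 1, e 2, X] - A [e 2, e 1, X] + A [e 3, e 4, X] - A [e 4, e 3, X] = 0" for X
  proof -
    have "A [e 2, X, e 1] = - A [e 2, e 1, X]" "A [e 4, X, e 3] = - A [e 4, e 3, X]"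
      by (rule s)+
    then show ?thesis
      using cyc[of "e 1" "e 2" X] cyc[of "e 3" "e 4" X] tr[of X] unfolding phi_trace_def by argo
  qed
  have "(\<Sum>i=1..5. D [e i, e i, X]) = 0" for X
    using tr12[of "\<phi> X"] unfolding sum_1_5 by (simp add: D_eval t z)
  moreover have "D [X, Y, Z] + D [Y, Z, X] + D [Z, X, Y] = 0" for X Y Z
  proof -
    \<comment> \<open>The cyclic sum of \<open>D\<close> is a 3-form that vanishes as soon as \<xi>
      is inserted. Four values remain, and all of them are combinations of traces and \<Phi>-traces
      of \<open>A\<close>.\<close>
    define B where "B = tri (\<lambda>X Y Z. D [X, Y, Z] + D [Y, Z, X] + D [Z, X, Y])"
    have trA: "A [e 1, e 1, X] + A [e 2, e 2, X] + A [e 3, e 3, X] + A [e 4, e 4, X] = 0" for X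
      using spaceA3_D(5)[OF A, of X] by (simp add: sum_1_5 z)
    have Ds: "D [X, Z, Y] = - D [X, Y, Z]" for X Y Z by (rule spaceA_swap[OF DA])
    have "B \<in> forms 3"
      unfolding forms_3_iff
    proof (intro conjI allI)
      show "B \<in> tensors 3"
        unfolding B_def by (intro tri_tensors linearI; simp add: tensor3_simps[OF Dt] algebra_simps)
      fix X Y Z
      show "B [Y, X, Z] = - B [X, Y, Z]" "B [X, Z, Y] = - B [X, Y, Z]"
        by (simp_all add: B_def Ds[of X Z Y] Ds[of Y X Z] Ds[of Z Y X])
    qed
    moreover have yy: "A [X, Y, Y] = 0" for X Y using s[of X Y Y] by simp
    moreover have s': "A [X, e 2, e 1] = - A [X, e 1, e 2]" "A [X, e 3, e 1] = - A [X, e 1, e 3]"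
      "A [X, e 4, e 1] = - A [X, e 1, e 4]" "A [X, e 3, e 2] = - A [X, e 2, e 3]"
      "A [X, e 4, e 2] = - A [X, e 2, e 4]" "A [X, e 4, e 3] = - A [X, e 3, e 4]" for X
      by (rule s)+
    ultimately have "B = 0"
      using tr[of "e 1"] tr[of "e 2"] tr[of "e 3"] tr[of "e 4"] trA[of "e 1"] trA[of "e 2"] trA[of "e 3"] trA[of "e 4"]
      by (intro form3_frame_eqI subspace_0 subspace_forms_3)
        (simp_all add: B_def D_eval t z m m' s' yy phi_trace_def)
    then have "B [X, Y, Z] = 0" by simp
    then show ?thesis by (simp add: B_def)
  qed
  ultimately have D: "D \<in> spaceA3 e" using DA by (simp add: spaceA3_iff)
  have pp: "A [X, \<phi> (\<phi> Y), \<phi> (\<phi> Z)] = A [X, Y, Z]" for X Y Z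
    by (simp add: phi_phi_hor hor_def t m m')
  have "(1/2) *\<^sub>R (A + c *\<^sub>R D) \<in> typed 0 c" if "c * c = 1" for c
  proof -
    have "(1/2) *\<^sub>R (A + c *\<^sub>R D) \<in> spaceA3 e"
      using A D by (intro subspace_scale subspace_add subspace_spaceA3)
    moreover have cc: "c * (c * r) = r" for r using that by (simp flip: mult.assoc)
    ultimately show ?thesis by (simp add: typed_def D_eval pp distrib_left cc mult.left_commute[of c "1/2"])
  qed
  from this[of "-1"] this[of 1]
  have "(1/2) *\<^sub>R (A - D) \<in> typed 0 (-1)" "(1/2) *\<^sub>R (A + D) \<in> typed 0 1" by simp_all
  moreover have "A = (1/2) *\<^sub>R (A - D) + (1/2) *\<^sub>R (A + D)"
    by (simp add: fun_eq_iff field_simps)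
  ultimately show ?thesis by blast
qed

lemma direct_sum_spaceA3: "direct_sum {1..9} (compA3 e) (spaceA3 e)"
proof (rule direct_sumI)
  show "(\<Sum>i=1..9. w i) \<in> spaceA3 e" if "\<And>i. i \<in> {1..9} \<Longrightarrow> w i \<in> compA3 e i" for w
    using that compA3_subset by (intro subspace_sum[OF subspace_spaceA3]) blast
next
  fix A assume A: "A \<in> spaceA3 e"
  obtain \<alpha> b where \<alpha>: "\<alpha> \<in> forms 2" "\<And>X. \<alpha> [e 5, X] = 0" and b: "b \<bullet> e 5 = 0"
    and z1: "\<And>Y Z. (A - theta3 e \<alpha> - theta45 2 2 b) [e 5, Y, Z] = 0"
    using spaceA3_split_e5[OF A] by blast
  define A1 where "A1 = A - theta3 e \<alpha> - theta45 2 2 b"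
  have A1: "A1 \<in> spaceA3 e"
    unfolding A1_def
    by (intro subspace_diff subspace_spaceA3 A theta3_spaceA3 theta45_spaceA3 \<alpha> b) simp
  obtain a where a: "a \<bullet> e 5 = 0" and tr: "\<And>X. phi_trace (A1 - theta45 1 (-1) a) X = 0"
    using spaceA3_split_phi_trace[OF A1] z1 unfolding A1_def by blast
  define A2 where "A2 = A1 - theta45 1 (-1) a"
  have A2: "A2 \<in> spaceA3 e"
    unfolding A2_def by (intro subspace_diff subspace_spaceA3 A1 theta45_spaceA3 a) simp
  \<comment> \<open>Subtracting \<open>theta4\<close> does not disturb this, as 1 + r = 0.\<close>
  have z2: "A2 [e 5, Y, Z] = 0" for Y Z
    using z1[of Y Z] theta45_e5[OF a, of 1 "-1" Y Z] unfolding A2_def A1_def by simp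
  obtain B6 B8 where B6: "B6 \<in> typed 1 0" and B8: "B8 \<in> typed (-1) 0"
    and m: "\<And>X Z. (A2 - B6 - B8) [X, e 5, Z] = 0"
    using spaceA3_split_middle[OF A2 z2] by blast
  define A3 where "A3 = A2 - B6 - B8"
  have A3: "A3 \<in> spaceA3 e"
    unfolding A3_def by (intro subspace_diff subspace_spaceA3 A2 typed_D(2)[OF B6] typed_D(2)[OF B8])
  have z3: "A3 [e 5, Y, Z] = 0" for Y Z
    using z2 typed_vertical(1)[OF B6] typed_vertical(1)[OF B8] by (simp add: A3_def)
  have tr3: "phi_trace A3 X = 0" for X
    using tr[of X] phi_trace_typed(1)[OF B6, of X] phi_trace_typed(1)[OF B8, of X]
    unfolding A3_def A2_def phi_trace_def by simp
  obtain B7 B9 where B7: "B7 \<in> typed 0 (-1)" and B9: "B9 \<in> typed 0 1" and A3_eq: "A3 = B7 + B9"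
    using spaceA3_split_horizontal[OF A3 z3 _ tr3] m unfolding A3_def by blast
  obtain v where v: "\<forall>i\<in>{1..4}. v i \<in> Lambda2 e i" and \<alpha>_eq: "\<alpha> = (\<Sum>i=1..4. v i)"
    using direct_sumD(3)[OF direct_sum_forms_2 \<alpha>(1)] by blast
  \<comment> \<open>The fourth space consists of forms with a factor \<eta>, which horizontality of
    \<alpha> excludes.\<close>
  have v4: "v 4 = 0"
  proof -
    have f: "v 4 \<in> forms 2" and p: "pull \<phi> (v 4) = 0" using bspec[OF v, of 4] by (simp_all add: Lambda2_4_iff)
    have "v 4 [e 5, X] = 0" for X
      using \<alpha>(2)[of X] v Lambda2_horizontal[of 1 "v 1" X] Lambda2_horizontal[of 2 "v 2" X]
        Lambda2_horizontal[of 3 "v 3" X] by (simp add: \<alpha>_eq sum_1_4)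
    then have "v 4 [X, e 5] = 0" for X using form2_swap[OF f, of X "e 5"] by simp
    then show ?thesis
      using pull_phi_form2[OF f] unfolding p
      by (intro form2_frame_eqI f subspace_0 subspace_forms_2) simp_all
  qed
  have "theta3 e \<alpha> = theta3 e (v 1) + theta3 e (v 2) + theta3 e (v 3)"
    by (simp add: \<alpha>_eq sum_1_4 v4 linear_add[OF linear_theta3])
  then have eq: "A = theta3 e (v 1) + theta3 e (v 2) + theta3 e (v 3) + theta45 1 (-1) a + theta45 2 2 b
      + B6 + B7 + B8 + B9"
    using A3_eq unfolding A3_def A2_def A1_def by (simp add: algebra_simps)
  let ?w = "(\<lambda>_::nat. 0)(1 := theta3 e (v 1), 2 := theta3 e (v 2), 3 := theta3 e (v 3),
    4 := theta45 1 (-1) a, 5 := theta45 2 2 b, 6 := B6, 7 := B7, 8 := B8, 9 := B9)"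
  show "\<exists>w. (\<forall>i\<in>{1..9}. w i \<in> compA3 e i) \<and> A = (\<Sum>i=1..9. w i)"
  proof (intro exI[of _ ?w] conjI ballI)
    show "A = (\<Sum>i=1..9. ?w i)" unfolding sum_1_9 by (simp add: eq)
    fix i :: nat assume "i \<in> {1..9}"
    then have "i = 1 \<or> i = 2 \<or> i = 3 \<or> i = 4 \<or> i = 5 \<or> i = 6 \<or> i = 7 \<or> i = 8 \<or> i = 9" by force
    then show "?w i \<in> compA3 e i"
      using v a b B6 B7 B8 B9 by (auto simp: compA3_theta3 compA3_theta45 compA3_typed)
  qed
qed (rule subspace_compA3 compA3_independent finite_atLeastAtMost; assumption?)+

section \<open>Irreducibility\<close>

definition z1 :: "vec5 \<Rightarrow> complex" where "z1 X = Complex (X \<bullet> e 1) (X \<bullet> e 2)"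
definition z2 :: "vec5 \<Rightarrow> complex" where "z2 X = Complex (X \<bullet> e 3) (X \<bullet> e 4)"

lemma z_simps:
  "z1 (X + Y) = z1 X + z1 Y" "z2 (X + Y) = z2 X + z2 Y"
  "z1 (c *\<^sub>R X) = of_real c * z1 X" "z2 (c *\<^sub>R X) = of_real c * z2 X"
  "z1 (\<phi> X) = - \<i> * z1 X" "z2 (\<phi> X) = - \<i> * z2 X"
  by (simp_all add: z1_def z2_def complex_eq_iff inner_simps)

lemma z_frame [simp]:
  "z1 (e 1) = 1" "z1 (e 2) = \<i>" "z1 (e 3) = 0" "z1 (e 4) = 0" "z1 (e 5) = 0"
  "z2 (e 1) = 0" "z2 (e 2) = 0" "z2 (e 3) = 1" "z2 (e 4) = \<i>" "z2 (e 5) = 0"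
  by (simp_all add: z1_def z2_def complex_eq_iff)

lemma inner_z: "X \<bullet> Y = Re (z1 X * cnj (z1 Y) + z2 X * cnj (z2 Y)) + (X \<bullet> e 5) * (Y \<bullet> e 5)"
  using inner_frame_sum[of X Y] by (simp add: sum_1_5 z1_def z2_def)

lemma vec_z_eqI: "z1 X = z1 Y \<Longrightarrow> z2 X = z2 Y \<Longrightarrow> X \<bullet> e 5 = Y \<bullet> e 5 \<Longrightarrow> X = Y"
proof (rule frame_vec_eqI)
  assume "z1 X = z1 Y" "z2 X = z2 Y" "X \<bullet> e 5 = Y \<bullet> e 5"
  then have "\<forall>i\<in>{1..5}. X \<bullet> e i = Y \<bullet> e i"
    unfolding ball_1_5 by (simp add: z1_def z2_def)
  then show "i \<in> {1..5} \<Longrightarrow> X \<bullet> e i = Y \<bullet> e i" for i by blast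
qed

text \<open>The complex matrix with rows (p, q) and (r, s) acting on (z1, z2) and fixing \<xi>. In
  these coordinates \<phi> is multiplication by -i, so complex linear maps commute with it.\<close>

definition umap :: "complex \<Rightarrow> complex \<Rightarrow> complex \<Rightarrow> complex \<Rightarrow> vec5 \<Rightarrow> vec5" where
  "umap p q r s X = Re (p * z1 X + q * z2 X) *\<^sub>R e 1 + Im (p * z1 X + q * z2 X) *\<^sub>R e 2
     + Re (r * z1 X + s * z2 X) *\<^sub>R e 3 + Im (r * z1 X + s * z2 X) *\<^sub>R e 4 + (X \<bullet> e 5) *\<^sub>R e 5"

lemma umap_simps [simp]:
  "z1 (umap p q r s X) = p * z1 X + q * z2 X" "z2 (umap p q r s X) = r * z1 X + s * z2 X"
  "umap p q r s X \<bullet> e 5 = X \<bullet> e 5"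
  unfolding umap_def by (simp_all add: z_simps complex_eq_iff inner_simps)

text \<open>The hypotheses say that the columns are orthonormal for the Hermitian product, whose
  real part is the scalar product on horizontal vectors.\<close>

lemma umap_in_G:
  assumes "p * cnj p + r * cnj r = 1" "q * cnj q + s * cnj s = 1" "p * cnj q + r * cnj s = 0"
  shows "umap p q r s \<in> G"
  unfolding in_G_iff
proof (intro conjI allI)
  show "linear (umap p q r s)"
    by (intro linearI vec_z_eqI) (simp_all add: z_simps inner_simps algebra_simps)
  show "umap p q r s (e 5) = e 5"
    by (intro vec_z_eqI) simp_all
  show "umap p q r s (\<phi> X) = \<phi> (umap p q r s X)" for X
    by (intro vec_z_eqI) (simp_all add: z_simps algebra_simps)
  show "umap p q r s X \<bullet> umap p q r s Y = X \<bullet> Y" for X Y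
  proof -
    have "(p * a + q * b) * cnj (p * a' + q * b') + (r * a + s * b) * cnj (r * a' + s * b') =
        (p * cnj p + r * cnj r) * (a * cnj a') + (q * cnj q + s * cnj s) * (b * cnj b')
        + (p * cnj q + r * cnj s) * (a * cnj b') + cnj (p * cnj q + r * cnj s) * (b * cnj a')"
      for a b a' b'
      by (simp add: algebra_simps)
    then show ?thesis by (simp add: inner_z[of "umap p q r s X" "umap p q r s Y"] inner_z[of X Y] assms)
  qed
qed

text \<open>Quarter turns act on weight coordinates by fourth roots of unity. The angle with cosine
  3/5 and sine 4/5 keeps all matrices rational and makes the entries required by
  \<open>irreducible_chart\<close> nonzero.\<close>

definition "rot1 = umap \<i> 0 0 1"
definition "rot2 = umap 1 0 0 \<i>"
definition "rot = umap (3/5) (4/5) (-4/5) (3/5)"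

lemma rots_in_G: "rot1 \<in> G" "rot2 \<in> G" "rot \<in> G"
  unfolding rot1_def rot2_def rot_def by (intro umap_in_G; simp)+

lemma z_rots [simp]:
  "z1 (rot1 X) = \<i> * z1 X" "z2 (rot1 X) = z2 X" "z1 (rot2 X) = z1 X" "z2 (rot2 X) = \<i> * z2 X"
  "z1 (rot X) = (3 * z1 X + 4 * z2 X) / 5" "z2 (rot X) = (3 * z2 X - 4 * z1 X) / 5"
  "rot1 X \<bullet> e 5 = X \<bullet> e 5" "rot2 X \<bullet> e 5 = X \<bullet> e 5" "rot X \<bullet> e 5 = X \<bullet> e 5"
  unfolding rot1_def rot2_def rot_def by (simp_all add: field_simps)

section \<open>Irreducibility from weight coordinates\<close>

lemma subspace_module: "is_module G U \<Longrightarrow> subspace U"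
  by (simp add: is_module_def)

lemma pull_module: "is_module G U \<Longrightarrow> C \<in> G \<Longrightarrow> A \<in> U \<Longrightarrow> pull C A \<in> U"
  by (simp add: is_module_G_iff)

text \<open>The polynomial in a torus element is the projection to coordinate \<open>m\<close>. The
  coefficients are real because submodules are real subspaces; degree 3 suffices when all values of
  \<open>w\<close> are fourth roots of unity.\<close>

definition separates :: "(nat \<Rightarrow> complex) set \<Rightarrow> nat \<Rightarrow> nat \<Rightarrow> bool" where
  "separates T n m \<longleftrightarrow> (\<exists>w\<in>T. \<exists>x0 x1 x2 x3. \<forall>k<n. of_real x0 + of_real x1 * w k
     + of_real x2 * (w k * w k) + of_real x3 * (w k * w k * w k) = (if k = m then 1 else 0))"

lemma separatesI:
  assumes "w \<in> T" "\<And>k. k < n \<Longrightarrow> of_real x0 + of_real x1 * w k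
      + of_real x2 * (w k * w k) + of_real x3 * (w k * w k * w k) = (if k = m then 1 else 0)"
  shows "separates T n m"
  using assms unfolding separates_def by blast

text \<open>A module with a chart by complex weight coordinates is irreducible if the torus separates the
  coordinates, multiplies one of them by \<open>\<i>\<close>, and a rotation links this one with all others.\<close>

lemma irreducible_chart:
  fixes C :: "(nat \<Rightarrow> complex) \<Rightarrow> tensor" and h :: "nat \<Rightarrow> nat \<Rightarrow> real"
  assumes W: "is_module G W" "W \<subseteq> range C" "v \<in> W" "v \<noteq> 0"
    and lin: "linear C" and loc: "\<And>c d. (\<And>k. k < n \<Longrightarrow> c k = d k) \<Longrightarrow> C c = C d"
    and torus: "\<And>w. w \<in> T \<Longrightarrow> \<exists>g\<in>G. \<forall>c. pull g (C c) = C (\<lambda>k. w k * c k)"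
    and proj: "\<And>m. m < n \<Longrightarrow> separates T n m"
    and m: "m < n" "\<exists>w\<in>T. w m = \<i>"
    and rot: "\<exists>g\<in>G. \<forall>c. pull g (C c) = C (\<lambda>k. \<Sum>j<n. of_real (h k j) * c j)"
    and h: "\<And>k. k < n \<Longrightarrow> h m k \<noteq> 0 \<and> h k m \<noteq> 0"
  shows "irreducible_module G W"
proof (rule irreducible_moduleI[OF W(1,3,4)])
  fix U A assume U: "is_module G U" "U \<subseteq> W" "A \<in> U" "A \<noteq> 0"
  let ?s = "\<lambda>j a k. if k = j then a else 0 :: complex"
  note sub = subspace_module[OF U(1)]
  have T: "C (\<lambda>k. w k * c k) \<in> U" if "w \<in> T" "C c \<in> U" for w c
    using torus[OF that(1)] pull_module[OF U(1) _ that(2)] by metis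
  have comb: "x0 *\<^sub>R C c0 + x1 *\<^sub>R C c1 + x2 *\<^sub>R C c2 + x3 *\<^sub>R C c3 \<in> U"
    if "C c0 \<in> U" "C c1 \<in> U" "C c2 \<in> U" "C c3 \<in> U" for x0 x1 x2 x3 c0 c1 c2 c3
    using that by (intro subspace_add subspace_scale sub)
  \<comment> \<open>Projection to one coordinate stays within \<open>U\<close>: apply the
    interpolating polynomial to the torus element.\<close>
  have P: "C (?s j (c j)) \<in> U" if c: "C c \<in> U" and j: "j < n" for c j
  proof -
    obtain w x0 x1 x2 x3 where w: "w \<in> T" and ind: "\<And>k. k < n \<Longrightarrow> of_real x0 + of_real x1 * w k
        + of_real x2 * (w k * w k) + of_real x3 * (w k * w k * w k) = (if k = j then 1 else 0)"
      using proj[OF j] unfolding separates_def by metis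
    let ?c1 = "\<lambda>k. w k * c k" and ?c2 = "\<lambda>k. w k * (w k * c k)" and ?c3 = "\<lambda>k. w k * (w k * (w k * c k))"
    have "x0 *\<^sub>R C c + x1 *\<^sub>R C ?c1 + x2 *\<^sub>R C ?c2 + x3 *\<^sub>R C ?c3 \<in> U"
      by (intro comb c T w)
    also have "x0 *\<^sub>R C c + x1 *\<^sub>R C ?c1 + x2 *\<^sub>R C ?c2 + x3 *\<^sub>R C ?c3 =
        C (x0 *\<^sub>R c + x1 *\<^sub>R ?c1 + x2 *\<^sub>R ?c2 + x3 *\<^sub>R ?c3)"
      by (simp add: linear_add[OF lin] linear_scale[OF lin])
    also have "\<dots> = C (?s j (c j))"
    proof (rule loc)
      fix k assume k: "k < n"
      have "(x0 *\<^sub>R c + x1 *\<^sub>R ?c1 + x2 *\<^sub>R ?c2 + x3 *\<^sub>R ?c3) k = (of_real x0 + of_real x1 * w k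
        + of_real x2 * (w k * w k) + of_real x3 * (w k * w k * w k)) * c k"
        by (simp add: scaleR_conv_of_real algebra_simps)
      then show "(x0 *\<^sub>R c + x1 *\<^sub>R ?c1 + x2 *\<^sub>R ?c2 + x3 *\<^sub>R ?c3) k = ?s j (c j) k"
        using ind[OF k] by simp
    qed
    finally show ?thesis .
  qed
  \<comment> \<open>Rotating a vector that lives in coordinate j and projecting to coordinate k
    multiplies its entry by \<open>h k j\<close>.\<close>
  have R: "C (?s k (of_real (h k j) * a)) \<in> U" if "C (?s j a) \<in> U" "j < n" "k < n" for j k a
  proof -
    obtain g where "g \<in> G" "\<And>c. pull g (C c) = C (\<lambda>k. \<Sum>j<n. of_real (h k j) * c j)"
      using rot by blast
    then have "C (\<lambda>k. \<Sum>l<n. of_real (h k l) * ?s j a l) \<in> U"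
      using pull_module[OF U(1) _ that(1)] by metis
    moreover have "(\<Sum>l<n. of_real (h k l) * ?s j a l) = of_real (h k j) * a" for k
      using that(2) by (simp add: if_distrib cong: if_cong)
    ultimately have "C (\<lambda>k. of_real (h k j) * a) \<in> U" by simp
    from P[OF this that(3)] show ?thesis .
  qed
  have dec: "C c = (\<Sum>j<n. C (?s j (c j)))" for c
  proof -
    have "C c = C (\<Sum>j<n. ?s j (c j))" by (rule loc) simp
    then show ?thesis by (simp add: linear_sum[OF lin])
  qed
  obtain c where c: "A = C c" using U W by blast
  obtain j where j: "j < n" "C (?s j (c j)) \<noteq> 0"
    using dec[of c] U(4) c by (metis (no_types, lifting) lessThan_iff sum.neutral)
  have "c j \<noteq> 0"
  proof
    assume "c j = 0"
    then have "?s j (c j) = 0" by (simp add: fun_eq_iff)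
    then show False using j(2) linear_0[OF lin] by simp
  qed
  \<comment> \<open>The detour through coordinate \<open>m\<close> needs only row and column
    \<open>m\<close> of \<open>h\<close> to be free of zeros.\<close>
  define a where "a = of_real (h m j) * c j"
  have cU: "C c \<in> U" using U(3) c by simp
  have a: "a \<noteq> 0" "C (?s m a) \<in> U"
    using h[OF j(1)] \<open>c j \<noteq> 0\<close> R[OF P[OF cU j(1)] j(1) m(1)] unfolding a_def by simp_all
  obtain w where w: "w \<in> T" "w m = \<i>" using m(2) by blast
  \<comment> \<open>Over the reals \<open>a\<close> and \<open>\<i> * a\<close> span the complex
    numbers, so \<open>U\<close> fills the plane of coordinate \<open>m\<close>.\<close>
  have "C (?s m (\<i> * a)) \<in> U"
    using P[OF T[OF w(1) a(2)] m(1)] by (simp add: w(2) cong: if_cong)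
  then have full: "C (?s m b) \<in> U" for b
  proof -
    obtain x y where b: "b = x *\<^sub>R a + y *\<^sub>R (\<i> * a)"
    proof
      have "b = (b / a) * a" using a by simp
      also have "b / a = of_real (Re (b / a)) + \<i> * of_real (Im (b / a))" by (rule complex_eq)
      finally show "b = Re (b / a) *\<^sub>R a + Im (b / a) *\<^sub>R (\<i> * a)"
        by (simp add: scaleR_conv_of_real algebra_simps)
    qed
    have "x *\<^sub>R C (?s m a) + y *\<^sub>R C (?s m (\<i> * a)) \<in> U"
      using a(2) \<open>C (?s m (\<i> * a)) \<in> U\<close> by (intro subspace_add subspace_scale sub)
    also have "x *\<^sub>R C (?s m a) + y *\<^sub>R C (?s m (\<i> * a)) = C (x *\<^sub>R ?s m a + y *\<^sub>R ?s m (\<i> * a))"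
      by (simp add: linear_add[OF lin] linear_scale[OF lin])
    also have "x *\<^sub>R ?s m a + y *\<^sub>R ?s m (\<i> * a) = ?s m b"
      by (simp add: b fun_eq_iff)
    finally show ?thesis .
  qed
  have "C (?s k b) \<in> U" if "k < n" for k b
    using R[OF full[of "b / of_real (h k m)"] m(1) that] h[OF that] by (simp cong: if_cong)
  then have "C d \<in> U" for d unfolding dec[of d] by (intro subspace_sum sub) simp
  then show "W \<subseteq> U" using W(2) by blast
qed

lemma lt_numeral:
  "(\<Sum>k<2. f k) = f 0 + f (1::nat)" "(\<Sum>k<3. f k) = f 0 + f 1 + f (2::nat)"
  "(\<Sum>k<4. f k) = f 0 + f 1 + f 2 + f (3::nat)"
  "(\<forall>k<2. P k) \<longleftrightarrow> P 0 \<and> P (1::nat)" "(\<forall>k<3. P k) \<longleftrightarrow> P 0 \<and> P 1 \<and> P (2::nat)"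
  "(\<forall>k<4. P k) \<longleftrightarrow> P 0 \<and> P 1 \<and> P 2 \<and> P (3::nat)" for f :: "nat \<Rightarrow> 'a::comm_monoid_add"
  by (simp_all add: eval_nat_numeral All_less_Suc One_nat_def conj_ac)

lemma lt_cases:
  "m < 2 \<longleftrightarrow> m = 0 \<or> m = (1::nat)" "m < 3 \<longleftrightarrow> m = 0 \<or> m = 1 \<or> m = (2::nat)"
  "m < 4 \<longleftrightarrow> m = 0 \<or> m = 1 \<or> m = 2 \<or> m = (3::nat)"
  by auto

section \<open>Invariance of the subspaces under the group\<close>

lemma pull_tri: "pull C (tri f) = tri (\<lambda>X Y Z. f (C X) (C Y) (C Z))"
  by (auto simp: pull_def tri_def fun_eq_iff split: list.split)

lemma pull_pull_phi: "C \<in> G \<Longrightarrow> pull \<phi> (pull C \<alpha>) = pull C (pull \<phi> \<alpha>)"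
proof -
  assume C: "C \<in> G"
  have eq: "C \<circ> \<phi> = \<phi> \<circ> C" using G_D(4)[OF C] by (simp add: fun_eq_iff)
  show ?thesis by (simp add: pull_def) (simp only: eq)
qed

lemma G_linear: "C \<in> G \<Longrightarrow> linear C"
  by (rule G_D(1))

lemma pull_flat:
  assumes C: "C \<in> G"
  shows "pull C (flat a) = flat (inv C a)"
proof (rule tensor1_eqI)
  show "pull C (flat a) \<in> tensors 1" by (intro pull_tensors G_linear C flat_tensors)
  show "flat (inv C a) \<in> tensors 1" by (rule flat_tensors)
  have "C (inv C a) = a" using bij_G[OF C] by (simp add: bij_is_surj surj_f_inv_f)
  then show "pull C (flat a) [X] = flat (inv C a) [X]" for X
    using G_D(2)[OF C, of "inv C a" X] by (simp add: pull_eval)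
qed

lemma is_module_Lambda1_2: "is_module G (Lambda1 e 2)"
  unfolding is_module_G_iff
proof (intro conjI ballI)
  have "subspace {a. a \<bullet> e 5 = 0}" by (auto simp: subspace_def inner_simps)
  then show "subspace (Lambda1 e 2)"
    unfolding Lambda1_2_eq by (rule linear_subspace_image[OF linear_flat])
  show "pull C \<alpha> \<in> Lambda1 e 2" if "C \<in> G" "\<alpha> \<in> Lambda1 e 2" for C \<alpha>
    using that G_D(6)[OF inv_in_G[OF that(1)]] unfolding Lambda1_2_eq by (auto simp: pull_flat)
qed

lemma is_module_Lambda2_2: "is_module G (Lambda2 e 2)"
  unfolding is_module_G_iff
proof (intro conjI ballI)
  show "subspace (Lambda2 e 2)" by (rule subspace_Lambda2) simp
  show "pull C \<alpha> \<in> Lambda2 e 2" if "C \<in> G" "\<alpha> \<in> Lambda2 e 2" for C \<alpha>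
    using that by (simp add: Lambda2_2_iff pull_pull_phi pull_forms_2 G_linear linear_neg[OF linear_pull])
qed

lemma is_module_Lambda2_3: "is_module G (Lambda2 e 3)"
  unfolding is_module_G_iff
proof (intro conjI ballI)
  show "subspace (Lambda2 e 3)" by (rule subspace_Lambda2) simp
  show "pull C \<alpha> \<in> Lambda2 e 3" if C: "C \<in> G" and "\<alpha> \<in> Lambda2 e 3" for C \<alpha>
  proof -
    have \<alpha>: "\<alpha> \<in> forms 2" "pull \<phi> \<alpha> = \<alpha>" "\<alpha> [e 1, e 2] + \<alpha> [e 3, e 4] = 0"
      using that by (simp_all add: Lambda2_3_iff)
    have t: "\<beta> \<in> tensors 2" if "\<beta> \<in> forms 2" for \<beta> using that by (simp add: forms_2)
    \<comment> \<open>A contraction over the whole frame, to which \<open>trace_G\<close> applies,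
      in place of the two single components.\<close>
    have trace: "(\<Sum>i=1..5. \<beta> [e i, \<phi> (e i)]) = - 2 * (\<beta> [e 1, e 2] + \<beta> [e 3, e 4])"
      if "\<beta> \<in> forms 2" for \<beta>
      unfolding sum_1_5 by (simp add: tensor2_simps[OF t[OF that]] form2_frame_sort[OF that])
    have "(\<Sum>i=1..5. \<alpha> [C (e i), \<phi> (C (e i))]) = (\<Sum>i=1..5. \<alpha> [e i, \<phi> (e i)])"
      using tensor2_simps[OF t[OF \<alpha>(1)]]
      by (intro trace_G[OF _ _ C, of "\<lambda>X Y. \<alpha> [X, \<phi> Y]"] linearI) (simp_all add: phi_add phi_scaleR)
    then have "(\<Sum>i=1..5. pull C \<alpha> [e i, \<phi> (e i)]) = (\<Sum>i=1..5. \<alpha> [e i, \<phi> (e i)])"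
      by (simp add: pull_eval G_D(4)[OF C])
    then show ?thesis
      using C \<alpha> unfolding Lambda2_3_iff trace[OF \<alpha>(1)] trace[OF pull_forms_2[OF G_linear[OF C] \<alpha>(1)]]
      by (simp add: pull_pull_phi pull_forms_2 G_linear)
  qed
qed

lemma pull_spaceA3:
  assumes C: "C \<in> G" and A: "A \<in> spaceA3 e"
  shows "pull C A \<in> spaceA3 e"
proof -
  have "pull C A \<in> spaceA"
    using spaceA3_D(2,3)[OF A] unfolding spaceA_iff pull_eval
    by (intro conjI allI pull_tensors G_linear[OF C])
  moreover have "(\<Sum>i=1..5. A [C (e i), C (e i), C X]) = (\<Sum>i=1..5. A [e i, e i, C X])" for X
    by (intro trace_G[OF _ _ C, of "\<lambda>V W. A [V, W, C X]"] linearI)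
      (simp_all add: tensor3_simps[OF spaceA3_D(2)[OF A]])
  ultimately show ?thesis using A by (simp add: spaceA3_iff pull_eval)
qed

lemma is_module_typed: "is_module G (typed c d)"
  unfolding is_module_G_iff
proof (intro conjI ballI subspace_typed)
  show "pull C A \<in> typed c d" if C: "C \<in> G" and A: "A \<in> typed c d" for C A
    unfolding typed_def
  proof (intro CollectI conjI allI)
    show "pull C A \<in> spaceA3 e" using pull_spaceA3[OF C typed_D(2)[OF A]] .
    show "pull C A [X, Y, Z] = c * (pull C A [\<phi> X, Y, \<phi> Z] + pull C A [\<phi> X, \<phi> Y, Z])
        + d * pull C A [X, \<phi> Y, \<phi> Z]" for X Y Z
      unfolding pull_eval G_D(4)[OF C] by (rule typed_D(1)[OF A])
  qed
qed

section \<open>Irreducible modules of forms\<close>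

definition chart_V :: "(nat \<Rightarrow> complex) \<Rightarrow> tensor" where
  "chart_V c = (\<lambda>xs. case xs of [X] \<Rightarrow> Re (c 0 * z1 X + c 1 * z2 X) | _ \<Rightarrow> 0)"

text \<open>A real linear form on \<complex>^2 is the real part of a unique complex linear one,
  which provides complex coordinates. The matrix \<open>h\<close> is the substitution of
  \<open>rot\<close> into c0 z1 + c1 z2.\<close>

lemma irreducible_Lambda1_2: "irreducible_module G (Lambda1 e 2)"
proof (rule irreducible_chart[where C = chart_V and n = 2 and m = 0 and T = "{\<lambda>k. [\<i>, 1] ! k}"
      and h = "\<lambda>k j. [[3, -4], [4, 3]] ! k ! j / 5" and v = "flat (e 1)"])
  show "is_module G (Lambda1 e 2)" by (rule is_module_Lambda1_2)
  show "Lambda1 e 2 \<subseteq> range chart_V"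
  proof
    fix \<alpha> assume "\<alpha> \<in> Lambda1 e 2"
    then obtain a where a: "\<alpha> = flat a" "a \<bullet> e 5 = 0" unfolding Lambda1_2_eq by blast
    have "a \<bullet> X = Re (cnj (z1 a) * z1 X + cnj (z2 a) * z2 X)" for X
      using a(2) inner_z[of a X] by simp
    then have "flat a = chart_V (\<lambda>k. [cnj (z1 a), cnj (z2 a)] ! k)"
      unfolding flat_def chart_V_def by (auto simp: fun_eq_iff split: list.split)
    then show "\<alpha> \<in> range chart_V" using a by blast
  qed
  show "flat (e 1) \<in> Lambda1 e 2" by (auto simp: Lambda1_2_eq)
  have "flat (e 1) [e 1] = 1" by simp
  then show "flat (e 1) \<noteq> 0" by (metis zero_fun_apply zero_neq_one)
  show "linear chart_V"
    by (intro linearI) (auto simp: chart_V_def fun_eq_iff algebra_simps split: list.split)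
  show "chart_V c = chart_V d" if "\<And>k. k < 2 \<Longrightarrow> c k = d k" for c d
    using that[of 0] that[of 1] by (simp add: chart_V_def cong: list.case_cong)
  show "\<exists>g\<in>G. \<forall>c. pull g (chart_V c) = chart_V (\<lambda>k. w k * c k)" if "w \<in> {\<lambda>k. [\<i>, 1] ! k}" for w
    using that by (intro bexI[of _ rot1] rots_in_G)
      (auto simp: pull_def chart_V_def fun_eq_iff split: list.split)
  show "\<exists>g\<in>G. \<forall>c. pull g (chart_V c) =
      chart_V (\<lambda>k. \<Sum>j<2. of_real ([[3, -4], [4, 3]] ! k ! j / 5) * c j)"
    by (intro bexI[of _ rot] rots_in_G)
      (auto simp: pull_def chart_V_def fun_eq_iff lt_numeral field_simps split: list.split)
  show "separates {\<lambda>k. [\<i>, 1] ! k} 2 m" if m: "m < 2" for m :: nat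
  proof -
    consider "m = 0" | "m = 1" using m unfolding lt_cases by blast
    then show ?thesis
    proof cases
      case 1
      \<comment> \<open>The polynomial (1 - w^2)/2 is 1 at i and 0 at 1.\<close>
      show ?thesis
        by (rule separatesI[of "\<lambda>k. [\<i>, 1] ! k" _ _ "1/2" 0 "-1/2" 0]) (auto simp: 1 lt_cases)
    next
      case 2
      show ?thesis
        by (rule separatesI[of "\<lambda>k. [\<i>, 1] ! k" _ _ "1/2" 0 "1/2" 0]) (auto simp: 2 lt_cases)
    qed
  qed
qed (auto simp: lt_cases)

text \<open>The real part of a complex multiple of dz1 \<and> dz2.\<close>

definition chart_L :: "(nat \<Rightarrow> complex) \<Rightarrow> tensor" where
  "chart_L c = (\<lambda>xs. case xs of [X, Y] \<Rightarrow> Re (c 0 * (z1 X * z2 Y - z1 Y * z2 X)) | _ \<Rightarrow> 0)"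

lemma Lambda2_2_coords:
  assumes \<alpha>: "\<alpha> \<in> Lambda2 e 2"
  shows "\<alpha> [X, Y] = Re (Complex (\<alpha> [e 1, e 3]) (- \<alpha> [e 1, e 4]) * (z1 X * z2 Y - z1 Y * z2 X))"
proof -
  have f: "\<alpha> \<in> forms 2" and p: "pull \<phi> \<alpha> = - \<alpha>" using \<alpha> by (simp_all add: Lambda2_2_iff)
  have c: "\<alpha> [e 1, e 2] = 0" "\<alpha> [e 2, e 4] = - \<alpha> [e 1, e 3]" "\<alpha> [e 2, e 3] = \<alpha> [e 1, e 4]"
    "\<alpha> [e 1, e 5] = 0" "\<alpha> [e 2, e 5] = 0" "\<alpha> [e 3, e 4] = 0" "\<alpha> [e 3, e 5] = 0" "\<alpha> [e 4, e 5] = 0"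
    using pull_phi_form2[OF f] unfolding p uminus_fun_eval by linarith+
  show ?thesis
    by (subst form2_expand[OF f]) (simp add: c z1_def z2_def algebra_simps)
qed

lemma form2_eq_case:
  assumes "\<alpha> \<in> forms 2" "\<And>X Y. \<alpha> [X, Y] = f X Y"
  shows "\<alpha> = (\<lambda>xs. case xs of [X, Y] \<Rightarrow> f X Y | _ \<Rightarrow> 0)"
  using assms by (auto simp: forms_2 tensors_2 fun_eq_iff split: list.split)

text \<open>As \<open>rot\<close> has determinant 1, it fixes dz1 \<and> dz2, whence
  \<open>h = 1\<close>; \<open>rot1\<close> multiplies the single coordinate by i. The witness
  \<open>v\<close> is the real part of dz1 \<and> dz2.\<close>

lemma irreducible_Lambda2_2: "irreducible_module G (Lambda2 e 2)"
proof (rule irreducible_chart[where C = chart_L and n = 1 and m = 0 and T = "{\<lambda>_. \<i>}"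
      and h = "\<lambda>_ _. 1"
      and v = "wedge 1 1 (flat (e 1)) (flat (e 3)) - wedge 1 1 (flat (e 2)) (flat (e 4))"])
  let ?v = "wedge 1 1 (flat (e 1)) (flat (e 3)) - wedge 1 1 (flat (e 2)) (flat (e 4))"
  show "is_module G (Lambda2 e 2)" by (rule is_module_Lambda2_2)
  show "Lambda2 e 2 \<subseteq> range chart_L"
  proof
    fix \<alpha> assume \<alpha>: "\<alpha> \<in> Lambda2 e 2"
    have "\<alpha> = chart_L (\<lambda>_. Complex (\<alpha> [e 1, e 3]) (- \<alpha> [e 1, e 4]))"
      unfolding chart_L_def using Lambda2_subset[of 2] \<alpha>
      by (intro form2_eq_case Lambda2_2_coords) auto
    then show "\<alpha> \<in> range chart_L" by blast
  qed
  have f: "?v \<in> forms 2"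
    by (intro subspace_diff subspace_forms_2 wedge_1_1_forms flat_tensors)
  have "pull \<phi> ?v = - ?v"
    by (intro form2_frame_eqI pull_forms_2 linear_phi f form2_neg)
      (simp_all add: pull_phi_form2[OF f], simp_all add: wedge_1_1)
  then show "?v \<in> Lambda2 e 2" using f by (simp add: Lambda2_2_iff)
  have "?v [e 1, e 3] = 1" by (simp add: wedge_1_1)
  then show "?v \<noteq> 0" by (metis zero_fun_apply zero_neq_one)
  show "linear chart_L"
    by (intro linearI) (auto simp: chart_L_def fun_eq_iff algebra_simps split: list.split)
  show "chart_L c = chart_L d" if "\<And>k. k < 1 \<Longrightarrow> c k = d k" for c d
    using that[of 0] by (simp add: chart_L_def cong: list.case_cong)
  show "\<exists>g\<in>G. \<forall>c. pull g (chart_L c) = chart_L (\<lambda>k. w k * c k)" if "w \<in> {\<lambda>_. \<i>}" for w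
    using that by (intro bexI[of _ rot1] rots_in_G)
      (auto simp: pull_def chart_L_def fun_eq_iff algebra_simps split: list.split)
  show "\<exists>g\<in>G. \<forall>c. pull g (chart_L c) = chart_L (\<lambda>k. \<Sum>j<1. of_real 1 * c j)"
    by (intro bexI[of _ rot] rots_in_G)
      (auto simp: pull_def chart_L_def fun_eq_iff field_simps One_nat_def split: list.split)
  show "separates {\<lambda>_. \<i>} 1 m" if "m < 1" for m :: nat
    using that by (intro separatesI[of "\<lambda>_. \<i>" _ _ 1 0 0 0]) (auto simp: One_nat_def)
qed auto

text \<open>\<open>a\<close> is the coordinate of weight (1, -1), \<open>r\<close> that of weight
  zero. Since \<open>r\<close> is real, \<open>irreducible_chart\<close> does not apply to this
  module.\<close>

definition chart_adj :: "complex \<Rightarrow> real \<Rightarrow> tensor" where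
  "chart_adj a r = (\<lambda>xs. case xs of [X, Y] \<Rightarrow> Re (a * (z1 X * cnj (z2 Y) - z1 Y * cnj (z2 X)))
     + r * (Im (z1 X * cnj (z1 Y)) - Im (z2 X * cnj (z2 Y))) | _ \<Rightarrow> 0)"

lemma chart_adj_linear:
  "chart_adj a r + chart_adj b s = chart_adj (a + b) (r + s)"
  "c *\<^sub>R chart_adj a r = chart_adj (c *\<^sub>R a) (c * r)"
  by (auto simp: chart_adj_def fun_eq_iff algebra_simps split: list.split)

lemma Lambda2_3_coords:
  assumes \<alpha>: "\<alpha> \<in> Lambda2 e 3"
  shows "\<alpha> = chart_adj (Complex (\<alpha> [e 1, e 3]) (\<alpha> [e 1, e 4])) (- \<alpha> [e 1, e 2])"
  unfolding chart_adj_def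
proof (rule form2_eq_case)
  show f: "\<alpha> \<in> forms 2" using \<alpha> by (simp add: Lambda2_3_iff)
  have p: "pull \<phi> \<alpha> = \<alpha>" and "\<alpha> [e 1, e 2] + \<alpha> [e 3, e 4] = 0" using \<alpha> by (simp_all add: Lambda2_3_iff)
  then have c: "\<alpha> [e 3, e 4] = - \<alpha> [e 1, e 2]" "\<alpha> [e 2, e 4] = \<alpha> [e 1, e 3]"
      "\<alpha> [e 2, e 3] = - \<alpha> [e 1, e 4]" "\<alpha> [e 1, e 5] = 0" "\<alpha> [e 2, e 5] = 0"
      "\<alpha> [e 3, e 5] = 0" "\<alpha> [e 4, e 5] = 0"
    using pull_phi_form2[OF f] unfolding p by linarith+
  show "\<alpha> [X, Y] = Re (Complex (\<alpha> [e 1, e 3]) (\<alpha> [e 1, e 4]) * (z1 X * cnj (z2 Y) - z1 Y * cnj (z2 X)))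
     + - \<alpha> [e 1, e 2] * (Im (z1 X * cnj (z1 Y)) - Im (z2 X * cnj (z2 Y)))" for X Y
    by (subst form2_expand[OF f]) (simp add: c z1_def z2_def algebra_simps)
qed

lemma irreducible_Lambda2_3: "irreducible_module G (Lambda2 e 3)"
proof (rule irreducible_moduleI)
  let ?v = "wedge 1 1 (flat (e 1)) (flat (e 3)) + wedge 1 1 (flat (e 2)) (flat (e 4))"
  show "is_module G (Lambda2 e 3)" by (rule is_module_Lambda2_3)
  have f: "?v \<in> forms 2"
    by (intro subspace_add subspace_forms_2 wedge_1_1_forms flat_tensors)
  have "pull \<phi> ?v = ?v"
    by (intro form2_frame_eqI pull_forms_2 linear_phi f)
      (simp_all add: pull_phi_form2[OF f], simp_all add: wedge_1_1)
  then show "?v \<in> Lambda2 e 3" using f by (simp add: Lambda2_3_iff wedge_1_1)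
  have "?v [e 1, e 3] = 1" by (simp add: wedge_1_1)
  then show "?v \<noteq> 0" by (metis zero_fun_apply zero_neq_one)
  fix U A assume U: "is_module G U" "U \<subseteq> Lambda2 e 3" "A \<in> U" "A \<noteq> 0"
  note sub = subspace_module[OF U(1)]
  have R1: "chart_adj (\<i> * a) r \<in> U" if "chart_adj a r \<in> U" for a r
  proof -
    have "pull rot1 (chart_adj a r) = chart_adj (\<i> * a) r"
      by (auto simp: pull_def chart_adj_def fun_eq_iff algebra_simps split: list.split)
    then show ?thesis using pull_module[OF U(1) rots_in_G(1) that] by simp
  qed
  \<comment> \<open>Conjugation by \<open>rot\<close>, with the double angle formulas: 9 and 16 are
    the squares of 3 and 4, 24 is twice their product, and -7 is the difference of the
    squares.\<close>
  have R: "chart_adj ((9 * a + 16 * cnj a - 24 * \<i> * of_real r) / 25) ((24 * Im a - 7 * r) / 25) \<in> U"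
    if "chart_adj a r \<in> U" for a r
  proof -
    have "pull rot (chart_adj a r) =
        chart_adj ((9 * a + 16 * cnj a - 24 * \<i> * of_real r) / 25) ((24 * Im a - 7 * r) / 25)"
      by (auto simp: pull_def chart_adj_def fun_eq_iff field_simps split: list.split)
    then show ?thesis using pull_module[OF U(1) rots_in_G(3) that] by simp
  qed
  have step: "Lambda2 e 3 \<subseteq> U" if ar: "chart_adj a r \<in> U" and a: "a \<noteq> 0" for a r
  proof -
    \<comment> \<open>Two quarter turns negate \<open>a\<close> and fix \<open>r\<close>, so half
      the difference retains \<open>a\<close> alone.\<close>
    have "(1/2) *\<^sub>R (chart_adj a r + (-1) *\<^sub>R chart_adj (\<i> * (\<i> * a)) r) \<in> U"
      by (intro subspace_add subspace_scale sub R1 ar)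
    then have a0: "chart_adj a 0 \<in> U" by (simp add: chart_adj_linear flip: mult.assoc)
    have full: "chart_adj b 0 \<in> U" for b
    proof -
      have b: "b = Re (b / a) *\<^sub>R a + Im (b / a) *\<^sub>R (\<i> * a)"
      proof -
        have "b = (b / a) * a" using a by simp
        also have "b / a = of_real (Re (b / a)) + \<i> * of_real (Im (b / a))" by (rule complex_eq)
        finally show ?thesis by (simp add: scaleR_conv_of_real algebra_simps)
      qed
      have "Re (b / a) *\<^sub>R chart_adj a 0 + Im (b / a) *\<^sub>R chart_adj (\<i> * a) 0 \<in> U"
        by (intro subspace_add subspace_scale sub R1 a0)
      then show ?thesis unfolding chart_adj_linear b[symmetric] by simp
    qed
    \<comment> \<open>Rotating a purely imaginary \<open>a\<close> produces a nonzero real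
      coordinate; its complex coordinate is then subtracted, since \<open>full\<close> covers
      it.\<close>
    have "chart_adj ((9 * \<i> + 16 * cnj \<i> - 24 * \<i> * of_real 0) / 25) (24 / 25) \<in> U"
      using R[OF full[of \<i>]] by simp
    then have "r *\<^sub>R (25 / 24) *\<^sub>R (chart_adj ((9 * \<i> + 16 * cnj \<i> - 24 * \<i> * of_real 0) / 25) (24 / 25)
        + (-1) *\<^sub>R chart_adj ((9 * \<i> + 16 * cnj \<i> - 24 * \<i> * of_real 0) / 25) 0) + chart_adj b 0 \<in> U" for b r
      by (intro subspace_add subspace_scale sub full)
    then have "chart_adj b r \<in> U" for b r by (simp add: chart_adj_linear)
    then show ?thesis using Lambda2_3_coords by (metis subsetI)
  qed
  obtain a r where A: "A = chart_adj a r" using Lambda2_3_coords U by blast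
  show "Lambda2 e 3 \<subseteq> U"
  proof (cases "a = 0")
    case False
    then show ?thesis using step U(3) A by blast
  next
    case True
    have "r \<noteq> 0"
    proof
      assume "r = 0"
      then have "A = 0" unfolding A True by (auto simp: chart_adj_def fun_eq_iff split: list.split)
      then show False using U(4) by simp
    qed
    \<comment> \<open>If only \<open>r\<close> is present, a rotation creates the complex coordinate
      -24 i r / 25, to which \<open>step\<close> applies.\<close>
    moreover have "chart_adj ((9 * a + 16 * cnj a - 24 * \<i> * of_real r) / 25) ((24 * Im a - 7 * r) / 25) \<in> U"
      using R U(3) A by blast
    ultimately show ?thesis using step True by simp
  qed
qed

section \<open>The components 7, 8 and 9\<close>

definition chart_VL :: "(nat \<Rightarrow> complex) \<Rightarrow> tensor" where
  "chart_VL c = tri (\<lambda>X Y Z. Re ((c 0 * z1 X + c 1 * z2 X) * (z1 Y * z2 Z - z1 Z * z2 Y)))"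

lemma linear_tri_Re:
  assumes "\<And>c d X Y Z. F (c + d) X Y Z = F c X Y Z + F d X Y Z"
    and "\<And>r c X Y Z. F (r *\<^sub>R c) X Y Z = r *\<^sub>R F c X Y Z"
  shows "linear (\<lambda>c :: nat \<Rightarrow> complex. tri (\<lambda>X Y Z. Re (F c X Y Z)))"
  by (intro linearI) (auto simp: tri_def fun_eq_iff assms split: list.split)

lemma z_linear_eqI:
  fixes f :: "vec5 \<Rightarrow> real"
  assumes "linear f" "f (e 5) = 0" "f (e 1) = Re c" "f (e 2) = - Im c" "f (e 3) = Re d" "f (e 4) = - Im d"
  shows "f X = Re (c * z1 X + d * z2 X)"
proof -
  have "f X = (X \<bullet> e 1) * f (e 1) + (X \<bullet> e 2) * f (e 2) + (X \<bullet> e 3) * f (e 3) + (X \<bullet> e 4) * f (e 4)"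
    using linear_frame[OF assms(1), of X] by (simp add: sum_1_5 assms(2))
  then show ?thesis by (simp add: assms z1_def z2_def)
qed

text \<open>The type puts a multiple of dz1 \<and> dz2 into the last two slots; the trace conditions
  force its coefficient to depend complex linearly on the first slot.\<close>

lemma typed7_coords:
  assumes A: "A \<in> typed 0 (-1)"
  shows "A = chart_VL (\<lambda>k. [Complex (A [e 1, e 1, e 3]) (- A [e 1, e 1, e 4]),
    Complex (A [e 3, e 1, e 3]) (- A [e 3, e 1, e 4])] ! k)"
  unfolding chart_VL_def
proof (rule tri_eqI)
  note t = tensor3_simps[OF typed_D(4)[OF A]] and s = typed_D(5)[OF A]
  show "length xs \<noteq> 3 \<Longrightarrow> A xs = 0" for xs using typed_D(4)[OF A] by (simp add: tensors_3)
  fix X Y Z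
  have L: "contract W A \<in> Lambda2 e 2" for W
    unfolding Lambda2_2_iff
  proof
    have "A [W, X, X] = 0" for X using s[of W X X] by simp
    then show f: "contract W A \<in> forms 2"
      using typed_D(4)[OF A] by (auto simp: forms_2 tensors_2 tensors_3 contract_def)
    have "A [W, \<phi> X, \<phi> Y] = - A [W, X, Y]" for X Y using typed_D(1)[OF A, of W X Y] by simp
    then show "pull \<phi> (contract W A) = - contract W A"
      using f pull_forms_2[OF linear_phi f] form2_neg[OF f]
      by (intro tensor2_eqI) (simp_all add: forms_2 pull_eval contract_def)
  qed
  have coords: "A [W, Y, Z] = Re (Complex (A [W, e 1, e 3]) (- A [W, e 1, e 4]) * (z1 Y * z2 Z - z1 Z * z2 Y))"
    for W Y Z
    using Lambda2_2_coords[OF L[of W], of Y Z] by (simp add: contract_def)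
  have c: "A [W, e 3, e 1] = - A [W, e 1, e 3]" "A [W, e 4, e 1] = - A [W, e 1, e 4]"
    "A [W, e 2, e 3] = A [W, e 1, e 4]" "A [W, e 2, e 4] = - A [W, e 1, e 3]"
    "A [W, e 3, e 2] = - A [W, e 1, e 4]" "A [W, e 4, e 2] = A [W, e 1, e 3]"
    "A [W, e 1, e 2] = 0" "A [W, e 2, e 1] = 0" "A [W, e 3, e 4] = 0" "A [W, e 4, e 3] = 0"
    "A [W, W, W] = 0" "A [W, e 1, e 1] = 0" "A [W, e 2, e 2] = 0" "A [W, e 3, e 3] = 0" "A [W, e 4, e 4] = 0"
    for W
    by (subst coords, simp)+
  have tr: "(\<Sum>i=1..5. A [e i, e i, W]) = 0" for W by (rule typed_D(7)[OF A])
  \<comment> \<open>These are Cauchy-Riemann equations for the complex coefficient as a function of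
    the first slot.\<close>
  have rel: "A [e 2, e 1, e 4] = - A [e 1, e 1, e 3]" "A [e 2, e 1, e 3] = A [e 1, e 1, e 4]"
    "A [e 4, e 1, e 4] = - A [e 3, e 1, e 3]" "A [e 4, e 1, e 3] = A [e 3, e 1, e 4]"
    using tr[of "e 1"] tr[of "e 2"] tr[of "e 3"] tr[of "e 4"]
    unfolding sum_1_5 by (simp_all add: c typed_horizontal[OF A])
  have "A [X, e 1, e 3] = Re (Complex (A [e 1, e 1, e 3]) (- A [e 1, e 1, e 4]) * z1 X
      + Complex (A [e 3, e 1, e 3]) (- A [e 3, e 1, e 4]) * z2 X)"
    by (intro z_linear_eqI[of "\<lambda>X. A [X, e 1, e 3]"] linearI)
      (simp_all add: t rel typed_horizontal[OF A])
  moreover have "A [X, e 1, e 4] = Re (Complex (A [e 1, e 1, e 4]) (A [e 1, e 1, e 3]) * z1 X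
      + Complex (A [e 3, e 1, e 4]) (A [e 3, e 1, e 3]) * z2 X)"
    by (intro z_linear_eqI[of "\<lambda>X. A [X, e 1, e 4]"] linearI)
      (simp_all add: t rel typed_horizontal[OF A])
  ultimately have "Complex (A [X, e 1, e 3]) (- A [X, e 1, e 4]) = Complex (A [e 1, e 1, e 3]) (- A [e 1, e 1, e 4]) * z1 X
      + Complex (A [e 3, e 1, e 3]) (- A [e 3, e 1, e 4]) * z2 X"
    by (simp add: complex_eq_iff)
  then show "A [X, Y, Z] = Re (([Complex (A [e 1, e 1, e 3]) (- A [e 1, e 1, e 4]),
    Complex (A [e 3, e 1, e 3]) (- A [e 3, e 1, e 4])] ! 0 * z1 X + [Complex (A [e 1, e 1, e 3]) (- A [e 1, e 1, e 4]),
    Complex (A [e 3, e 1, e 3]) (- A [e 3, e 1, e 4])] ! 1 * z2 X) * (z1 Y * z2 Z - z1 Z * z2 Y))"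
    using coords[of X Y Z] by simp
qed

lemma typedI_tri:
  fixes f :: "vec5 \<Rightarrow> vec5 \<Rightarrow> vec5 \<Rightarrow> real"
  assumes lin: "\<And>Y Z. linear (\<lambda>X. f X Y Z)" "\<And>X Z. linear (\<lambda>Y. f X Y Z)"
    and skew: "\<And>X Y Z. f X Z Y = - f X Y Z" and cyc: "\<And>X Y Z. f X Y Z + f Y Z X + f Z X Y = 0"
    and tr: "\<And>X. f (e 1) (e 1) X + f (e 2) (e 2) X + f (e 3) (e 3) X + f (e 4) (e 4) X + f (e 5) (e 5) X = 0"
    and type: "\<And>X Y Z. f X Y Z = c * (f (\<phi> X) Y (\<phi> Z) + f (\<phi> X) (\<phi> Y) Z) + d * f X (\<phi> Y) (\<phi> Z)"
  shows "tri f \<in> typed c d"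
proof -
  have "f X = (\<lambda>Y Z. - f X Z Y)" for X by (intro ext skew)
  then have "linear (f X Y)" for X Y
    using linear_compose_neg[OF lin(2)[of X Y]] by metis
  then have "tri f \<in> tensors 3" using lin by (intro tri_tensors)
  then have "tri f \<in> spaceA3 e"
    unfolding spaceA3_iff spaceA_iff sum_1_5 tri_eval by (intro conjI allI skew cyc tr)
  then show ?thesis
    unfolding typed_def mem_Collect_eq tri_eval by (intro conjI allI type)
qed

text \<open>The matrix \<open>h\<close> is that of \<open>Lambda1 e 2\<close>, because
  \<open>rot\<close> fixes the factor dz1 \<and> dz2. \<open>rot1\<close> separates the two
  coordinates, and \<open>rot2\<close> multiplies coordinate 0 by i.\<close>

lemma irreducible_typed7: "irreducible_module G (typed 0 (-1))"
proof (rule irreducible_chart[where C = chart_VL and n = 2 and m = 0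
      and T = "{\<lambda>k. [-1, \<i>] ! k, \<lambda>k. [\<i>, -1] ! k}" and h = "\<lambda>k j. [[3, -4], [4, 3]] ! k ! j / 5"
      and v = "chart_VL (\<lambda>_. 1)"])
  show "is_module G (typed 0 (-1))" by (rule is_module_typed)
  show "typed 0 (-1) \<subseteq> range chart_VL" using typed7_coords by blast
  show "chart_VL (\<lambda>_. 1) \<in> typed 0 (-1)"
    unfolding chart_VL_def
    by (rule typedI_tri; (intro linearI)?) (simp_all add: z_simps algebra_simps)
  have "chart_VL (\<lambda>_. 1) [e 1, e 1, e 3] = 1" by (simp add: chart_VL_def)
  then show "chart_VL (\<lambda>_. 1) \<noteq> 0" by (metis zero_fun_apply zero_neq_one)
  show "linear chart_VL"
    unfolding chart_VL_def[abs_def]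
    by (rule linear_tri_Re) (simp_all add: algebra_simps)
  show "chart_VL c = chart_VL d" if "\<And>k. k < 2 \<Longrightarrow> c k = d k" for c d
    using that[of 0] that[of 1] by (simp add: chart_VL_def)
  show "\<exists>g\<in>G. \<forall>c. pull g (chart_VL c) = chart_VL (\<lambda>k. w k * c k)"
    if "w \<in> {\<lambda>k. [-1, \<i>] ! k, \<lambda>k. [\<i>, -1] ! k}" for w
  proof -
    have "pull rot1 (chart_VL c) = chart_VL (\<lambda>k. [-1, \<i>] ! k * c k)"
      "pull rot2 (chart_VL c) = chart_VL (\<lambda>k. [\<i>, -1] ! k * c k)" for c
      unfolding chart_VL_def pull_tri by (simp_all add: algebra_simps)
    then show ?thesis using that rots_in_G by blast
  qed
  have "pull rot (chart_VL c) = chart_VL (\<lambda>k. \<Sum>j<2. of_real ([[3, -4], [4, 3]] ! k ! j / 5) * c j)" for c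
    unfolding chart_VL_def pull_tri
    by (intro arg_cong[of _ _ tri] ext arg_cong[of _ _ Re]) (simp add: lt_numeral field_simps)
  then show "\<exists>g\<in>G. \<forall>c. pull g (chart_VL c) =
      chart_VL (\<lambda>k. \<Sum>j<2. of_real ([[3, -4], [4, 3]] ! k ! j / 5) * c j)"
    using rots_in_G by blast
  show "separates {\<lambda>k. [-1, \<i>] ! k, \<lambda>k. [\<i>, -1] ! k} 2 m" if m: "m < 2" for m :: nat
  proof -
    consider "m = 0" | "m = 1" using m unfolding lt_cases by blast
    then show ?thesis
    proof cases
      case 1
      show ?thesis
        by (rule separatesI[of "\<lambda>k. [-1, \<i>] ! k" _ _ "1/2" 0 "1/2" 0]) (auto simp: 1 lt_cases)
    next
      case 2
      show ?thesis
        by (rule separatesI[of "\<lambda>k. [-1, \<i>] ! k" _ _ "1/2" 0 "-1/2" 0]) (auto simp: 2 lt_cases)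
    qed
  qed
qed (auto simp: lt_cases)

definition quad :: "(nat \<Rightarrow> complex) \<Rightarrow> vec5 \<Rightarrow> vec5 \<Rightarrow> complex" where
  "quad c X Y = c 0 * (z1 X * z1 Y) + c 1 * (z1 X * z2 Y + z2 X * z1 Y) + c 2 * (z2 X * z2 Y)"

text \<open>Substitution of the rotation into the binary quadratic form c0 z1^2 + 2 c1 z1 z2 + c2
  z2^2.\<close>

lemma quad_rot:
  assumes "k 0 = (9 * c 0 - 24 * c 1 + 16 * c 2) / 25" "k 1 = (12 * c 0 - 7 * c 1 - 12 * c 2) / 25"
    "k 2 = (16 * c 0 + 24 * c 1 + 9 * c 2) / 25"
  shows "quad c (rot X) (rot Y) = quad k X Y"
  unfolding quad_def assms z_rots by algebra

definition chart_S2 :: "(nat \<Rightarrow> complex) \<Rightarrow> tensor" where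
  "chart_S2 c = sym_part (\<lambda>X Y. Re (quad c X Y))"

lemma chart_S2_tri:
  "chart_S2 c = tri (\<lambda>X Y Z. Re (of_real (Y \<bullet> e 5) * quad c X Z - of_real (Z \<bullet> e 5) * quad c X Y))"
  by (simp add: chart_S2_def sym_part_def)

text \<open>A horizontal symmetric form that changes sign under \<phi> has no Hermitian part, so it
  is the real part of a complex symmetric bilinear form.\<close>

lemma typed8_coords:
  assumes A: "A \<in> typed (-1) 0"
  shows "A \<in> range chart_S2"
proof -
  note t = tensor3_simps[OF typed_D(4)[OF A]]
  define S where "S X Z = A [X, e 5, Z]" for X Z
  have ty: "S X Z = - S (\<phi> X) (\<phi> Z)" and sym: "S X Z = S Z X" for X Z
    using typed_vertical(3,4)[OF A, of X Z] by (simp_all add: S_def)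
  have S: "S (X + X') Y = S X Y + S X' Y" "S (k *\<^sub>R X) Y = k * S X Y" "S (- X) Y = - S X Y"
    "S X (- Y) = - S X Y" "S 0 Y = 0" "S X (Y + Y') = S X Y + S X Y'" "S X (k *\<^sub>R Y) = k * S X Y"
    "S X 0 = 0" for X X' Y Y' k by (simp_all add: S_def t)
  have S5: "S (e 5) X = 0" "S X (e 5) = 0" for X using ty[of "e 5" X] ty[of X "e 5"] by (simp_all add: S)
  have rel: "S (e 2) (e 1) = S (e 1) (e 2)" "S (e 2) (e 2) = - S (e 1) (e 1)"
    "S (e 3) (e 1) = S (e 1) (e 3)" "S (e 4) (e 1) = S (e 1) (e 4)" "S (e 2) (e 3) = S (e 1) (e 4)"
    "S (e 3) (e 2) = S (e 1) (e 4)" "S (e 2) (e 4) = - S (e 1) (e 3)" "S (e 4) (e 2) = - S (e 1) (e 3)"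
    "S (e 4) (e 3) = S (e 3) (e 4)" "S (e 4) (e 4) = - S (e 3) (e 3)"
    using ty[of "e 1" "e 1"] ty[of "e 1" "e 3"] ty[of "e 1" "e 4"] ty[of "e 3" "e 3"]
      sym[of "e 2" "e 1"] sym[of "e 3" "e 1"] sym[of "e 4" "e 1"] sym[of "e 3" "e 2"] sym[of "e 4" "e 2"]
      sym[of "e 4" "e 3"] by (simp_all add: S)
  obtain c :: "nat \<Rightarrow> complex" where c: "\<And>X. S X (e 1) = Re (c 0 * z1 X + c 1 * z2 X)"
    "\<And>X. S X (e 2) = Re (\<i> * c 0 * z1 X + \<i> * c 1 * z2 X)"
    "\<And>X. S X (e 3) = Re (c 1 * z1 X + c 2 * z2 X)"
    "\<And>X. S X (e 4) = Re (\<i> * c 1 * z1 X + \<i> * c 2 * z2 X)"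
  proof
    let ?c = "\<lambda>k. [Complex (S (e 1) (e 1)) (- S (e 1) (e 2)), Complex (S (e 1) (e 3)) (- S (e 1) (e 4)),
      Complex (S (e 3) (e 3)) (- S (e 3) (e 4))] ! k"
    show "S X (e 1) = Re (?c 0 * z1 X + ?c 1 * z2 X)" for X
      by (intro z_linear_eqI[of "\<lambda>X. S X (e 1)"] linearI) (simp_all add: S S5 rel)
    show "S X (e 2) = Re (\<i> * ?c 0 * z1 X + \<i> * ?c 1 * z2 X)" for X
      by (intro z_linear_eqI[of "\<lambda>X. S X (e 2)"] linearI) (simp_all add: S S5 rel)
    show "S X (e 3) = Re (?c 1 * z1 X + ?c 2 * z2 X)" for X
      by (intro z_linear_eqI[of "\<lambda>X. S X (e 3)"] linearI) (simp_all add: S S5 rel)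
    show "S X (e 4) = Re (\<i> * ?c 1 * z1 X + \<i> * ?c 2 * z2 X)" for X
      by (intro z_linear_eqI[of "\<lambda>X. S X (e 4)"] linearI) (simp_all add: S S5 rel)
  qed
  have quad: "S X Z = Re (quad c X Z)" for X Z
  proof -
    have "S X Z = Re ((c 0 * z1 X + c 1 * z2 X) * z1 Z + (c 1 * z1 X + c 2 * z2 X) * z2 Z)"
      by (intro z_linear_eqI[of "\<lambda>Z. S X Z"] linearI) (simp_all add: S S5 c)
    also have "(c 0 * z1 X + c 1 * z2 X) * z1 Z + (c 1 * z1 X + c 2 * z2 X) * z2 Z = quad c X Z"
      by (simp add: quad_def algebra_simps)
    finally show ?thesis .
  qed
  have "A = chart_S2 c"
    unfolding chart_S2_def sym_part_def
  proof (rule tri_eqI)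
    show "length xs \<noteq> 3 \<Longrightarrow> A xs = 0" for xs using typed_D(4)[OF A] by (simp add: tensors_3)
    show "A [X, Y, Z] = (Y \<bullet> e 5) * Re (quad c X Z) - (Z \<bullet> e 5) * Re (quad c X Y)" for X Y Z
      unfolding quad[symmetric] S_def by (rule typed_vertical(2)[OF A]) simp
  qed
  then show ?thesis by blast
qed

text \<open>Under \<open>rot1\<close> the coefficient of z1 z2 is multiplied by i and those of the
  squares by -1 and 1, whence \<open>m = 1\<close>.\<close>

lemma irreducible_typed8: "irreducible_module G (typed (-1) 0)"
proof (rule irreducible_chart[where C = chart_S2 and n = 3 and m = 1
      and T = "{\<lambda>k. [-1, \<i>, 1] ! k}"
      and h = "\<lambda>k j. [[9, -24, 16], [12, -7, -12], [16, 24, 9]] ! k ! j / 25" and v = "chart_S2 (\<lambda>_. 1)"])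
  let ?w = "\<lambda>k. [-1, \<i>, 1] ! k :: complex"
  show "is_module G (typed (-1) 0)" by (rule is_module_typed)
  show "typed (-1) 0 \<subseteq> range chart_S2" using typed8_coords by blast
  show "chart_S2 (\<lambda>_. 1) \<in> typed (-1) 0"
    unfolding chart_S2_def
    by (rule sym_part_typed; (intro linearI)?) (simp_all add: quad_def z_simps sum_1_5 algebra_simps)
  have "chart_S2 (\<lambda>_. 1) [e 1, e 5, e 1] = 1" by (simp add: chart_S2_tri quad_def)
  then show "chart_S2 (\<lambda>_. 1) \<noteq> 0" by (metis zero_fun_apply zero_neq_one)
  show "linear chart_S2"
    unfolding chart_S2_tri[abs_def]
    by (rule linear_tri_Re) (simp_all add: quad_def scaleR_conv_of_real algebra_simps)
  show "chart_S2 c = chart_S2 d" if "\<And>k. k < 3 \<Longrightarrow> c k = d k" for c d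
    using that[of 0] that[of 1] that[of 2] by (simp add: chart_S2_tri quad_def)
  have "pull rot1 (chart_S2 c) = chart_S2 (\<lambda>k. ?w k * c k)" for c
    unfolding chart_S2_tri pull_tri
    by (intro arg_cong[of _ _ tri] ext arg_cong[of _ _ Re]) (simp add: quad_def algebra_simps)
  then show "\<exists>g\<in>G. \<forall>c. pull g (chart_S2 c) = chart_S2 (\<lambda>k. w k * c k)" if "w \<in> {?w}" for w
    using that rots_in_G by blast
  have "pull rot (chart_S2 c) =
      chart_S2 (\<lambda>k. \<Sum>j<3. of_real ([[9, -24, 16], [12, -7, -12], [16, 24, 9]] ! k ! j / 25) * c j)" for c
  proof -
    have "quad c (rot X) (rot Y) =
        quad (\<lambda>k. \<Sum>j<3. of_real ([[9, -24, 16], [12, -7, -12], [16, 24, 9]] ! k ! j / 25) * c j) X Y" for X Y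
      by (rule quad_rot) (simp_all add: lt_numeral field_simps)
    then show ?thesis unfolding chart_S2_tri pull_tri by simp
  qed
  then show "\<exists>g\<in>G. \<forall>c. pull g (chart_S2 c) =
      chart_S2 (\<lambda>k. \<Sum>j<3. of_real ([[9, -24, 16], [12, -7, -12], [16, 24, 9]] ! k ! j / 25) * c j)"
    using rots_in_G by blast
  show "separates {?w} 3 m"
    if m: "m < 3" for m :: nat
  proof -
    \<comment> \<open>For the eigenvalues s = 1 and s = -1 the projection averages (w/s)^k over k <
      4; for i it is (1 - w^2)/2.\<close>
    consider "m = 0" | "m = 1" | "m = 2" using m unfolding lt_cases by blast
    then show ?thesis
    proof cases
      case 1
      show ?thesis
        by (rule separatesI[of ?w _ _ "1/4" "-1/4" "1/4" "-1/4"]) (auto simp: 1 lt_cases)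
    next
      case 2
      show ?thesis
        by (rule separatesI[of ?w _ _ "1/2" 0 "-1/2" 0]) (auto simp: 2 lt_cases)
    next
      case 3
      show ?thesis
        by (rule separatesI[of ?w _ _ "1/4" "1/4" "1/4" "1/4"]) (auto simp: 3 lt_cases)
    qed
  qed
qed (auto simp: lt_cases)

text \<open>Identifying \<open>cnj z2\<close> and \<open>- cnj z1\<close> with \<open>z1\<close> and \<open>z2\<close>, which is compatible with \<open>SU(2)\<close>, turns this tensor
  into the binary cubic \<open>c\<^sub>0 z1\<^sup>3 + 3 c\<^sub>1 z1\<^sup>2 z2 - 3 c\<^sub>2 z1 z2\<^sup>2 - c\<^sub>3 z2\<^sup>3\<close>. The coefficients in \<open>cubic_rot\<close> come from
  substituting the rotation into this cubic.\<close>

definition cubic :: "(nat \<Rightarrow> complex) \<Rightarrow> vec5 \<Rightarrow> vec5 \<Rightarrow> vec5 \<Rightarrow> complex" where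
  "cubic c X Y Z =
     c 0 * (z1 X * (z1 Y * cnj (z2 Z) - z1 Z * cnj (z2 Y)))
     + c 1 * (z1 X * (z2 Y * cnj (z2 Z) - z2 Z * cnj (z2 Y)) + z2 X * (z1 Y * cnj (z2 Z) - z1 Z * cnj (z2 Y))
         - z1 X * (z1 Y * cnj (z1 Z) - z1 Z * cnj (z1 Y)))
     + c 2 * (z2 X * (z1 Y * cnj (z1 Z) - z1 Z * cnj (z1 Y)) + z1 X * (z2 Y * cnj (z1 Z) - z2 Z * cnj (z1 Y))
         - z2 X * (z2 Y * cnj (z2 Z) - z2 Z * cnj (z2 Y)))
     + c 3 * (z2 X * (z2 Y * cnj (z1 Z) - z2 Z * cnj (z1 Y)))"

lemma cubic_rot:
  assumes "k 0 = (27 * c 0 - 108 * c 1 - 144 * c 2 + 64 * c 3) / 125"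
    "k 1 = (36 * c 0 - 69 * c 1 + 8 * c 2 - 48 * c 3) / 125"
    "k 2 = (- 48 * c 0 - 8 * c 1 - 69 * c 2 - 36 * c 3) / 125"
    "k 3 = (- 64 * c 0 - 144 * c 1 + 108 * c 2 + 27 * c 3) / 125"
  shows "cubic c (rot X) (rot Y) (rot Z) = cubic k X Y Z"
  unfolding cubic_def assms z_rots complex_cnj_divide complex_cnj_add complex_cnj_diff complex_cnj_mult
    complex_cnj_numeral
  by algebra

definition chart_S3 :: "(nat \<Rightarrow> complex) \<Rightarrow> tensor" where
  "chart_S3 c = tri (\<lambda>X Y Z. Re (cubic c X Y Z))"

lemma linear_Re:
  assumes "\<And>X Y. F (X + Y) = F X + F Y" "\<And>k X. F (k *\<^sub>R X) = of_real k * F X"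
  shows "linear (\<lambda>X :: vec5. Re (F X))"
  by (intro linearI) (simp_all add: assms)

lemma chart_S3_tensors: "chart_S3 c \<in> tensors 3"
  unfolding chart_S3_def
  by (intro tri_tensors linear_Re) (simp_all add: cubic_def z_simps algebra_simps)

lemma typed9_coords:
  assumes A: "A \<in> typed 0 1"
  shows "A \<in> range chart_S3"
proof -
  note t = tensor3_simps[OF typed_D(4)[OF A]] and s = typed_D(5)[OF A] and hz = typed_horizontal[OF A]
  have c: "A [W, e 2, e 4] = A [W, e 1, e 3]" "A [W, e 2, e 3] = - A [W, e 1, e 4]" for W
    using typed_D(1)[OF A, of W "e 2" "e 4"] typed_D(1)[OF A, of W "e 2" "e 3"] s[of W "e 1" "e 4"]
    by (simp_all add: t)
  have d: "A [W, e 2, e 1] = - A [W, e 1, e 2]" "A [W, e 3, e 1] = - A [W, e 1, e 3]"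
    "A [W, e 4, e 1] = - A [W, e 1, e 4]" "A [W, e 3, e 2] = A [W, e 1, e 4]"
    "A [W, e 4, e 2] = - A [W, e 1, e 3]" "A [W, e 4, e 3] = - A [W, e 3, e 4]" for W
    unfolding s[of W "e 2" "e 1"] s[of W "e 3" "e 1"] s[of W "e 4" "e 1"] s[of W "e 3" "e 2"]
      s[of W "e 4" "e 2"] s[of W "e 4" "e 3"] c by simp_all
  have yy: "A [W, Y, Y] = 0" for W Y using s[of W Y Y] by simp
  have tr: "(\<Sum>i=1..5. A [e i, e i, W]) = 0" for W by (rule typed_D(7)[OF A])
  note cyc = typed_D(6)[OF A]
  \<comment> \<open>Four traces and four cyclic identities. The type and horizontality leave 16 real
    components, so 8 remain, the real dimension of four complex coordinates.\<close>
  have rel0: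
    "- A [e 2, e 1, e 2] - A [e 3, e 1, e 3] - A [e 4, e 1, e 4] = 0"
    "A [e 1, e 1, e 2] + A [e 3, e 1, e 4] - A [e 4, e 1, e 3] = 0"
    "A [e 1, e 1, e 3] - A [e 2, e 1, e 4] - A [e 4, e 3, e 4] = 0"
    "A [e 1, e 1, e 4] + A [e 2, e 1, e 3] + A [e 3, e 3, e 4] = 0"
    "- A [e 1, e 1, e 4] - A [e 2, e 1, e 3] + A [e 3, e 1, e 2] = 0"
    "A [e 1, e 1, e 3] - A [e 2, e 1, e 4] + A [e 4, e 1, e 2] = 0"
    "A [e 1, e 3, e 4] - A [e 3, e 1, e 4] + A [e 4, e 1, e 3] = 0"
    "A [e 2, e 3, e 4] - A [e 3, e 1, e 3] - A [e 4, e 1, e 4] = 0"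
    using tr[of "e 1"] tr[of "e 2"] tr[of "e 3"] tr[of "e 4"] cyc[of "e 1" "e 2" "e 3"]
      cyc[of "e 1" "e 2" "e 4"] cyc[of "e 1" "e 3" "e 4"] cyc[of "e 2" "e 3" "e 4"]
    unfolding sum_1_5 by (simp_all add: c d hz yy)
  have rel: "A [e 1, e 3, e 4] = - A [e 1, e 1, e 2]" "A [e 2, e 3, e 4] = - A [e 2, e 1, e 2]"
    "A [e 2, e 1, e 3] = A [e 3, e 1, e 2] - A [e 1, e 1, e 4]"
    "A [e 2, e 1, e 4] = A [e 1, e 1, e 3] + A [e 4, e 1, e 2]"
    "A [e 4, e 1, e 3] = A [e 1, e 1, e 2] + A [e 3, e 1, e 4]"
    "A [e 4, e 1, e 4] = - A [e 2, e 1, e 2] - A [e 3, e 1, e 3]"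
    "A [e 3, e 3, e 4] = - A [e 3, e 1, e 2]" "A [e 4, e 3, e 4] = - A [e 4, e 1, e 2]"
    using rel0 by argo+
  \<comment> \<open>Obtained by evaluating \<open>cubic\<close> on the frame and solving for its
    coefficients; for instance the value at [e 1, e 1, e 3] is the real part of c 0 - c 2.\<close>
  define k where "k = (\<lambda>j. [Complex (A [e 1, e 1, e 3] + A [e 4, e 1, e 2] / 2) (A [e 1, e 1, e 4] - A [e 3, e 1, e 2] / 2),
    Complex (- A [e 2, e 1, e 2] / 2) (- A [e 1, e 1, e 2] / 2),
    Complex (A [e 4, e 1, e 2] / 2) (A [e 3, e 1, e 2] / 2),
    Complex (- A [e 3, e 1, e 3] - A [e 2, e 1, e 2] / 2) (A [e 3, e 1, e 4] + A [e 1, e 1, e 2] / 2)] ! j)"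
  have k: "k 0 = Complex (A [e 1, e 1, e 3] + A [e 4, e 1, e 2] / 2) (A [e 1, e 1, e 4] - A [e 3, e 1, e 2] / 2)"
    "k 1 = Complex (- A [e 2, e 1, e 2] / 2) (- A [e 1, e 1, e 2] / 2)"
    "k 2 = Complex (A [e 4, e 1, e 2] / 2) (A [e 3, e 1, e 2] / 2)"
    "k 3 = Complex (- A [e 3, e 1, e 3] - A [e 2, e 1, e 2] / 2) (A [e 3, e 1, e 4] + A [e 1, e 1, e 2] / 2)"
    by (simp_all add: k_def)
  have contract_forms: "contract W B \<in> forms 2" if "B \<in> spaceA" for B W
  proof -
    have "B [W, X, X] = 0" for X using spaceA_swap[OF that, of W X X] by simp
    then show ?thesis
      using spaceA_tensors[OF that] by (auto simp: forms_2 tensors_2 tensors_3 contract_def)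
  qed
  have B: "chart_S3 k \<in> spaceA"
    unfolding spaceA_iff
  proof (intro conjI allI chart_S3_tensors)
    fix X Y Z
    have "cubic k X Z Y = - cubic k X Y Z" by (simp add: cubic_def algebra_simps)
    then show "chart_S3 k [X, Z, Y] = - chart_S3 k [X, Y, Z]" by (simp add: chart_S3_def)
  qed
  have eq: "contract (e i) A = contract (e i) (chart_S3 k)" if "i \<in> {1, 2, 3, 4, 5}" for i
    using that
    by (intro form2_frame_eqI contract_forms B typed_D(3)[OF A])
      (auto simp: contract_def chart_S3_def cubic_def c hz rel k)
  have "A = chart_S3 k"
  proof (rule tensor3_frame_eqI[OF typed_D(4)[OF A] chart_S3_tensors])
    fix i j l :: nat assume "i \<in> {1..5}"
    then have "i \<in> {1, 2, 3, 4, 5}" by force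
    from fun_cong[OF eq[OF this], of "[e j, e l]"]
    show "A [e i, e j, e l] = chart_S3 k [e i, e j, e l]" by (simp add: contract_def)
  qed
  then show ?thesis by blast
qed

text \<open>Two torus elements are needed, because i and -i both occur as eigenvalues of each and a
  real polynomial cannot separate them. \<open>rot1\<close> isolates the coordinates 0 and 2, where
  it acts by -1 and 1, and \<open>rot2\<close> the coordinates 1 and 3.\<close>

lemma irreducible_typed9: "irreducible_module G (typed 0 1)"
proof (rule irreducible_chart[where C = chart_S3 and n = 4 and m = 1
      and T = "{\<lambda>k. [-1, \<i>, 1, - \<i>] ! k, \<lambda>k. [- \<i>, 1, \<i>, -1] ! k}"
      and h = "\<lambda>k j. [[27, -108, -144, 64], [36, -69, 8, -48], [-48, -8, -69, -36], [-64, -144, 108, 27]] ! k ! j / 125"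
      and v = "tri (\<lambda>X Y Z. Re (z1 X * (z1 Y * cnj (z2 Z) - z1 Z * cnj (z2 Y))))"])
  let ?v = "tri (\<lambda>X Y Z. Re (z1 X * (z1 Y * cnj (z2 Z) - z1 Z * cnj (z2 Y))))"
  let ?w1 = "\<lambda>k. [-1, \<i>, 1, - \<i>] ! k :: complex" and ?w2 = "\<lambda>k. [- \<i>, 1, \<i>, -1] ! k :: complex"
  show "is_module G (typed 0 1)" by (rule is_module_typed)
  show "typed 0 1 \<subseteq> range chart_S3" using typed9_coords by blast
  show "?v \<in> typed 0 1"
    by (rule typedI_tri; (intro linearI)?) (simp_all add: z_simps algebra_simps)
  have "?v [e 1, e 1, e 3] = 1" by simp
  then show "?v \<noteq> 0" by (metis zero_fun_apply zero_neq_one)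
  show "linear chart_S3"
    unfolding chart_S3_def[abs_def]
    by (rule linear_tri_Re) (simp_all add: cubic_def scaleR_conv_of_real algebra_simps)
  show "chart_S3 c = chart_S3 d" if "\<And>k. k < 4 \<Longrightarrow> c k = d k" for c d
    using that[of 0] that[of 1] that[of 2] that[of 3] by (simp add: chart_S3_def cubic_def)
  have "pull rot1 (chart_S3 c) = chart_S3 (\<lambda>k. ?w1 k * c k)"
    "pull rot2 (chart_S3 c) = chart_S3 (\<lambda>k. ?w2 k * c k)" for c
    unfolding chart_S3_def pull_tri
    by (intro arg_cong[of _ _ tri] ext arg_cong[of _ _ Re], simp add: cubic_def algebra_simps)+
  then show "\<exists>g\<in>G. \<forall>c. pull g (chart_S3 c) = chart_S3 (\<lambda>k. w k * c k)" if "w \<in> {?w1, ?w2}" for w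
    using that rots_in_G by blast
  have "pull rot (chart_S3 c) = chart_S3 (\<lambda>k. \<Sum>j<4. of_real ([[27, -108, -144, 64], [36, -69, 8, -48],
      [-48, -8, -69, -36], [-64, -144, 108, 27]] ! k ! j / 125) * c j)" for c
    unfolding chart_S3_def pull_tri
    by (intro arg_cong[of _ _ tri] ext arg_cong[of _ _ Re] cubic_rot) (simp_all add: lt_numeral field_simps)
  then show "\<exists>g\<in>G. \<forall>c. pull g (chart_S3 c) = chart_S3 (\<lambda>k. \<Sum>j<4. of_real ([[27, -108, -144, 64],
      [36, -69, 8, -48], [-48, -8, -69, -36], [-64, -144, 108, 27]] ! k ! j / 125) * c j)"
    using rots_in_G by blast
  show "separates {?w1, ?w2} 4 m"
    if m: "m < 4" for m :: nat
  proof -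
    consider "m = 0" | "m = 1" | "m = 2" | "m = 3" using m unfolding lt_cases by blast
    then show ?thesis
    proof cases
      case 1
      show ?thesis
        by (rule separatesI[of ?w1 _ _ "1/4" "-1/4" "1/4" "-1/4"]) (auto simp: 1 lt_cases)
    next
      case 2
      show ?thesis
        by (rule separatesI[of ?w2 _ _ "1/4" "1/4" "1/4" "1/4"]) (auto simp: 2 lt_cases)
    next
      case 3
      show ?thesis
        by (rule separatesI[of ?w1 _ _ "1/4" "1/4" "1/4" "1/4"]) (auto simp: 3 lt_cases)
    next
      case 4
      show ?thesis
        by (rule separatesI[of ?w2 _ _ "1/4" "-1/4" "1/4" "-1/4"]) (auto simp: 4 lt_cases)
    qed
  qed
qed (auto simp: lt_cases)

section \<open>Transport of irreducibility to all components of \<A>\<close>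

lemma irreducible_transport:
  assumes "irreducible_module G W" "linear f"
    and equiv: "\<And>C A. C \<in> G \<Longrightarrow> A \<in> W \<Longrightarrow> f (pull C A) = pull C (f A)"
    and inj: "\<And>A. A \<in> W \<Longrightarrow> f A = 0 \<Longrightarrow> A = 0"
  shows "irreducible_module G (f ` W)"
proof (rule irreducible_module_image[OF assms(1,2)])
  show "f (act B A) = act B (f A)" if "B \<in> G" "A \<in> W" for A B
    unfolding act_eq_pull using equiv[OF inv_in_G[OF that(1)] that(2)] .
  have "W \<noteq> {0}" "0 \<in> W"
    using assms(1) by (auto simp: irreducible_module_def is_module_def subspace_0)
  then show "\<exists>A\<in>W. f A \<noteq> 0" using inj by blast
qed

text \<open>A Hermitian form is determined by its real or by its imaginary part: putting \<phi> into
  one slot exchanges \<phi>-invariant 2-forms with \<phi>-invariant horizontal symmetric forms, and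
  orthogonality to \<Phi> with trace zero. Hence this component is another copy of the adjoint
  module.\<close>

lemma irreducible_typed6: "irreducible_module G (typed 1 0)"
proof -
  let ?f = "\<lambda>\<alpha> :: tensor. sym_part (\<lambda>X Y. \<alpha> [X, \<phi> Y])"
  have eval: "?f \<alpha> = tri (\<lambda>X Y Z. (Y \<bullet> e 5) * \<alpha> [X, \<phi> Z] - (Z \<bullet> e 5) * \<alpha> [X, \<phi> Y])" for \<alpha>
    by (simp add: sym_part_def)
  have "typed 1 0 = ?f ` Lambda2 e 3"
  proof (intro equalityI subsetI)
    fix A assume "A \<in> ?f ` Lambda2 e 3"
    then obtain \<alpha> where A: "A = ?f \<alpha>" and "\<alpha> \<in> Lambda2 e 3" by blast
    then have \<alpha>: "\<alpha> \<in> forms 2" "pull \<phi> \<alpha> = \<alpha>" "\<alpha> [e 1, e 2] + \<alpha> [e 3, e 4] = 0"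
      by (simp_all add: Lambda2_3_iff)
    then have t: "\<alpha> \<in> tensors 2" by (simp add: forms_2)
    have p: "\<alpha> [\<phi> X, \<phi> Y] = \<alpha> [X, Y]" for X Y using pull_eval(2)[of \<phi> \<alpha> X Y] \<alpha>(2) by simp
    have h: "\<alpha> [X, e 5] = 0" for X using p[of X "e 5"] by (simp add: tensor2_simps[OF t])
    show "A \<in> typed 1 0"
      unfolding A
    proof (rule sym_part_typed)
      show "linear (\<lambda>X. \<alpha> [X, \<phi> Y])" for Y using t by (simp add: tensors_2)
      show "\<alpha> [X, \<phi> Y] = \<alpha> [Y, \<phi> X]" for X Y
      proof -
        have "\<alpha> [X, \<phi> Y] = \<alpha> [\<phi> X, \<phi> (\<phi> Y)]" by (rule p[symmetric])
        also have "\<dots> = - \<alpha> [\<phi> X, Y]" by (simp add: phi_phi_hor hor_def tensor2_simps[OF t] h)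
        also have "\<dots> = \<alpha> [Y, \<phi> X]" using form2_swap[OF \<alpha>(1), of "\<phi> X" Y] by simp
        finally show ?thesis .
      qed
      show "(\<Sum>i=1..5. \<alpha> [e i, \<phi> (e i)]) = 0"
        using \<alpha>(3) form2_swap[OF \<alpha>(1), of "e 2" "e 1"] form2_swap[OF \<alpha>(1), of "e 4" "e 3"]
        unfolding sum_1_5 by (simp add: tensor2_simps[OF t])
      show "\<alpha> [X, \<phi> Y] = 1 * \<alpha> [\<phi> X, \<phi> (\<phi> Y)]" for X Y by (simp add: p)
    qed simp
  next
    fix A assume A: "A \<in> typed 1 0"
    note t = tensor3_simps[OF typed_D(4)[OF A]]
    have ty: "A [X, e 5, Z] = A [\<phi> X, e 5, \<phi> Z]" and sym: "A [X, e 5, Z] = A [Z, e 5, X]" for X Z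
      using typed_vertical(3,4)[OF A, of X Z] by simp_all
    have h: "A [X, e 5, e 5] = 0" "A [e 5, e 5, X] = 0" for X
      using ty[of X "e 5"] ty[of "e 5" X] by (simp_all add: t)
    \<comment> \<open>The minus sign compensates for \<phi> being applied twice.\<close>
    define \<alpha> where "\<alpha> = (\<lambda>xs. case xs of [X, Y] \<Rightarrow> - A [X, e 5, \<phi> Y] | _ \<Rightarrow> 0)"
    have \<alpha>_eval: "\<alpha> [X, Y] = - A [X, e 5, \<phi> Y]" for X Y by (simp add: \<alpha>_def)
    have pp: "A [\<phi> X, e 5, \<phi> (\<phi> Y)] = A [X, e 5, \<phi> Y]" for X Y by (rule ty[symmetric])
    have pp': "A [X, e 5, \<phi> (\<phi> Y)] = - A [X, e 5, Y]" for X Y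
      by (simp add: phi_phi_hor hor_def t h)
    have \<alpha>: "\<alpha> \<in> forms 2"
      unfolding forms_2 tensors_2
    proof (intro conjI allI impI)
      show "length xs \<noteq> 2 \<Longrightarrow> \<alpha> xs = 0" for xs by (auto simp: \<alpha>_def split: list.split)
      show "linear (\<lambda>W. \<alpha> [W, Y])" "linear (\<lambda>W. \<alpha> [X, W])" for X Y
        by (intro linearI; simp add: \<alpha>_eval t phi_add phi_scaleR)+
      show "\<alpha> [X, X] = 0" for X
        using ty[of X "\<phi> X"] sym[of "\<phi> X" X] by (simp add: \<alpha>_eval pp')
    qed
    have "\<alpha> \<in> Lambda2 e 3"
      unfolding Lambda2_3_iff
    proof (intro conjI \<alpha>)
      show "pull \<phi> \<alpha> = \<alpha>"
        using \<alpha> pull_forms_2[OF linear_phi \<alpha>]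
        by (intro tensor2_eqI) (simp_all add: forms_2 pull_eval \<alpha>_eval pp)
      have "A [e i, e i, e 5] = - A [e i, e 5, e i]" for i by (rule typed_D(5)[OF A])
      then have "(\<Sum>i=1..5. A [e i, e 5, e i]) = 0"
        using typed_D(7)[OF A, of "e 5"] by (simp add: sum_negf)
      then show "\<alpha> [e 1, e 2] + \<alpha> [e 3, e 4] = 0"
        using ty[of "e 1" "e 1"] ty[of "e 3" "e 3"] unfolding sum_1_5 by (simp add: \<alpha>_eval t h)
    qed
    moreover have "?f \<alpha> = A"
      unfolding eval
    proof (rule tri_eqI[symmetric])
      show "length xs \<noteq> 3 \<Longrightarrow> A xs = 0" for xs using typed_D(4)[OF A] by (simp add: tensors_3)
      show "A [X, Y, Z] = (Y \<bullet> e 5) * \<alpha> [X, \<phi> Z] - (Z \<bullet> e 5) * \<alpha> [X, \<phi> Y]" for X Y Z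
        unfolding \<alpha>_eval pp' using typed_vertical(2)[OF A, of X Y Z] by simp
    qed
    ultimately show "A \<in> ?f ` Lambda2 e 3" by blast
  qed
  moreover have "irreducible_module G (?f ` Lambda2 e 3)"
  proof (rule irreducible_transport[OF irreducible_Lambda2_3])
    show "linear ?f"
      unfolding eval by (intro linearI) (auto simp: tri_def fun_eq_iff algebra_simps split: list.split)
    show "?f (pull C \<alpha>) = pull C (?f \<alpha>)" if "C \<in> G" for C \<alpha>
      unfolding eval pull_tri by (simp add: pull_eval G_D[OF that])
    fix \<alpha> assume L: "\<alpha> \<in> Lambda2 e 3" and z: "?f \<alpha> = 0"
    have \<alpha>: "\<alpha> \<in> forms 2" using L by (simp add: Lambda2_3_iff)
    then have t: "\<alpha> \<in> tensors 2" by (simp add: forms_2)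
    have "\<alpha> [X, \<phi> Z] = 0" for X Z
    proof -
      have "\<alpha> [X, 0] = 0" by (simp add: tensor2_simps[OF t])
      then show ?thesis using fun_cong[OF z, of "[X, e 5, \<phi> (\<phi> (\<phi> Z))]"] fun_cong[OF z, of "[X, e 5, Z]"]
        by (simp add: eval)
    qed
    from this[of _ "\<phi> _"] have "\<alpha> [X, hor Z] = 0" for X Z
      unfolding phi_phi_hor by (simp add: tensor2_simps[OF t])
    moreover have "\<alpha> [X, e 5] = 0" for X
      using form2_swap[OF \<alpha>, of "e 5" X] Lambda2_horizontal[of 3 \<alpha> X] L by simp
    ultimately have "\<alpha> [X, Z] = 0" for X Z
      using tensor2_simps(4)[OF t, of X Z "(Z \<bullet> e 5) *\<^sub>R e 5"] by (simp add: hor_def tensor2_simps[OF t])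
    then show "\<alpha> = 0" using t subspace_0[OF subspace_tensors] by (intro tensor2_eqI) simp_all
  qed
  ultimately show ?thesis by simp
qed

lemma pull_eta: "C \<in> G \<Longrightarrow> pull C (eta e) = eta e"
  by (intro tensor1_eqI pull_tensors G_linear eta_tensors) (simp_all add: pull_eval G_D)

lemma pull_Phi: "C \<in> G \<Longrightarrow> pull C (Phi e) = Phi e"
  using Phi_forms pull_forms_2[OF G_linear Phi_forms, of C]
  by (intro tensor2_eqI) (simp_all add: forms_2 pull_eval G_D(2) flip: G_D(4))

lemma irreducible_Lambda1_1: "irreducible_module G (Lambda1 e 1)"
proof -
  have "eta e [e 5] = 1" by simp
  then have "eta e \<noteq> 0" by (metis zero_fun_apply zero_neq_one)
  then show ?thesis
    by (simp add: Lambda1_def) (intro irreducible_module_span_singleton; simp add: act_eq_pull pull_eta inv_in_G)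
qed

lemma irreducible_Lambda2_1: "irreducible_module G (Lambda2 e 1)"
proof -
  have "Phi e [e 1, e 2] = 1" by simp
  then have "Phi e \<noteq> 0" by (metis zero_fun_apply zero_neq_one)
  then show ?thesis
    by (simp add: Lambda2_def) (intro irreducible_module_span_singleton; simp add: act_eq_pull pull_Phi inv_in_G)
qed

lemma irreducible_tau:
  assumes W: "irreducible_module G W" and sub: "W \<subseteq> spaceA"
  shows "irreducible_module G (tau ` W)"
proof (rule irreducible_transport[OF W linear_tau])
  show "tau (pull C A) = pull C (tau A)" for C A
    by (auto simp: tau_def pull_def fun_eq_iff split: list.split)
qed (use sub tau_inj_on_spaceA in blast)

lemma theta1_inj:
  assumes "\<alpha> \<in> forms 1" "theta1 \<alpha> = 0"
  shows "\<alpha> = 0"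
proof (rule tensor1_eqI)
  have \<alpha>: "\<alpha> \<in> tensors 1" using assms by (simp add: forms_1)
  then show "\<alpha> \<in> tensors 1" "0 \<in> tensors 1" using subspace_0[OF subspace_tensors] by auto
  show "\<alpha> [X] = 0 [X]" for X using theta1_trace[OF \<alpha>, of X] unfolding assms(2) by simp
qed

lemma Lambda1_subset: "i \<in> {1, 2} \<Longrightarrow> Lambda1 e i \<subseteq> forms 1"
  using span_minimal[OF _ subspace_tensors[of 1], of "{eta e}"] eta_tensors
  by (auto simp: Lambda1_def forms_1)

lemma irreducible_compA_1:
  assumes "j \<in> {1..2}"
  shows "irreducible_module G (compA e 1 j)"
proof -
  have j: "j = 1 \<or> j = 2" using assms by force
  have "irreducible_module G (theta1 ` Lambda1 e j)"
  proof (rule irreducible_transport[OF _ linear_theta1])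
    show "irreducible_module G (Lambda1 e j)"
      using j irreducible_Lambda1_1 irreducible_Lambda1_2 by auto
    show "theta1 (pull C \<alpha>) = pull C (theta1 \<alpha>)" if "C \<in> G" for C \<alpha>
      by (auto simp: theta1_def pull_def fun_eq_iff G_D(2)[OF that] split: list.split)
    show "\<alpha> = 0" if "\<alpha> \<in> Lambda1 e j" "theta1 \<alpha> = 0" for \<alpha>
      using that Lambda1_subset[of j] j theta1_inj by blast
  qed
  then show ?thesis by (simp add: compA_def)
qed

lemma pull_wedge_1_2:
  assumes C: "C \<in> G" and \<alpha>: "\<alpha> \<in> tensors 1" and \<beta>: "\<beta> \<in> forms 2"
  shows "wedge 1 2 (pull C \<alpha>) (pull C \<beta>) = pull C (wedge 1 2 \<alpha> \<beta>)"
proof (rule tensor3_eqI)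
  have p: "pull C \<beta> \<in> forms 2" "pull C \<alpha> \<in> tensors 1"
    using pull_forms_2 pull_tensors G_linear[OF C] \<alpha> \<beta> by auto
  show "wedge 1 2 (pull C \<alpha>) (pull C \<beta>) \<in> tensors 3" "pull C (wedge 1 2 \<alpha> \<beta>) \<in> tensors 3"
    using wedge_1_2_forms[OF p(2,1)] pull_tensors[OF G_linear[OF C], of _ 3] wedge_1_2_forms[OF \<alpha> \<beta>]
    by (simp_all add: forms_3)
  show "wedge 1 2 (pull C \<alpha>) (pull C \<beta>) [X, Y, Z] = pull C (wedge 1 2 \<alpha> \<beta>) [X, Y, Z]" for X Y Z
    by (simp add: wedge_1_2[OF p(1)] wedge_1_2[OF \<beta>] pull_eval)
qed

lemma hodge_Phi: "hodge e 2 (Phi e) = wedge 1 2 (eta e) (Phi e)"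
  by (intro form3_frame_eqI hodge_2_forms wedge_1_2_forms eta_tensors Phi_forms)
    (simp_all add: hodge_2_frame[OF Phi_forms] wedge_eta_form2[OF Phi_forms])

text \<open>On these spaces the Hodge operator is the wedge product with \<eta> up to sign, and
  \<eta> is fixed by the group; so equivariance follows without the invariance of the volume
  form.\<close>

lemma irreducible_Lambda3_123:
  assumes "j \<in> {1, 2, 3}"
  shows "irreducible_module G (Lambda3 e j)"
  unfolding Lambda3_def
proof (rule irreducible_transport[OF _ linear_hodge])
  show irr: "irreducible_module G (Lambda2 e j)"
    using assms irreducible_Lambda2_1 irreducible_Lambda2_2 irreducible_Lambda2_3 by auto
  have sub: "Lambda2 e j \<subseteq> forms 2" using assms Lambda2_subset[of j] by auto
  obtain c where c: "hodge e 2 \<alpha> = c *\<^sub>R wedge 1 2 (eta e) \<alpha>" if "\<alpha> \<in> Lambda2 e j" for \<alpha>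
  proof -
    consider "j = 1" | "j = 2" | "j = 3" using assms by blast
    then show ?thesis
    proof cases
      case 1
      then show ?thesis
        by (intro that[of 1])
          (auto simp: Lambda2_def span_singleton linear_scale[OF linear_hodge] linear_scale[OF linear_wedge] hodge_Phi)
    next
      case 2
      then show ?thesis by (intro that[of 1]) (simp add: Lambda2_def)
    next
      case 3
      then show ?thesis by (intro that[of "-1"]) (simp add: Lambda2_def)
    qed
  qed
  fix C \<alpha> assume C: "C \<in> G" and \<alpha>: "\<alpha> \<in> Lambda2 e j"
  have "pull C \<alpha> \<in> Lambda2 e j" using irr C \<alpha> by (simp add: irreducible_module_def is_module_G_iff)
  moreover have "wedge 1 2 (eta e) (pull C \<alpha>) = pull C (wedge 1 2 (eta e) \<alpha>)"
    using pull_wedge_1_2[OF C eta_tensors, of \<alpha>] \<alpha> sub by (auto simp: pull_eta[OF C])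
  ultimately show "hodge e 2 (pull C \<alpha>) = pull C (hodge e 2 \<alpha>)"
    using c[of \<alpha>] c[of "pull C \<alpha>"] \<alpha> by (simp add: linear_scale[OF linear_pull])
next
  show "\<alpha> = 0" if "\<alpha> \<in> Lambda2 e j" "hodge e 2 \<alpha> = 0" for \<alpha>
  proof (rule hodge_inj_on_forms_2[OF _ that(2)])
    show "\<alpha> \<in> forms 2" using that(1) Lambda2_subset[of j] assms by auto
  qed
qed

lemma Lambda2_4_eq: "Lambda2 e 4 = wedge 1 1 (eta e) ` Lambda1 e 2"
proof (intro equalityI subsetI)
  fix \<beta> assume \<beta>: "\<beta> \<in> Lambda2 e 4"
  then have f: "\<beta> \<in> forms 2" and p: "pull \<phi> \<beta> = 0" by (simp_all add: Lambda2_4_iff)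
  have c: "\<beta> [e 1, e 2] = 0" "\<beta> [e 1, e 3] = 0" "\<beta> [e 1, e 4] = 0" "\<beta> [e 2, e 3] = 0"
    "\<beta> [e 2, e 4] = 0" "\<beta> [e 3, e 4] = 0"
    using pull_phi_form2[OF f] unfolding p by simp_all
  \<comment> \<open>The sign arises because \<eta> is the left factor of the wedge product.\<close>
  define a where "a = - (\<Sum>i=1..5. \<beta> [e i, e 5] *\<^sub>R e i)"
  have "\<beta> [e 5, e 5] = 0" using f by (simp add: forms_2)
  then have a: "a \<bullet> e 5 = 0" "a \<bullet> e 1 = - \<beta> [e 1, e 5]" "a \<bullet> e 2 = - \<beta> [e 2, e 5]"
    "a \<bullet> e 3 = - \<beta> [e 3, e 5]" "a \<bullet> e 4 = - \<beta> [e 4, e 5]"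
    unfolding a_def sum_1_5 by (simp_all add: inner_simps)
  have "\<beta> = wedge 1 1 (eta e) (flat a)"
    by (intro form2_frame_eqI f wedge_1_1_forms eta_tensors flat_tensors) (simp_all add: wedge_1_1 a c)
  then show "\<beta> \<in> wedge 1 1 (eta e) ` Lambda1 e 2" using a(1) by (auto simp: Lambda1_2_eq)
next
  fix \<beta> assume "\<beta> \<in> wedge 1 1 (eta e) ` Lambda1 e 2"
  then obtain a where \<beta>: "\<beta> = wedge 1 1 (eta e) (flat a)" "a \<bullet> e 5 = 0" by (auto simp: Lambda1_2_eq)
  have f: "\<beta> \<in> forms 2" unfolding \<beta> by (intro wedge_1_1_forms eta_tensors flat_tensors)
  have "pull \<phi> \<beta> = 0"
    by (intro form2_frame_eqI pull_forms_2 linear_phi f subspace_0 subspace_forms_2)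
      (simp_all add: pull_phi_form2[OF f], simp_all add: \<beta> wedge_1_1)
  then show "\<beta> \<in> Lambda2 e 4" using f by (simp add: Lambda2_4_iff)
qed

text \<open>On the fourth space this replaces the Hodge operator by an expression in \<phi> and
  \<Phi>, with which the group is compatible by definition.\<close>

lemma hodge_eta_wedge:
  assumes "\<alpha> \<in> Lambda1 e 2"
  shows "hodge e 2 (wedge 1 1 (eta e) \<alpha>) = wedge 1 2 (pull \<phi> \<alpha>) (Phi e)"
proof -
  obtain a where a: "\<alpha> = flat a" "a \<bullet> e 5 = 0" using assms by (auto simp: Lambda1_2_eq)
  have f: "wedge 1 1 (eta e) (flat a) \<in> forms 2" by (intro wedge_1_1_forms eta_tensors flat_tensors)
  show ?thesis
    unfolding a(1)
    by (intro form3_frame_eqI hodge_2_forms wedge_1_2_forms pull_tensors linear_phi flat_tensors Phi_forms)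
      (simp_all add: hodge_2_frame[OF f] wedge_1_2[OF Phi_forms], simp_all add: wedge_1_1 pull_eval)
qed

lemma irreducible_Lambda3_4: "irreducible_module G (Lambda3 e 4)"
proof -
  have "Lambda3 e 4 = (\<lambda>\<alpha>. wedge 1 2 (pull \<phi> \<alpha>) (Phi e)) ` Lambda1 e 2"
    unfolding Lambda3_def Lambda2_4_eq image_image by (intro image_cong refl hodge_eta_wedge)
  moreover have "irreducible_module G ((\<lambda>\<alpha>. wedge 1 2 (pull \<phi> \<alpha>) (Phi e)) ` Lambda1 e 2)"
  proof (rule irreducible_transport[OF irreducible_Lambda1_2])
    show "linear (\<lambda>\<alpha>. wedge 1 2 (pull \<phi> \<alpha>) (Phi e))"
      using linear_compose[OF linear_pull linear_wedge_left] by (simp add: o_def)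
    show "wedge 1 2 (pull \<phi> (pull C \<alpha>)) (Phi e) = pull C (wedge 1 2 (pull \<phi> \<alpha>) (Phi e))"
      if C: "C \<in> G" and \<alpha>: "\<alpha> \<in> Lambda1 e 2" for C \<alpha>
    proof -
      have "pull \<phi> \<alpha> \<in> tensors 1"
        using Lambda1_subset[of 2] \<alpha> by (intro pull_tensors linear_phi) (auto simp: forms_1)
      then show ?thesis
        using pull_wedge_1_2[OF C _ Phi_forms, of "pull \<phi> \<alpha>"] by (simp add: pull_pull_phi[OF C] pull_Phi[OF C])
    qed
    fix \<alpha> assume \<alpha>: "\<alpha> \<in> Lambda1 e 2" and "wedge 1 2 (pull \<phi> \<alpha>) (Phi e) = 0"
    then have z: "hodge e 2 (wedge 1 1 (eta e) \<alpha>) = 0" by (simp add: hodge_eta_wedge)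
    obtain a where a: "\<alpha> = flat a" "a \<bullet> e 5 = 0" using \<alpha> by (auto simp: Lambda1_2_eq)
    have "wedge 1 1 (eta e) (flat a) = 0"
      using hodge_inj_on_forms_2[OF wedge_1_1_forms[OF eta_tensors flat_tensors]] z a by simp
    then have "wedge 1 1 (eta e) (flat a) [e 5, X] = 0" for X by simp
    then have "flat a [X] = 0" for X using a(2) by (simp add: wedge_1_1)
    then show "\<alpha> = 0"
      unfolding a(1) by (intro tensor1_eqI flat_tensors subspace_0[OF subspace_tensors]) simp
  qed
  ultimately show ?thesis by simp
qed

lemma Lambda3_subset: "Lambda3 e j \<subseteq> forms 3"
  using hodge_2_forms by (auto simp: Lambda3_def)

lemma compA_2_eq: "compA e 2 j = Lambda3 e j"
proof -
  have "theta2 e \<alpha> = \<alpha>" if "\<alpha> \<in> Lambda3 e j" for \<alpha>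
    using that Lambda3_subset[of j] by (intro theta2_id) (auto simp: forms_3)
  then show ?thesis by (simp add: compA_def image_def)
qed

lemma irreducible_compA_2:
  assumes "j \<in> {1..4}"
  shows "irreducible_module G (compA e 2 j)"
proof -
  have "j \<in> {1, 2, 3} \<or> j = 4" using assms by force
  then show ?thesis unfolding compA_2_eq using irreducible_Lambda3_123 irreducible_Lambda3_4 by blast
qed

lemma irreducible_theta3:
  assumes j: "j \<in> {1, 2, 3}"
  shows "irreducible_module G (theta3 e ` Lambda2 e j)"
proof (rule irreducible_transport[OF _ linear_theta3])
  show "irreducible_module G (Lambda2 e j)"
    using assms irreducible_Lambda2_1 irreducible_Lambda2_2 irreducible_Lambda2_3 by auto
  have sub: "\<alpha> \<in> forms 2" if "\<alpha> \<in> Lambda2 e j" for \<alpha> using that j Lambda2_subset[of j] by auto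
  show "theta3 e (pull C \<alpha>) = pull C (theta3 e \<alpha>)" if C: "C \<in> G" and "\<alpha> \<in> Lambda2 e j" for C \<alpha>
    unfolding theta3_eq[OF sub[OF that(2)]] theta3_eq[OF pull_forms_2[OF G_linear[OF C] sub[OF that(2)]]] pull_tri
    by (simp add: pull_eval G_D(6)[OF C])
  fix \<alpha> assume \<alpha>: "\<alpha> \<in> Lambda2 e j" and z: "theta3 e \<alpha> = 0"
  have "\<alpha> [Y, Z] = 0" for Y Z
    using theta3_e5[OF sub[OF \<alpha>] Lambda2_horizontal[OF j \<alpha>], of Y Z] z by simp
  then show "\<alpha> = 0"
    using sub[OF \<alpha>] subspace_0[OF subspace_tensors] by (intro tensor2_eqI) (auto simp: forms_2)
qed

text \<open>The group acts on tensors, not on vectors, so the parameter \<open>a\<close> is first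
  read as \<open>sharp\<close> of a 1-form.\<close>

lemma irreducible_theta45:
  assumes inj: "\<And>a. a \<bullet> e 5 = 0 \<Longrightarrow> theta45 p r a = 0 \<Longrightarrow> a = 0"
  shows "irreducible_module G (theta45 p r ` {a. a \<bullet> e 5 = 0})"
proof -
  have sharp: "sharp e (flat a) = a" for a
    using frame_expand[of a] by (simp add: sharp_def)
  have "theta45 p r ` {a. a \<bullet> e 5 = 0} = (\<lambda>\<alpha>. theta45 p r (sharp e \<alpha>)) ` Lambda1 e 2"
    by (simp add: Lambda1_2_eq image_image sharp)
  moreover have "irreducible_module G ((\<lambda>\<alpha>. theta45 p r (sharp e \<alpha>)) ` Lambda1 e 2)"
  proof (rule irreducible_transport[OF irreducible_Lambda1_2])
    have "linear (sharp e)"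
      by (intro linearI) (simp_all add: sharp_def sum.distrib scaleR_add_left scaleR_sum_right)
    then show "linear (\<lambda>\<alpha>. theta45 p r (sharp e \<alpha>))"
      using linear_compose[OF _ linear_theta45] by (auto simp: o_def)
    show "theta45 p r (sharp e (pull C \<alpha>)) = pull C (theta45 p r (sharp e \<alpha>))"
      if C: "C \<in> G" and \<alpha>: "\<alpha> \<in> Lambda1 e 2" for C \<alpha>
    proof -
      obtain a where a: "\<alpha> = flat a" using \<alpha> by (auto simp: Lambda1_2_eq)
      define b where "b = inv C a"
      have "a = C b" using bij_G[OF C] by (simp add: b_def bij_is_surj surj_f_inv_f)
      then have "a \<bullet> C Y = b \<bullet> Y" for Y using G_D(2)[OF C] by simp
      then have "pull C (theta45 p r a) = theta45 p r b"
        unfolding theta45_def pull_tri by (simp add: G_D(2,6)[OF C] flip: G_D(4)[OF C])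
      then show ?thesis unfolding a pull_flat[OF C] sharp b_def[symmetric] by simp
    qed
    fix \<alpha> assume "\<alpha> \<in> Lambda1 e 2" and z: "theta45 p r (sharp e \<alpha>) = 0"
    then obtain a where a: "\<alpha> = flat a" "a \<bullet> e 5 = 0" by (auto simp: Lambda1_2_eq)
    then have "a = 0" using inj z by (simp add: sharp)
    then show "\<alpha> = 0" using a linear_0[OF linear_flat] by simp
  qed
  ultimately show ?thesis by simp
qed

lemma irreducible_compA_3:
  assumes "j \<in> {1..9}"
  shows "irreducible_module G (compA e 3 j)"
proof -
  have "a = 0" if "a \<bullet> e 5 = 0" "theta45 1 (-1) a = 0" for a
  proof -
    \<comment> \<open>Component 4 is invisible to \<xi> in the first slot, so its injectivity comes
      from the \<Phi>-trace; for component 5 the value at [\<xi>, \<xi>, b] suffices.\<close>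
    have "a \<bullet> \<phi> (\<phi> a) = 0"
      using phi_trace_theta45[OF that(1), of "\<phi> a"] that(2) by (simp add: phi_trace_def)
    then show ?thesis using that(1) by simp
  qed
  moreover have "b = 0" if "b \<bullet> e 5 = 0" "theta45 2 2 b = 0" for b
    using theta45_e5[OF that(1), of 2 2 "e 5" b] that by simp
  ultimately have 45: "irreducible_module G (compA3 e 4)" "irreducible_module G (compA3 e 5)"
    unfolding compA3_theta45 by (intro irreducible_theta45; blast)+
  consider "j \<in> {1, 2, 3}" | "j = 4" | "j = 5" | "j = 6" | "j = 7" | "j = 8" | "j = 9"
    using assms by force
  then have "irreducible_module G (compA3 e j)"
    using irreducible_theta3 45 irreducible_typed6 irreducible_typed7 irreducible_typed8 irreducible_typed9
    by cases (simp_all add: compA3_theta3 compA3_typed)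
  then show ?thesis by (simp add: compA_def)
qed

section \<open>The space of torsion tensors\<close>

lemma direct_sum_forms_1: "direct_sum {1..2} (Lambda1 e) (forms 1)"
proof (rule direct_sumI)
  have sum2: "(\<Sum>i=1..2. f i) = f 1 + f (2::nat)" for f :: "nat \<Rightarrow> tensor"
    by (simp add: eval_nat_numeral One_nat_def)
  have sub: "subspace (forms 1)" using subspace_tensors by (simp add: forms_1)
  have cases: "i = 1 \<or> i = 2" if "i \<in> {1..2}" for i :: nat using that by force
  show "subspace (Lambda1 e i)" if "i \<in> {1..2}" for i
    using cases[OF that] irreducible_Lambda1_1 irreducible_Lambda1_2
    by (auto simp: irreducible_module_def is_module_def)
  show "(\<Sum>i=1..2. w i) \<in> forms 1" if "\<And>i. i \<in> {1..2} \<Longrightarrow> w i \<in> Lambda1 e i" for w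
    using that Lambda1_subset cases by (intro subspace_sum[OF sub]) blast
  show "\<exists>w. (\<forall>i\<in>{1..2}. w i \<in> Lambda1 e i) \<and> \<alpha> = (\<Sum>i=1..2. w i)" if \<alpha>: "\<alpha> \<in> forms 1" for \<alpha>
  proof -
    let ?w = "(\<lambda>_::nat. 0)(1 := \<alpha> [e 5] *\<^sub>R eta e, 2 := \<alpha> - \<alpha> [e 5] *\<^sub>R eta e)"
    have t: "\<alpha> - \<alpha> [e 5] *\<^sub>R eta e \<in> tensors 1"
      using \<alpha> eta_tensors by (intro subspace_diff subspace_scale subspace_tensors) (auto simp: forms_1)
    have "contract (e 5) (\<alpha> - \<alpha> [e 5] *\<^sub>R eta e) = 0"
    proof
      show "contract (e 5) (\<alpha> - \<alpha> [e 5] *\<^sub>R eta e) xs = 0 xs" for xs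
        using t by (cases xs) (auto simp: contract_def tensors_1)
    qed
    then have "?w 1 \<in> Lambda1 e 1" "?w 2 \<in> Lambda1 e 2"
      using t by (auto simp: Lambda1_def forms_1 xi_def span_base span_scale)
    then have "\<forall>i\<in>{1..2}. ?w i \<in> Lambda1 e i" using cases by metis
    moreover have "\<alpha> = (\<Sum>i=1..2. ?w i)" by (simp add: sum2)
    ultimately show ?thesis by blast
  qed
  show "w i = 0" if w: "\<And>i. i \<in> {1..2} \<Longrightarrow> w i \<in> Lambda1 e i" and s: "(\<Sum>i=1..2. w i) = 0"
    and i: "i \<in> {1..2}" for w i
  proof -
    obtain c where c: "w 1 = c *\<^sub>R eta e" using w[of 1] by (auto simp: Lambda1_def span_singleton)
    obtain a where a: "w 2 = flat a" "a \<bullet> e 5 = 0" using w[of 2] by (auto simp: Lambda1_2_eq)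
    have eq: "w 1 + w 2 = 0" using s by (simp add: sum2)
    have "c = 0" using fun_cong[OF eq, of "[e 5]"] a by (simp add: c)
    then have "w 1 = 0" using c by simp
    then show ?thesis using eq cases[OF i] by auto
  qed
qed simp

lemma direct_sum_compA:
  "direct_sum {1..2} (compA e 1) (theta1 ` forms 1)"
  "direct_sum {1..4} (compA e 2) (forms 3)"
  "direct_sum {1..9} (compA e 3) (spaceA3 e)"
proof -
  have eq: "compA e 1 = (\<lambda>j. theta1 ` Lambda1 e j)" by (simp add: compA_def fun_eq_iff)
  show "direct_sum {1..2} (compA e 1) (theta1 ` forms 1)"
    unfolding eq by (rule direct_sum_image[OF direct_sum_forms_1 _ linear_theta1 theta1_inj]) auto
  have "compA e 2 = Lambda3 e" by (simp add: fun_eq_iff compA_2_eq)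
  then show "direct_sum {1..4} (compA e 2) (forms 3)" using direct_sum_forms_3 by simp
  have "compA e 3 = compA3 e" by (simp add: fun_eq_iff compA_def)
  then show "direct_sum {1..9} (compA e 3) (spaceA3 e)" using direct_sum_spaceA3 by simp
qed

text \<open>The two terms of \<open>theta1\<close> with \<alpha>(Z) cancel under
  \<open>tau\<close>.\<close>

lemma spaceT1_eq: "spaceT1 = tau ` (theta1 ` forms 1)"
proof (intro equalityI subsetI)
  fix T assume "T \<in> tau ` (theta1 ` forms 1)"
  then obtain \<alpha> where \<alpha>: "T = tau (theta1 \<alpha>)" "\<alpha> \<in> forms 1" by blast
  then have "T \<in> spaceT" using tau_spaceA theta1_spaceA by (auto simp: forms_1)
  then show "T \<in> spaceT1"
    using \<alpha> by (auto simp: spaceT1_def inner_commute intro!: bexI[of _ \<alpha>])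
next
  fix T assume "T \<in> spaceT1"
  then obtain \<alpha> where T: "T \<in> spaceT" "\<alpha> \<in> forms 1"
    "\<And>X Y Z. T [X, Y, Z] = \<alpha> [X] * (Y \<bullet> Z) - \<alpha> [Y] * (X \<bullet> Z)"
    unfolding spaceT1_def by blast
  have "T = tau (theta1 \<alpha>)"
    using T(2) theta1_spaceA[of \<alpha>]
    by (intro tensor3_eqI spaceT_tensors[OF T(1)] tau_tensors spaceA_tensors)
      (simp_all add: forms_1 T(3) inner_commute)
  then show "T \<in> tau ` (theta1 ` forms 1)" using T(2) by blast
qed

lemma tau_forms_3:
  assumes A: "A \<in> forms 3"
  shows "tau A = 2 *\<^sub>R A"
proof (rule tensor3_eqI)
  show t: "tau A \<in> tensors 3" "2 *\<^sub>R A \<in> tensors 3"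
    using A tau_tensors subspace_scale[OF subspace_tensors] by (simp_all add: forms_3)
  show "tau A [X, Y, Z] = (2 *\<^sub>R A) [X, Y, Z]" for X Y Z
    using form3_swap(1)[OF A, where Y = Y and X = X and Z = Z] by simp
qed

lemma spaceT2_eq: "spaceT2 = tau ` forms 3"
proof (intro equalityI subsetI)
  fix T assume "T \<in> tau ` forms 3"
  then obtain A where A: "T = 2 *\<^sub>R A" "A \<in> forms 3" using tau_forms_3 by blast
  have "T \<in> tensors 3"
    unfolding A(1) using A(2) by (intro subspace_scale[OF subspace_tensors]) (simp add: forms_3)
  moreover have "T [X, Y, Z] + T [Y, X, Z] = 0" "T [X, Y, Z] + T [X, Z, Y] = 0" for X Y Z
    unfolding A(1) using form3_swap[OF A(2), where X = X and Y = Y and Z = Z] by simp_all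
  ultimately show "T \<in> spaceT2" by (simp add: spaceT2_def spaceT_def)
next
  fix T assume T: "T \<in> spaceT2"
  then have "T \<in> spaceT" and "T [X, Y, Z] + T [X, Z, Y] = 0" for X Y Z
    by (simp_all add: spaceT2_def)
  then have "T \<in> spaceT" and "T [X, Z, Y] = - T [X, Y, Z]" for X Y Z
    by (simp_all add: eq_neg_iff_add_eq_0 add.commute)
  then have f: "T \<in> forms 3"
    unfolding forms_3_iff using spaceT_tensors spaceT_swap by blast
  then have "(1/2) *\<^sub>R T \<in> forms 3" by (rule subspace_scale[OF subspace_forms_3])
  moreover from tau_forms_3[OF this] have "tau ((1/2) *\<^sub>R T) = T" by simp
  ultimately show "T \<in> tau ` forms 3" by (metis image_eqI)
qed

text \<open>The cyclic sum of \<open>tau A\<close> is a difference of two cyclic sums of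
  \<open>A\<close>, and skewness in the last two slots identifies the two traces. Conversely
  \<open>tau_inv\<close> turns each condition back into the other.\<close>

lemma spaceT3_eq: "spaceT3 e = tau ` spaceA3 e"
proof
  show "tau ` spaceA3 e \<subseteq> spaceT3 e"
  proof
    fix T assume "T \<in> tau ` spaceA3 e"
    then obtain A where T: "T = tau A" and A: "A \<in> spaceA3 e" by blast
    have "T \<in> spaceT" using T tau_spaceA spaceA3_D(1)[OF A] by blast
    moreover have "T [X, Y, Z] + T [Y, Z, X] + T [Z, X, Y] = 0" for X Y Z
      using spaceA3_D(4)[OF A, of X Y Z] spaceA3_D(4)[OF A, of Y X Z] unfolding T tau_eval by argo
    moreover have "(\<Sum>i=1..5. T [X, e i, e i]) = 0" for X
    proof -
      have "T [X, e i, e i] = A [e i, e i, X]" for i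
        using spaceA3_D(3)[OF A, of X "e i" "e i"] spaceA3_D(3)[OF A, of "e i" X "e i"] by (simp add: T)
      then show ?thesis using spaceA3_D(5)[OF A, of X] by simp
    qed
    ultimately show "T \<in> spaceT3 e" by (simp add: spaceT3_def)
  qed
  show "spaceT3 e \<subseteq> tau ` spaceA3 e"
  proof (rule tau_image_subset)
    show "spaceT3 e \<subseteq> spaceT" by (auto simp: spaceT3_def)
    fix T assume T: "T \<in> spaceT3 e"
    then have sp: "T \<in> spaceT" and cyc: "\<And>X Y Z. T [X, Y, Z] + T [Y, Z, X] + T [Z, X, Y] = 0"
      and tr: "\<And>X. (\<Sum>i=1..5. T [X, e i, e i]) = 0"
      by (auto simp: spaceT3_def)
    have "tau_inv T [X, Y, Z] + tau_inv T [Y, Z, X] + tau_inv T [Z, X, Y] = 0" for X Y Z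
      using cyc[of X Y Z] unfolding tau_inv_eval by argo
    moreover have "(\<Sum>i=1..5. tau_inv T [e i, e i, X]) = 0" for X
    proof -
      have "tau_inv T [e i, e i, X] = T [X, e i, e i]" for i
        using spaceT_swap[OF sp, of "e i" "e i" X] spaceT_swap[OF sp, of "e i" X "e i"] by simp
      then show ?thesis using tr by simp
    qed
    ultimately show "tau_inv T \<in> spaceA3 e"
      using tau_inv_spaceT(1)[OF sp] by (simp add: spaceA3_iff)
  qed
qed

lemma compT_eq: "compT e i = (\<lambda>j. tau ` compA e i j)"
  by (simp add: fun_eq_iff compT_def)

lemma compA_subset_spaceA:
  "j \<in> {1..2} \<Longrightarrow> compA e 1 j \<subseteq> spaceA" "j \<in> {1..4} \<Longrightarrow> compA e 2 j \<subseteq> spaceA"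
  "j \<in> {1..9} \<Longrightarrow> compA e 3 j \<subseteq> spaceA"
proof -
  show "compA e 1 j \<subseteq> spaceA" if "j \<in> {1..2}"
  proof -
    have "j \<in> {1, 2}" using that by force
    then show ?thesis using Lambda1_subset[of j] theta1_spaceA by (auto simp: compA_def forms_1)
  qed
  show "compA e 2 j \<subseteq> spaceA"
    using Lambda3_subset[of j] forms_3_spaceA by (auto simp: compA_2_eq)
  show "compA e 3 j \<subseteq> spaceA" if "j \<in> {1..9}"
    using compA3_subset[OF that] spaceA3_D(1) by (auto simp: compA_def)
qed

abbreviation "indices \<equiv> {1} \<times> {1..2} \<union> {2} \<times> {1..4} \<union> {3} \<times> {1..9::nat} :: (nat \<times> nat) set"

lemma irreducible_compT:
  assumes "(i, j) \<in> indices"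
  shows "irreducible_module G (compT e i j)"
  using assms irreducible_tau irreducible_compA_1[of j] irreducible_compA_2[of j] irreducible_compA_3[of j]
    compA_subset_spaceA[of j]
  by (auto simp: compT_def)

lemma direct_sum_compT: "direct_sum indices (\<lambda>(i, j). compT e i j) spaceT"
proof -
  let ?J = "\<lambda>i::nat. if i = 1 then {1..2} else if i = 2 then {1..4} else {1..9::nat}"
  have idx: "indices = Sigma {1, 2, 3} ?J" by (auto split: if_splits)
  have "direct_sum (Sigma {1, 2, 3} ?J) (\<lambda>(i, j). compA e i j) spaceA"
    by (rule direct_sum_Sigma[OF direct_sum_spaceA]) (auto simp: direct_sum_compA)
  then have "direct_sum indices (\<lambda>p. tau ` (case p of (i, j) \<Rightarrow> compA e i j)) (tau ` spaceA)"
    unfolding idx by (rule direct_sum_image[OF _ _ linear_tau tau_inj_on_spaceA]) auto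
  moreover have "(\<lambda>p. tau ` (case p of (i, j) \<Rightarrow> compA e i j)) = (\<lambda>(i, j). compT e i j)"
    by (auto simp: compT_def)
  ultimately show ?thesis by (simp add: tau_spaceA)
qed

lemma direct_sum_compT_parts:
  "direct_sum {1..2} (compT e 1) spaceT1" "direct_sum {1..4} (compT e 2) spaceT2"
  "direct_sum {1..9} (compT e 3) (spaceT3 e)"
proof -
  have sub: "theta1 ` forms 1 \<subseteq> spaceA" "forms 3 \<subseteq> spaceA" "spaceA3 e \<subseteq> spaceA"
    using theta1_spaceA forms_3_spaceA spaceA3_D(1) by (auto simp: forms_1)
  have "direct_sum J (\<lambda>j. tau ` compA e i j) (tau ` V)"
    if "direct_sum J (compA e i) V" "finite J" "V \<subseteq> spaceA" for i J V
    using that tau_inj_on_spaceA by (intro direct_sum_image linear_tau) auto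
  then show "direct_sum {1..2} (compT e 1) spaceT1" "direct_sum {1..4} (compT e 2) spaceT2"
    "direct_sum {1..9} (compT e 3) (spaceT3 e)"
    unfolding compT_eq spaceT1_eq spaceT2_eq spaceT3_eq using direct_sum_compA sub by simp_all
qed

end

theorem corollary2p1:
  fixes e :: "nat \<Rightarrow> real ^ 5"
  assumes "orthonormal_frame e"
  shows "direct_sum ({1} \<times> {1..2} \<union> {2} \<times> {1..4} \<union> {3} \<times> {1..9})
           (\<lambda>(i, j). compT e i j) spaceT \<and>
         (\<forall>(i, j) \<in> {1} \<times> {1..2} \<union> {2} \<times> {1..4} \<union> {3} \<times> {1..9}.
           irreducible_module (U2 e) (compT e i j)) \<and>
         direct_sum {1..2} (compT e 1) spaceT1 \<and>
         direct_sum {1..4} (compT e 2) spaceT2 \<and>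
         direct_sum {1..9} (compT e 3) (spaceT3 e)"
proof -
  interpret frame e using assms by unfold_locales
  show ?thesis
    using direct_sum_compT irreducible_compT direct_sum_compT_parts by blast
qed

end
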